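(* Consider the planar piecewise linear system $$\dot{\mathbf x}=\begin{cases}A_L\mathbf x+\mathbf b_L, & x_1\le 0,\\ A_R\mathbf x+\mathbf b_R, & x_1\ge 0,\end{cases}\qquad \mathbf x=(x_1,x_2)\in\mathbb R^2,$$ with $A_{L,R}=(a_{ij}^{L,R})$ real $2\times2$ matrices, $\mathbf b_{L,R}=(b_1^{L,R},b_2^{L,R})\in\mathbb R^2$ and $a_{12}^La_{12}^R>0$. Let $T_L,T_R$ and $D_L,D_R$ be the traces and determinants of $A_L,A_R$, and assume $T_L^2-4D_L<0$ and $T_R^2-4D_R<0$. Let $R(Y_1)$ be the resultant with respect to $Y_0$ of the polynomials $\widetilde F_{b^*}(Y_0,Y_1)$ and $\widetilde G_{b^*}(Y_0,Y_1)$ defined in the context, assume $R\not\equiv0$, and let $\ell$ be the number of roots of $R(Y_1)$, counted with multiplicity, in $\mathbb C\setminus\{Y_1\in\mathbb R:Y_1\le0\}$. Then the system has no more than $8-\ell$ (crossing) limit cycles.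
   Context: Parameters: $a_L=a_{12}^Lb_2^L-a_{22}^Lb_1^L$, $a_R=\dfrac{a_{12}^L}{a_{12}^R}(a_{12}^Rb_2^R-a_{22}^Rb_1^R)$, $b^*=a_{12}^Lb_1^R/a_{12}^R-b_1^L$. For $b\in\mathbb R$ put $m_0=a_L^2(a_R^2b+b^3D_R+a_Rb^2T_R)$, $m_1=-a_L^2b(2bD_R+a_RT_R)$, $m_2=-a_R^2(bD_L+a_LT_L)+bD_R(3a_L^2-b^2D_L+a_LbT_L)+a_R(a_L^2-b^2D_L)T_R$, $m_3=a_L^2bD_R$, $m_4=a_R^2D_L-D_R(a_L^2-b^2D_L+a_LbT_L)+a_RbD_LT_R$, $m_5=a_LD_RT_L-a_RD_LT_R-bD_LD_R$, and $F_b(y_0,y_1)=m_0+m_1(y_0+y_1)+m_2y_0y_1+m_3(y_0^2+y_1^2)+m_4(y_0y_1^2+y_0^2y_1)+m_5y_0^2y_1^2$. Let $W_L(y)=D_Ly^2-a_LT_Ly+a_L^2$ and $$G_b(y_0,y_1)=-\Big(y_1W_L(y_0)\frac{\partial F_b}{\partial y_0}(y_0,y_1)+y_0W_L(y_1)\frac{\partial F_b}{\partial y_1}(y_0,y_1)\Big).$$ Both $F_b$ and $G_b$ are symmetric in $(y_0,y_1)$; $\widetilde F_b,\widetilde G_b$ are the unique polynomials with $\widetilde F_b(y_0+y_1,y_0y_1)=F_b(y_0,y_1)$ and $\widetilde G_b(y_0+y_1,y_0y_1)=G_b(y_0,y_1)$. In particular $\widetilde F_b(Y_0,Y_1)=m_0+m_1Y_0+(m_2-2m_3)Y_1+m_3Y_0^2+m_4Y_0Y_1+m_5Y_1^2$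 and $\widetilde G_b$ has degree at most 3. Limit cycles: solutions are understood in Filippov's sense; a point of $\Sigma=\{x_1=0\}$ is a crossing point if the first components of the two linear fields there have strictly positive product. A crossing periodic orbit is a closed orbit meeting both sides of $\Sigma$ and meeting $\Sigma$ only at crossing points; a (crossing) limit cycle is a crossing periodic orbit isolated in the set of all crossing periodic orbits. *)

theory Defs
  imports "HOL-Analysis.Analysis" "HOL-Computational_Algebra.Computational_Algebra"
    "Subresultants.Resultant_Prelim"
begin

(* The theory of the resultant brings its own vectors along; keep $ for real ^ 'n. *)
no_notation Matrix.vec_index (infixl "$" 100)


section \<open>The piecewise linear system and its crossing limit cycles\<close>

definition affine_field :: "real^2^2 \<Rightarrow> real^2 \<Rightarrow> real^2 \<Rightarrow> real^2" where
  "affine_field A b x = A *v x + b"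

text \<open>On the switching line both affine fields are in force; Filippov's convention takes the
  segment between their values there.\<close>

definition filippov_field ::
  "real^2^2 \<Rightarrow> real^2 \<Rightarrow> real^2^2 \<Rightarrow> real^2 \<Rightarrow> real^2 \<Rightarrow> (real^2) set" where
  "filippov_field A_L b_L A_R b_R x =
     (if x $ 1 < 0 then {affine_field A_L b_L x}
      else if x $ 1 > 0 then {affine_field A_R b_R x}
      else convex hull {affine_field A_L b_L x, affine_field A_R b_R x})"

text \<open>A locally absolutely continuous curve satisfying the differential inclusion almost
  everywhere. Local absolute continuity is expressed by saying that the curve is an indefinite
  integral of a locally Lebesgue integrable \<open>v\<close>, which is then its derivative almost everywhere.\<close>

definition filippov_solution ::
  "real^2^2 \<Rightarrow> real^2 \<Rightarrow> real^2^2 \<Rightarrow> real^2 \<Rightarrow> (real \<Rightarrow> real^2) \<Rightarrow> bool" where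
  "filippov_solution A_L b_L A_R b_R x \<longleftrightarrow>
     (\<exists>v. (\<forall>s t. s \<le> t \<longrightarrow> v absolutely_integrable_on {s..t} \<and> (v has_integral x t - x s) {s..t}) \<and>
          (AE t in lebesgue. v t \<in> filippov_field A_L b_L A_R b_R (x t)))"

definition crossing_point ::
  "real^2^2 \<Rightarrow> real^2 \<Rightarrow> real^2^2 \<Rightarrow> real^2 \<Rightarrow> real^2 \<Rightarrow> bool" where
  "crossing_point A_L b_L A_R b_R p \<longleftrightarrow>
     p $ 1 = 0 \<and> affine_field A_L b_L p $ 1 * affine_field A_R b_R p $ 1 > 0"

definition crossing_periodic_orbit ::
  "real^2^2 \<Rightarrow> real^2 \<Rightarrow> real^2^2 \<Rightarrow> real^2 \<Rightarrow> (real^2) set \<Rightarrow> bool" where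
  "crossing_periodic_orbit A_L b_L A_R b_R \<Gamma> \<longleftrightarrow>
     (\<exists>x T. filippov_solution A_L b_L A_R b_R x \<and> T > 0 \<and> (\<forall>t. x (t + T) = x t) \<and> \<Gamma> = range x) \<and>
     (\<exists>p\<in>\<Gamma>. p $ 1 < 0) \<and> (\<exists>p\<in>\<Gamma>. p $ 1 > 0) \<and>
     (\<forall>p\<in>\<Gamma>. p $ 1 = 0 \<longrightarrow> crossing_point A_L b_L A_R b_R p)"

definition crossing_limit_cycle ::
  "real^2^2 \<Rightarrow> real^2 \<Rightarrow> real^2^2 \<Rightarrow> real^2 \<Rightarrow> (real^2) set \<Rightarrow> bool" where
  "crossing_limit_cycle A_L b_L A_R b_R \<Gamma> \<longleftrightarrow>
     crossing_periodic_orbit A_L b_L A_R b_R \<Gamma> \<and>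
     (\<exists>U. open U \<and> \<Gamma> \<subseteq> U \<and>
          (\<forall>\<Gamma>'. crossing_periodic_orbit A_L b_L A_R b_R \<Gamma>' \<and> \<Gamma>' \<subseteq> U \<longrightarrow> \<Gamma>' = \<Gamma>))"


section \<open>The parameters\<close>

definition par_aL :: "real^2^2 \<Rightarrow> real^2 \<Rightarrow> real" where
  "par_aL A_L b_L = A_L$1$2 * b_L$2 - A_L$2$2 * b_L$1"

definition par_aR :: "real^2^2 \<Rightarrow> real^2^2 \<Rightarrow> real^2 \<Rightarrow> real" where
  "par_aR A_L A_R b_R = A_L$1$2 / A_R$1$2 * (A_R$1$2 * b_R$2 - A_R$2$2 * b_R$1)"

definition par_bstar :: "real^2^2 \<Rightarrow> real^2 \<Rightarrow> real^2^2 \<Rightarrow> real^2 \<Rightarrow> real" where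
  "par_bstar A_L b_L A_R b_R = A_L$1$2 * b_R$1 / A_R$1$2 - b_L$1"


section \<open>The polynomial functions \<open>F\<close> and \<open>G\<close>\<close>

definition m0 :: "real \<Rightarrow> real \<Rightarrow> real \<Rightarrow> real \<Rightarrow> real \<Rightarrow> real \<Rightarrow> real \<Rightarrow> real" where
  "m0 a_L a_R T_L D_L T_R D_R b = a_L^2 * (a_R^2 * b + b^3 * D_R + a_R * b^2 * T_R)"

definition m1 :: "real \<Rightarrow> real \<Rightarrow> real \<Rightarrow> real \<Rightarrow> real \<Rightarrow> real \<Rightarrow> real \<Rightarrow> real" where
  "m1 a_L a_R T_L D_L T_R D_R b = - (a_L^2 * b * (2 * b * D_R + a_R * T_R))"

definition m2 :: "real \<Rightarrow> real \<Rightarrow> real \<Rightarrow> real \<Rightarrow> real \<Rightarrow> real \<Rightarrow> real \<Rightarrow> real" where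
  "m2 a_L a_R T_L D_L T_R D_R b =
     - (a_R^2 * (b * D_L + a_L * T_L)) + b * D_R * (3 * a_L^2 - b^2 * D_L + a_L * b * T_L)
     + a_R * (a_L^2 - b^2 * D_L) * T_R"

definition m3 :: "real \<Rightarrow> real \<Rightarrow> real \<Rightarrow> real \<Rightarrow> real \<Rightarrow> real \<Rightarrow> real \<Rightarrow> real" where
  "m3 a_L a_R T_L D_L T_R D_R b = a_L^2 * b * D_R"

definition m4 :: "real \<Rightarrow> real \<Rightarrow> real \<Rightarrow> real \<Rightarrow> real \<Rightarrow> real \<Rightarrow> real \<Rightarrow> real" where
  "m4 a_L a_R T_L D_L T_R D_R b =
     a_R^2 * D_L - D_R * (a_L^2 - b^2 * D_L + a_L * b * T_L) + a_R * b * D_L * T_R"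

definition m5 :: "real \<Rightarrow> real \<Rightarrow> real \<Rightarrow> real \<Rightarrow> real \<Rightarrow> real \<Rightarrow> real \<Rightarrow> real" where
  "m5 a_L a_R T_L D_L T_R D_R b = a_L * D_R * T_L - a_R * D_L * T_R - b * D_L * D_R"

definition F_fun ::
  "real \<Rightarrow> real \<Rightarrow> real \<Rightarrow> real \<Rightarrow> real \<Rightarrow> real \<Rightarrow> real \<Rightarrow> real \<Rightarrow> real \<Rightarrow> real" where
  "F_fun a_L a_R T_L D_L T_R D_R b y0 y1 =
     m0 a_L a_R T_L D_L T_R D_R b
     + m1 a_L a_R T_L D_L T_R D_R b * (y0 + y1)
     + m2 a_L a_R T_L D_L T_R D_R b * y0 * y1
     + m3 a_L a_R T_L D_L T_R D_R b * (y0^2 + y1^2)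
     + m4 a_L a_R T_L D_L T_R D_R b * (y0 * y1^2 + y0^2 * y1)
     + m5 a_L a_R T_L D_L T_R D_R b * y0^2 * y1^2"

definition W_L :: "real \<Rightarrow> real \<Rightarrow> real \<Rightarrow> real \<Rightarrow> real" where
  "W_L a_L T_L D_L y = D_L * y^2 - a_L * T_L * y + a_L^2"

definition G_fun ::
  "real \<Rightarrow> real \<Rightarrow> real \<Rightarrow> real \<Rightarrow> real \<Rightarrow> real \<Rightarrow> real \<Rightarrow> real \<Rightarrow> real \<Rightarrow> real" where
  "G_fun a_L a_R T_L D_L T_R D_R b y0 y1 =
     - (y1 * W_L a_L T_L D_L y0 * deriv (\<lambda>u. F_fun a_L a_R T_L D_L T_R D_R b u y1) y0
        + y0 * W_L a_L T_L D_L y1 * deriv (\<lambda>u. F_fun a_L a_R T_L D_L T_R D_R b y0 u) y1)"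


section \<open>Reduction to the elementary symmetric polynomials\<close>

text \<open>Real polynomials in \<open>Y\<^sub>0, Y\<^sub>1\<close> are elements of type \<open>real poly poly\<close>, the outer variable
  being \<open>Y\<^sub>0\<close> and the inner one \<open>Y\<^sub>1\<close>.\<close>

definition eval2 :: "real poly poly \<Rightarrow> real \<Rightarrow> real \<Rightarrow> real" where
  "eval2 P u v = poly (poly P [:u:]) v"

definition sym_reduct :: "(real \<Rightarrow> real \<Rightarrow> real) \<Rightarrow> real poly poly" where
  "sym_reduct H = (THE P. \<forall>y0 y1. eval2 P (y0 + y1) (y0 * y1) = H y0 y1)"

definition F_tilde ::
  "real \<Rightarrow> real \<Rightarrow> real \<Rightarrow> real \<Rightarrow> real \<Rightarrow> real \<Rightarrow> real \<Rightarrow> real poly poly" where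
  "F_tilde a_L a_R T_L D_L T_R D_R b = sym_reduct (F_fun a_L a_R T_L D_L T_R D_R b)"

definition G_tilde ::
  "real \<Rightarrow> real \<Rightarrow> real \<Rightarrow> real \<Rightarrow> real \<Rightarrow> real \<Rightarrow> real \<Rightarrow> real poly poly" where
  "G_tilde a_L a_R T_L D_L T_R D_R b = sym_reduct (G_fun a_L a_R T_L D_L T_R D_R b)"

text \<open>The constant \<open>resultant\<close> takes the value 1 on two zero polynomials (empty Sylvester matrix);
  the usual convention is that a resultant involving the zero polynomial vanishes.\<close>

definition resultant_Y0 :: "real poly poly \<Rightarrow> real poly poly \<Rightarrow> real poly" where
  "resultant_Y0 P Q = (if P = 0 \<or> Q = 0 then 0 else resultant P Q)"

text \<open>The descriptions by \<open>THE\<close> are proper.\<close>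

lemma eval2_diff: "eval2 (P - Q) u v = eval2 P u v - eval2 Q u v"
  by (simp add: eval2_def)

lemma eval2_eq_map_poly: "eval2 P u v = poly (map_poly (\<lambda>c. poly c v) P) u"
proof (induction P)
  case (pCons a P)
  have "map_poly (\<lambda>c. poly c v) (pCons a P) = pCons (poly a v) (map_poly (\<lambda>c. poly c v) P)"
    by (rule poly_eqI) (simp add: coeff_map_poly coeff_pCons split: nat.split)
  then show ?case using pCons.IH by (simp add: eval2_def)
qed (simp add: eval2_def)

lemma eval2_sym_zero:
  assumes "\<And>y0 y1. eval2 P (y0 + y1) (y0 * y1) = 0"
  shows "P = 0"
proof -
  have real_roots: "\<exists>y0 y1. y0 + y1 = u \<and> y0 * y1 = v" if "v \<le> 0" for u v :: real
  proof -
    define d where "d = sqrt (u^2 - 4 * v)"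
    have d: "d^2 = u^2 - 4 * v"
      using that zero_le_power2[of u] unfolding d_def by (intro real_sqrt_pow2) linarith
    have "(u + d) / 2 + (u - d) / 2 = u"
      by (simp add: field_simps)
    moreover have "(u + d) / 2 * ((u - d) / 2) = v"
      using d by (simp add: field_simps power2_eq_square)
    ultimately show ?thesis by blast
  qed
  have "poly (coeff P i) v = 0" if "v \<le> 0" for i v
  proof -
    have "poly (map_poly (\<lambda>c. poly c v) P) u = 0" for u
      using real_roots[OF that, of u] assms by (metis eval2_eq_map_poly)
    then have "map_poly (\<lambda>c. poly c v) P = 0"
      using poly_all_0_iff_0 by blast
    then have "coeff (map_poly (\<lambda>c. poly c v) P) i = 0"
      by simp
    then show ?thesis
      by (simp add: coeff_map_poly)
  qed
  then have "{..0} \<subseteq> {v. poly (coeff P i) v = 0}" for i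
    by auto
  then have "coeff P i = 0" for i
    using infinite_Iic[of "0::real"] poly_roots_finite finite_subset by metis
  then show ?thesis
    by (simp add: poly_eqI)
qed

lemma sym_reduct_eqI:
  assumes "\<And>y0 y1. eval2 P (y0 + y1) (y0 * y1) = H y0 y1"
  shows "sym_reduct H = P"
  unfolding sym_reduct_def
proof (rule the_equality)
  fix Q assume "\<forall>y0 y1. eval2 Q (y0 + y1) (y0 * y1) = H y0 y1"
  then have "Q - P = 0"
    using assms by (intro eval2_sym_zero) (simp add: eval2_diff)
  then show "Q = P" by simp
qed (use assms in blast)

lemma F_tilde_eq:
  "F_tilde a_L a_R T_L D_L T_R D_R b =
    [: [: m0 a_L a_R T_L D_L T_R D_R b,
          m2 a_L a_R T_L D_L T_R D_R b - 2 * m3 a_L a_R T_L D_L T_R D_R b,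
          m5 a_L a_R T_L D_L T_R D_R b :],
       [: m1 a_L a_R T_L D_L T_R D_R b, m4 a_L a_R T_L D_L T_R D_R b :],
       [: m3 a_L a_R T_L D_L T_R D_R b :] :]"
  unfolding F_tilde_def
  by (rule sym_reduct_eqI)
     (simp add: eval2_def F_fun_def algebra_simps power2_eq_square)

lemma F_fun_commute: "F_fun a_L a_R T_L D_L T_R D_R b y0 y1 = F_fun a_L a_R T_L D_L T_R D_R b y1 y0"
  by (simp add: F_fun_def algebra_simps)

lemma deriv_F_fun:
  "deriv (\<lambda>u. F_fun a_L a_R T_L D_L T_R D_R b u y1) y0 =
     m1 a_L a_R T_L D_L T_R D_R b
     + m2 a_L a_R T_L D_L T_R D_R b * y1
     + 2 * m3 a_L a_R T_L D_L T_R D_R b * y0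
     + m4 a_L a_R T_L D_L T_R D_R b * (y1^2 + 2 * y0 * y1)
     + 2 * m5 a_L a_R T_L D_L T_R D_R b * y0 * y1^2"
  unfolding F_fun_def
  by (rule DERIV_imp_deriv) (auto intro!: derivative_eq_intros simp: algebra_simps)

lemma deriv_F_fun':
  "deriv (\<lambda>u. F_fun a_L a_R T_L D_L T_R D_R b y0 u) y1 =
     m1 a_L a_R T_L D_L T_R D_R b
     + m2 a_L a_R T_L D_L T_R D_R b * y0
     + 2 * m3 a_L a_R T_L D_L T_R D_R b * y1
     + m4 a_L a_R T_L D_L T_R D_R b * (y0^2 + 2 * y1 * y0)
     + 2 * m5 a_L a_R T_L D_L T_R D_R b * y1 * y0^2"
  by (subst F_fun_commute) (rule deriv_F_fun)

lemma G_tilde_eq: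
  fixes a_L a_R T_L D_L T_R D_R b :: real
  defines "M1 \<equiv> m1 a_L a_R T_L D_L T_R D_R b" and "M2 \<equiv> m2 a_L a_R T_L D_L T_R D_R b"
    and "M3 \<equiv> m3 a_L a_R T_L D_L T_R D_R b" and "M4 \<equiv> m4 a_L a_R T_L D_L T_R D_R b"
    and "M5 \<equiv> m5 a_L a_R T_L D_L T_R D_R b"
  shows "G_tilde a_L a_R T_L D_L T_R D_R b = -
    [: [: 0,
          - 2 * a_L * T_L * M1 - a_L^2 * (2 * M2 - 4 * M3),
          D_L * (2 * M2 - 4 * M3) - 2 * a_L * T_L * M4 - 4 * a_L^2 * M5,
          4 * D_L * M5 :],
       [: a_L^2 * M1,
          D_L * M1 - a_L * T_L * (M2 + 2 * M3) - a_L^2 * M4,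
          3 * D_L * M4 - 2 * a_L * T_L * M5 :],
       [: a_L^2 * M2, 2 * D_L * M3 - a_L * T_L * M4 + 2 * a_L^2 * M5 :],
       [: a_L^2 * M4 :] :]"
  unfolding G_tilde_def
proof (rule sym_reduct_eqI, goal_cases)
  case (1 y0 y1)
  show ?case
    unfolding G_fun_def deriv_F_fun deriv_F_fun' W_L_def
      M1_def[symmetric] M2_def[symmetric] M3_def[symmetric] M4_def[symmetric] M5_def[symmetric]
    by (simp add: eval2_def algebra_simps power2_eq_square)
qed

end

theory Submission
  imports Defs
begin

text \<open>
  Measure a point \<open>(0, x\<^sub>2)\<close> of the switching line by its level \<open>y = - (a\<^sub>1\<^sub>2\<^sup>L x\<^sub>2 + b\<^sub>1\<^sup>L)\<close>. There the
  left field crosses the line with velocity \<open>- y\<close> and the right one with a positive multiple of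
  \<open>b - y\<close>, where \<open>b = b\<^sup>*\<close>; so an orbit enters the left half plane at a level \<open>y\<^sub>0 > max 0 b\<close> and
  leaves it at a level \<open>y\<^sub>1 < min 0 b\<close>.

  Reduction to two equations. On each side the motion is a rotation combined with a dilation about
  a focus. Comparing the modulus and the angle at both ends of an excursion, and showing that the
  excursion takes less than a full turn, yields a relation \<open>\<Psi> y\<^sub>1 - \<Psi> y\<^sub>0 = const\<close> in which
  \<open>\<Psi>' y = 2 D y / W y\<close> and the constant is the same for all excursions on that side
  (\<open>focus_pass.pass_relation\<close>). Since \<open>\<Psi>\<close> is monotone on both half lines, the return map on levels is
  increasing, hence an orbit that closes at all closes after one excursion to each side
  (\<open>crossing_orbit.double_match\<close>). Forward uniqueness of orbits that only cross the line makes an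
  orbit depend on its level alone (\<open>crossing_orbits_meeting\<close>). So it is enough to bound the number of
  pairs \<open>(y\<^sub>0, y\<^sub>1)\<close> that solve both the left and the right equation.

  Two applications of Rolle's theorem. The left equation describes a curve. Between two solutions on
  it the right equation has a critical point, and at a critical point \<open>F y\<^sub>0 y\<^sub>1 = 0\<close>
  (\<open>F_fun_identity\<close>, \<open>two_foci.F_zero_between_double_matches\<close>). Now walk along \<open>F = 0\<close> instead. In the
  coordinates \<open>\<zeta> = 1 / y\<^sub>0 + 1 / y\<^sub>1\<close>, \<open>\<eta> = 1 / (y\<^sub>0 y\<^sub>1)\<close> the relevant part of this set is contained
  in a line or a (possibly degenerate) ellipse, which the half plane \<open>\<eta> < 0\<close> cuts in a single arc.
  Between two points where this arc meets the left curve it is tangent to a level curve of the left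
  equation, and tangency means \<open>G = 0\<close> (\<open>two_foci.tangencies\<close>). Hence \<open>N \<ge> 2\<close> orbits give at least
  \<open>N - 2\<close> common zeros of the polynomials \<open>F\<close> and \<open>G\<close> in \<open>Y\<^sub>0 = y\<^sub>0 + y\<^sub>1\<close>, \<open>Y\<^sub>1 = y\<^sub>0 y\<^sub>1\<close> with
  \<open>Y\<^sub>1 < 0\<close>. That there is one arc and not two is what keeps the loss at \<open>2\<close>.

  Elimination. A value \<open>Y\<^sub>1 = c\<close> shared by \<open>k\<close> common zeros is a root of the resultant of multiplicity
  at least \<open>k\<close>, because multiplying the Sylvester matrix by a Vandermonde matrix produces \<open>k\<close> rows that
  vanish at \<open>c\<close> (\<open>common_zeros_power_dvd_resultant\<close>). The resultant has degree at most
  \<open>2 \<cdot> 3 = 6\<close>, and \<open>l\<close> of its roots are not on the half line \<open>Y\<^sub>1 \<le> 0\<close>, so \<open>N - 2 \<le> 6 - l\<close>.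
  The bound is obtained for the set of all crossing periodic orbits, which contains the limit cycles.
\<close>

section \<open>Common zeros of two polynomials and their resultant\<close>

text \<open>A vector in the kernel is the coefficient list of a polynomial of degree below \<open>N\<close> with \<open>N\<close> roots. The
powers decrease along a row because the columns of the Sylvester matrix belong to decreasing powers.\<close>

lemma vandermonde_det_nonzero:
  fixes f :: "nat \<Rightarrow> 'a::{field}"
  assumes inj: "inj_on f {..<N}"
  shows "Determinant.det (Matrix.mat N N (\<lambda>(i,j). f i ^ (N - 1 - j))) \<noteq> 0"
proof
  let ?V = "Matrix.mat N N (\<lambda>(i,j). f i ^ (N - 1 - j))"
  have V: "?V \<in> carrier_mat N N" by simp
  assume "Determinant.det ?V = 0"
  then obtain v where v: "v \<in> carrier_vec N" "v \<noteq> 0\<^sub>v N" and Vv: "?V *\<^sub>v v = 0\<^sub>v N"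
    using det_0_iff_vec_prod_zero_field[OF V] by blast
  define p where "p = (\<Sum>j<N. Polynomial.monom (vec_index v j) (N - 1 - j))"
  have root: "poly p (f i) = 0" if "i < N" for i
  proof -
    have "vec_index (?V *\<^sub>v v) i = (\<Sum>j<N. f i ^ (N - 1 - j) * vec_index v j)"
      using that v(1) by (auto simp: scalar_prod_def atLeast0LessThan intro!: sum.cong)
    moreover have "poly p (f i) = (\<Sum>j<N. f i ^ (N - 1 - j) * vec_index v j)"
      by (simp add: p_def poly_sum poly_monom mult.commute)
    moreover have "vec_index (?V *\<^sub>v v) i = 0"
      unfolding Vv using that by simp
    ultimately show ?thesis by simp
  qed
  have cf: "coeff p (N - 1 - j) = vec_index v j" if "j < N" for j
  proof -
    have "coeff p (N - 1 - j) = (\<Sum>i<N. if i = j then vec_index v i else 0)"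
      unfolding p_def coeff_sum by (intro sum.cong) (use that in auto)
    then show ?thesis using that by simp
  qed
  obtain j where j: "j < N" "vec_index v j \<noteq> 0"
    using v by (metis carrier_vecD eq_vecI index_zero_vec(1) index_zero_vec(2))
  then have "p \<noteq> 0" using cf by (metis coeff_0)
  have "degree p \<le> N - 1"
    unfolding p_def by (intro degree_sum_le) (auto intro: order_trans[OF degree_monom_le])
  then have "degree p < N" using j by linarith
  moreover have "N = card (f ` {..<N})" using card_image[OF inj] by simp
  moreover have "card (f ` {..<N}) \<le> card {x. poly p x = 0}"
    using root poly_roots_finite[OF \<open>p \<noteq> 0\<close>] by (intro card_mono) auto
  ultimately show False
    using card_poly_roots_bound[OF \<open>p \<noteq> 0\<close>] by linarith
qed

lemma power_dvd_det_rows: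
  fixes A :: "'a::comm_ring_1 mat"
  assumes A: "A \<in> carrier_mat N N" and "k \<le> N"
    and rows: "\<And>i j. i < k \<Longrightarrow> j < N \<Longrightarrow> d dvd A $$ (i, j)"
  shows "d ^ k dvd Determinant.det A"
  unfolding det_def'[OF A]
proof (intro dvd_sum dvd_mult)
  fix p assume "p \<in> {p. p permutes {0..<N}}"
  then have p: "p i < N" if "i < N" for i
    using that permutes_in_image[of p "{0..<N}" i] by simp
  have "(\<Prod>i = 0..<N. if i < k then d else 1) dvd (\<Prod>i = 0..<N. A $$ (i, p i))"
    by (intro prod_dvd_prod) (use p rows in auto)
  moreover have "(\<Prod>i = 0..<N. if i < k then d else 1) = d ^ card {i\<in>{0..<N}. i < k}"
    by (simp add: prod.If_cases Int_def)
  moreover have "{i\<in>{0..<N}. i < k} = {..<k}" using \<open>k \<le> N\<close> by auto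
  ultimately show "d ^ k dvd (\<Prod>i = 0..<N. A $$ (i, p i))" by simp
qed

lemma eval2_mult: "eval2 (P * Q) u v = eval2 P u v * eval2 Q u v"
  by (simp add: eval2_def)

text \<open>Written as a scalar product of coefficients and powers, evaluation becomes the entry of a matrix
product.\<close>

lemma eval2_altdef:
  assumes "degree P < N"
  shows "eval2 P u v = (\<Sum>l<N. poly (coeff P l) v * u ^ l)"
proof -
  have "degree (map_poly (\<lambda>c. poly c v) P) < N"
    using degree_map_poly_le[of "\<lambda>c. poly c v" P] assms by linarith
  then have "eval2 P u v = (\<Sum>l<N. coeff (map_poly (\<lambda>c. poly c v) P) l * u ^ l)"
    unfolding eval2_eq_map_poly poly_altdef
    by (intro sum.mono_neutral_left) (auto simp: coeff_eq_0)
  then show ?thesis by (simp add: coeff_map_poly)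
qed

lemma inj_extension:
  fixes X :: "'a set"
  assumes "finite X" "card X \<le> N" "infinite (UNIV :: 'a set)"
  obtains f where "inj_on f {..<N}" "f ` {..<card X} = X"
proof -
  obtain Y where Y: "Y \<subseteq> UNIV - X" "finite Y" "card Y = N - card X"
    using infinite_arbitrarily_large[of "UNIV - X" "N - card X"] assms by auto
  obtain h where h: "bij_betw h {0..<card X} X"
    using ex_bij_betw_nat_finite[OF assms(1)] by blast
  obtain g where g: "bij_betw g {0..<card Y} Y"
    using ex_bij_betw_nat_finite[OF Y(2)] by blast
  define f where "f i = (if i < card X then h i else g (i - card X))" for i
  have "f ` {..<card X} = h ` {0..<card X}"
    by (auto simp: f_def)
  then have im: "f ` {..<card X} = X" using h by (simp add: bij_betw_def)
  have inX: "f i \<in> X" if "i < card X" for i using that im by blast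
  have inY: "f i \<in> Y" if "\<not> i < card X" "i < N" for i
  proof -
    have "i - card X \<in> {0..<card Y}" using that Y by auto
    then show ?thesis using g that by (auto simp: f_def bij_betw_def)
  qed
  have "inj_on f {..<N}"
  proof (rule inj_onI)
    fix i j assume ij: "i \<in> {..<N}" "j \<in> {..<N}" "f i = f j"
    have same: "i < card X \<longleftrightarrow> j < card X"
      using ij inX inY Y by (metis DiffE lessThan_iff subset_eq)
    show "i = j"
    proof (cases "i < card X")
      case True
      then show ?thesis using same ij h
        by (auto simp: f_def bij_betw_def dest: inj_onD)
    next
      case False
      then have "i - card X \<in> {0..<card Y}" "j - card X \<in> {0..<card Y}"
        using same ij Y by auto
      then have "i - card X = j - card X"
        using False same ij g by (auto simp: f_def bij_betw_def dest: inj_onD)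
      then show ?thesis using False same by linarith
    qed
  qed
  then show thesis using im that by blast
qed

text \<open>The rows of the Sylvester matrix are the coefficient lists of multiples of \<open>P\<close> and \<open>Q\<close> by powers of
\<open>Y\<^sub>0\<close>. The scalar product of such a row with \<open>(x^(N - 1), \<dots>, x, 1)\<close> is the value of that multiple at \<open>x\<close>, and
it vanishes at \<open>Y\<^sub>1 = c\<close> for each common zero \<open>x\<close>. A Vandermonde matrix whose first nodes are the
common zeros therefore multiplies the (transposed) Sylvester matrix to one with \<open>card X\<close> rows
divisible by \<open>Y\<^sub>1 - c\<close>, and it changes the determinant by a nonzero real factor only.\<close>

lemma common_zeros_power_dvd_resultant:
  fixes P Q :: "real poly poly"
  assumes "finite X" and k: "card X \<le> degree P + degree Q"
    and zero: "\<And>x. x \<in> X \<Longrightarrow> eval2 P x c = 0 \<and> eval2 Q x c = 0"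
  shows "[:- c, 1:] ^ card X dvd resultant P Q"
proof -
  define m n where "m = degree P" and "n = degree Q"
  define N where "N = m + n"
  obtain f where inj: "inj_on f {..<N}" and im: "f ` {..<card X} = X"
    using inj_extension[OF assms(1), of N] k infinite_UNIV_char_0 by (metis N_def m_def n_def)
  define V where "V = Matrix.mat N N (\<lambda>(i,j). f i ^ (N - 1 - j))"
  let ?h = "\<lambda>a :: real. [:a:]"
  interpret h: comm_ring_hom ?h
    by standard (auto simp: one_pCons)
  define S where "S = sylvester_mat P Q"
  have carr: "V \<in> carrier_mat N N" "map_mat ?h V \<in> carrier_mat N N" "S \<in> carrier_mat N N"
    "transpose_mat S \<in> carrier_mat N N"
    using sylvester_carrier_mat[of P Q] unfolding V_def S_def N_def m_def n_def by auto
  define B where "B = map_mat ?h V * transpose_mat S"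
  have B: "B \<in> carrier_mat N N" unfolding B_def using carr by (intro mult_carrier_mat)
  have Bentry: "[:- c, 1:] dvd B $$ (i, r)" if "i < card X" "r < N" for i r
  proof -
    have i: "i < N" and fi: "f i \<in> X" using that k im by (auto simp: N_def m_def n_def)
    \<comment> \<open>the polynomial whose coefficients form row \<open>r\<close>\<close>
    define q where "q = (if r < n then Polynomial.monom 1 (n - 1 - r) * P
                          else Polynomial.monom 1 (N - 1 - r) * Q)"
    have S_entry: "S $$ (r, j) = coeff q (N - 1 - j)" if j: "j < N" for j
    proof (cases "r < n")
      case True
      have e: "n - r = Suc (n - 1 - r)" "N - j = Suc (N - 1 - j)" using True j by auto
      show ?thesis
        using sylvester_index_mat2[of r P Q j] True j \<open>r < N\<close> e
        by (simp add: S_def q_def N_def m_def n_def coeff_monom_mult)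
    next
      case False
      have e: "N - r = Suc (N - 1 - r)" "N - j = Suc (N - 1 - j)" using \<open>r < N\<close> j by auto
      show ?thesis
        using sylvester_index_mat2[of r P Q j] False j \<open>r < N\<close> e
        by (simp add: S_def q_def N_def m_def n_def coeff_monom_mult)
    qed
    have "degree q \<le> (if r < n then (n - 1 - r) + m else (N - 1 - r) + n)"
      unfolding q_def m_def n_def
      by (auto simp: degree_monom_eq intro!: order_trans[OF degree_mult_le])
    then have dq: "degree q < N" using \<open>r < N\<close> by (auto simp: N_def split: if_splits)
    have "poly (B $$ (i, r)) c = (\<Sum>j<N. f i ^ (N - 1 - j) * poly (S $$ (r, j)) c)"
      using i \<open>r < N\<close> carr unfolding B_def V_def
      by (auto simp: scalar_prod_def poly_sum atLeast0LessThan intro!: sum.cong)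
    also have "\<dots> = (\<Sum>j<N. f i ^ (N - 1 - j) * poly (coeff q (N - 1 - j)) c)"
      by (simp add: S_entry)
    also have "\<dots> = (\<Sum>l<N. f i ^ l * poly (coeff q l) c)"
      using sum.nat_diff_reindex[of "\<lambda>l. f i ^ l * poly (coeff q l) c" N] by simp
    also have "\<dots> = eval2 q (f i) c"
      by (simp add: eval2_altdef[OF dq] mult.commute)
    also have "\<dots> = 0"
      using zero[OF fi] by (simp add: q_def eval2_mult)
    finally show ?thesis by (simp add: poly_eq_0_iff_dvd)
  qed
  have "[:- c, 1:] ^ card X dvd Determinant.det B"
    using B k Bentry by (intro power_dvd_det_rows[where N = N]) (auto simp: N_def m_def n_def)
  also have "Determinant.det B = [:Determinant.det V:] * resultant P Q"
    unfolding B_def det_mult[OF carr(2,4)] det_transpose[OF carr(3)]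
    by (simp add: resultant_def S_def h.hom_det)
  finally show ?thesis
    using vandermonde_det_nonzero[OF inj]
    by (simp add: V_def dvd_smult_cancel)
qed

text \<open>Bezout's bound for weighted degrees. For each permutation \<open>p\<close> the entries on its graph satisfy an
inequality of the form \<open>degree + i \<le> const + p i\<close>, where the constant depends on the kind of row only; on
summation the terms \<open>i\<close> and \<open>p i\<close> cancel, so every term of the Leibniz formula obeys the same bound.\<close>

lemma degree_resultant_le:
  fixes P Q :: "'a::idom poly poly"
  assumes P: "\<And>i. i \<le> degree P \<Longrightarrow> degree (coeff P i) + i \<le> a"
    and Q: "\<And>i. i \<le> degree Q \<Longrightarrow> degree (coeff Q i) + i \<le> b"
  shows "degree (resultant P Q) + degree P * degree Q \<le> degree Q * a + degree P * b"
proof -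
  define m n where "m = degree P" and "n = degree Q"
  define S where "S = sylvester_mat P Q"
  have S: "S \<in> carrier_mat (m + n) (m + n)"
    unfolding S_def m_def n_def by (rule sylvester_carrier_mat)
  have nm: "m * n \<le> n * a + m * b"
    using P[of m] by (simp add: m_def trans_le_add1 mult.commute[of _ n])
  have "degree (\<Prod>i = 0..<m + n. S $$ (i, p i)) + m * n \<le> n * a + m * b"
    if p: "p permutes {0..<m + n}" for p
  proof (cases "\<forall>i\<in>{0..<m + n}. S $$ (i, p i) \<noteq> 0")
    case False
    then have "(\<Prod>i = 0..<m + n. S $$ (i, p i)) = 0"
      by (intro prod_zero) auto
    then have "degree (\<Prod>i = 0..<m + n. S $$ (i, p i)) = 0"
      by (simp only: degree_0)
    then show ?thesis using nm by linarith
  next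
    case nz: True
    define e where "e i = degree (S $$ (i, p i))" for i
    have bnd: "e i + (if i < n then m else 0) + i \<le> (if i < n then a else b) + p i"
      if i: "i \<in> {0..<m + n}" for i
    proof -
      have pi: "p i < m + n" using permutes_in_image[OF p, of i] i by auto
      show ?thesis
      proof (cases "i < n")
        case True
        then have ent: "S $$ (i, p i) = (if i \<le> p i \<and> p i - i \<le> m then coeff P (m + i - p i) else 0)"
          using sylvester_index_mat[of i P Q "p i"] i pi by (auto simp: S_def m_def n_def)
        then have "i \<le> p i" "p i - i \<le> m" using nz i by (auto split: if_splits)
        moreover from this have "m + i - p i \<le> degree P" by (simp add: m_def)
        note P[OF this]
        ultimately show ?thesis using True ent by (simp add: e_def)
      next
        case False
        then have ent: "S $$ (i, p i) = (if i - n \<le> p i \<and> p i \<le> i then coeff Q (i - p i) else 0)"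
          using sylvester_index_mat[of i P Q "p i"] i pi by (auto simp: S_def m_def n_def)
        then have "i - n \<le> p i" "p i \<le> i" using nz i by (auto split: if_splits)
        moreover from this have "i - p i \<le> degree Q" by (simp add: n_def)
        note Q[OF this]
        ultimately show ?thesis using False ent by (simp add: e_def)
      qed
    qed
    have "(\<Sum>i = 0..<m + n. e i + (if i < n then m else 0) + i)
        \<le> (\<Sum>i = 0..<m + n. (if i < n then a else b) + p i)"
      by (intro sum_mono bnd)
    moreover have "(\<Sum>i = 0..<m + n. p i) = (\<Sum>i = 0..<m + n. i)"
      using sum.permute[OF p, of "\<lambda>i. i"] by simp
    moreover have "(\<Sum>i = 0..<m + n. if i < n then u else v) = n * u + m * v" for u v :: nat
    proof -
      have "{i. i < m + n \<and> i < n} = {..<n}" "{i. i < m + n \<and> \<not> i < n} = {n..<m + n}" by auto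
      then show ?thesis by (simp add: sum.If_cases Int_def)
    qed
    ultimately have "(\<Sum>i = 0..<m + n. e i) + n * m \<le> n * a + m * b"
      by (simp add: sum.distrib)
    then show ?thesis
      using degree_prod_sum_le[of "{0..<m + n}" "\<lambda>i. S $$ (i, p i)"]
      by (simp add: e_def o_def mult.commute)
  qed note prods = this
  have "degree (Determinant.det S) \<le> n * a + m * b - m * n"
    unfolding det_def'[OF S]
  proof (intro degree_sum_le)
    fix p assume "p \<in> {p. p permutes {0..<m + n}}"
    then have "degree (\<Prod>i = 0..<m + n. S $$ (i, p i)) \<le> n * a + m * b - m * n"
      using prods[of p] by auto
    then show "degree (signof p * (\<Prod>i = 0..<m + n. S $$ (i, p i))) \<le> n * a + m * b - m * n"
      by (auto simp: sign_def)
  qed (simp add: finite_permutations)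
  then show ?thesis
    using nm by (simp add: resultant_def S_def m_def n_def)
qed

lemma sum_count_le_size:
  assumes "finite Z"
  shows "(\<Sum>z\<in>Z. count M z) \<le> size {# z \<in># M. z \<in> Z #}"
proof -
  have "(\<Sum>z\<in>Z. count M z) = (\<Sum>z\<in>Z. count {# z \<in># M. z \<in> Z #} z)"
    by (intro sum.cong) auto
  also have "\<dots> = size {# z \<in># M. z \<in> Z #}"
    unfolding size_multiset_overloaded_eq
    by (intro sum.mono_neutral_right) (use assms in \<open>auto simp: count_eq_zero_iff\<close>)
  finally show ?thesis by simp
qed

text \<open>Common zeros are grouped by their second coordinate \<open>c < 0\<close>; each group is paid for by the multiplicity
of \<open>c\<close> as a root of the resultant. Without \<open>no_line\<close> a group could be infinite, since the
resultant can be nonzero although both polynomials vanish on a whole line \<open>Y\<^sub>1 = c\<close>.\<close>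

lemma card_common_zeros_le:
  fixes P Q :: "real poly poly"
  defines "R \<equiv> resultant P Q"
  assumes "R \<noteq> 0" and "finite S"
    and S: "\<And>u v. (u, v) \<in> S \<Longrightarrow> v < 0 \<and> eval2 P u v = 0 \<and> eval2 Q u v = 0"
    and no_line: "\<And>v. v < 0 \<Longrightarrow> (\<exists>u. eval2 P u v \<noteq> 0) \<or> (\<exists>u. eval2 Q u v \<noteq> 0)"
  shows "card S + size {# z \<in># proots (map_poly complex_of_real R). z \<notin> \<real>\<^sub>\<le>\<^sub>0 #} \<le> degree R"
proof -
  define M where "M = proots (map_poly complex_of_real R)"
  interpret h: map_poly_inj_idom_divide_hom complex_of_real ..
  have R': "map_poly complex_of_real R \<noteq> 0" using \<open>R \<noteq> 0\<close> by simp
  define C where "C = snd ` S"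
  have fC: "finite C" using \<open>finite S\<close> by (simp add: C_def)
  have fib: "card {u. (u, c) \<in> S} \<le> order c R" and fibfin: "finite {u. (u, c) \<in> S}" if "c \<in> C" for c
  proof -
    have "c < 0" using that S by (force simp: C_def)
    have sub: "{u. (u, c) \<in> S} \<subseteq> fst ` S" by force
    then show fin: "finite {u. (u, c) \<in> S}" using \<open>finite S\<close> finite_surj by blast
    have deg: "card {u. (u, c) \<in> S} \<le> degree T"
      if T: "T = P \<or> T = Q" and u: "\<exists>u. eval2 T u c \<noteq> 0" for T
    proof -
      let ?t = "map_poly (\<lambda>d. poly d c) T"
      have t: "?t \<noteq> 0" using u by (auto simp: eval2_eq_map_poly)
      have "{u. (u, c) \<in> S} \<subseteq> {u. poly ?t u = 0}"
        using T S by (auto simp: eval2_eq_map_poly)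
      then have "card {u. (u, c) \<in> S} \<le> card {u. poly ?t u = 0}"
        by (rule card_mono[OF poly_roots_finite[OF t]])
      also have "\<dots> \<le> degree ?t"
        by (rule card_poly_roots_bound[OF t])
      finally have "card {u. (u, c) \<in> S} \<le> degree ?t" .
      then show ?thesis using degree_map_poly_le[of "\<lambda>d. poly d c" T] by linarith
    qed
    have "card {u. (u, c) \<in> S} \<le> degree P \<or> card {u. (u, c) \<in> S} \<le> degree Q"
      using no_line[OF \<open>c < 0\<close>] deg[of P] deg[of Q] by blast
    then have "card {u. (u, c) \<in> S} \<le> degree P + degree Q"
      by linarith
    then have "[:- c, 1:] ^ card {u. (u, c) \<in> S} dvd R"
      unfolding R_def using fin S by (intro common_zeros_power_dvd_resultant) auto
    then show "card {u. (u, c) \<in> S} \<le> order c R"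
      using \<open>R \<noteq> 0\<close> by (simp add: order_divides)
  qed
  have "card S = (\<Sum>c\<in>C. card {u. (u, c) \<in> S})"
  proof -
    have "card S = card (prod.swap ` S)"
      by (simp add: card_image)
    also have "prod.swap ` S = Sigma C (\<lambda>c. {u. (u, c) \<in> S})"
      by (force simp: C_def)
    finally show ?thesis using fC fibfin by simp
  qed
  also have "\<dots> \<le> (\<Sum>c\<in>C. order c R)" by (intro sum_mono fib)
  also have "\<dots> = (\<Sum>c\<in>C. count M (complex_of_real c))"
    using R' by (simp add: M_def h.order_hom)
  also have "\<dots> = (\<Sum>z\<in>complex_of_real ` C. count M z)"
    by (simp add: sum.reindex inj_on_def)
  also have "\<dots> \<le> size {# z \<in># M. z \<in> complex_of_real ` C #}"
    using fC by (intro sum_count_le_size) simp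
  also have "\<dots> \<le> size {# z \<in># M. \<not> z \<notin> \<real>\<^sub>\<le>\<^sub>0 #}"
  proof -
    have "complex_of_real c \<in> \<real>\<^sub>\<le>\<^sub>0" if "c \<in> C" for c
      using that S by (force simp: C_def)
    then show ?thesis
      by (intro size_mset_mono mset_subset_eqI) auto
  qed
  finally have "card S + size {# z \<in># M. z \<notin> \<real>\<^sub>\<le>\<^sub>0 #} \<le> size M"
    using multiset_partition[of M "\<lambda>z. z \<notin> \<real>\<^sub>\<le>\<^sub>0"]
    by (metis add.commute add_le_cancel_left size_union)
  also have "size M = degree R"
    by (simp add: M_def size_proots_complex)
  finally show ?thesis by (simp add: M_def)
qed

section \<open>Counting by Rolle's theorem\<close>

text \<open>The counting form of Rolle's theorem: a property that has an instance between any two points of \<open>Z\<close>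
has at least \<open>card Z - 1\<close> instances.\<close>

lemma interlaced_witnesses:
  fixes Z :: "real set"
  assumes "finite Z"
    and step: "\<And>x y. x \<in> Z \<Longrightarrow> y \<in> Z \<Longrightarrow> x < y \<Longrightarrow> \<exists>z. x < z \<and> z < y \<and> P z"
  obtains S where "finite S" "\<And>z. z \<in> S \<Longrightarrow> P z" "card Z \<le> card S + 1"
proof -
  have "\<exists>S. finite S \<and> (\<forall>z\<in>S. P z \<and> (\<exists>y\<in>Z. z < y)) \<and> card Z \<le> card S + 1"
    using assms
  proof (induction Z rule: finite_linorder_max_induct)
    case empty
    then show ?case by (intro exI[of _ "{}"]) auto
  next
    case (insert y Z)
    then obtain S where S: "finite S" "\<forall>z\<in>S. P z \<and> (\<exists>x\<in>Z. z < x)" "card Z \<le> card S + 1"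
      by (metis insertCI)
    show ?case
    proof (cases "Z = {}")
      case True
      then show ?thesis by (intro exI[of _ "{}"]) auto
    next
      case False
      define x where "x = Max Z"
      have x: "x \<in> Z" "\<And>x'. x' \<in> Z \<Longrightarrow> x' \<le> x"
        using insert.hyps False by (auto simp: x_def)
      then obtain z where z: "x < z" "z < y" "P z"
        using insert.prems[of x y] insert.hyps by auto
      have "z \<notin> S" using S x z by (meson not_less_iff_gr_or_eq order_less_le_trans)
      then show ?thesis
        using S z insert.hyps
        by (intro exI[of _ "insert z S"]) (auto intro: less_trans)
    qed
  qed
  then show thesis using that by blast
qed

section \<open>The first integral of an excursion\<close>

text \<open>Up to an additive constant this is the primitive of \<open>2 D y / W y\<close>. It is the quantity
\<open>2 ln r - 2 (\<alpha> / \<beta>) \<theta>\<close>, with \<open>r\<close> and \<open>\<theta>\<close> the polar coordinates about the focus with eigenvalues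
\<open>\<alpha> \<plusminus> i \<beta>\<close>, read off at the point of the switching line with level \<open>y\<close>. For \<open>a = 0\<close> the focus
lies on the line, the angle is constant on each half line, and the second summand is \<open>0\<close> because of
\<open>z / 0 = 0\<close>.\<close>

definition pass_integral :: "real \<Rightarrow> real \<Rightarrow> real \<Rightarrow> real \<Rightarrow> real" where
  "pass_integral a T D y =
     ln (W_L a T D y)
     + 2 * T / sqrt (4 * D - T^2) * arctan ((2 * D * y - a * T) / (sqrt (4 * D - T^2) * a))"

lemma focus_det_pos:
  fixes T D :: real
  assumes "T^2 - 4 * D < 0" shows "D > 0"
  using assms zero_le_power2[of T] by linarith

text \<open>Completing the square: \<open>4 D W y = (2 D y - a T)\<^sup>2 + a\<^sup>2 (4 D - T\<^sup>2)\<close>.\<close>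

lemma W_L_pos:
  assumes focus: "T^2 - 4 * D < 0" and "a \<noteq> 0 \<or> y \<noteq> 0"
  shows "W_L a T D y > 0"
proof -
  have eq: "4 * D * W_L a T D y = (2 * D * y - a * T)^2 + a^2 * (4 * D - T^2)"
    by (simp add: W_L_def power2_eq_square algebra_simps)
  have "0 < (2 * D * y - a * T)^2 + a^2 * (4 * D - T^2)"
  proof (cases "a = 0")
    case True
    then show ?thesis using assms focus_det_pos[OF focus] by simp
  next
    case False
    then show ?thesis using focus by (intro add_nonneg_pos mult_pos_pos) auto
  qed
  then show ?thesis
    unfolding eq[symmetric] using focus_det_pos[OF focus] by (simp add: zero_less_mult_iff)
qed

lemma pass_integral_deriv:
  assumes focus: "T^2 - 4 * D < 0" and ay: "a \<noteq> 0 \<or> y \<noteq> 0"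
  shows "(pass_integral a T D has_real_derivative 2 * D * y / W_L a T D y) (at y)"
proof -
  define s where "s = sqrt (4 * D - T^2)"
  have s: "s > 0" "s^2 = 4 * D - T^2" using focus by (auto simp: s_def)
  note W = W_L_pos[OF assms]
  have dW: "(W_L a T D has_real_derivative 2 * D * y - a * T) (at y)"
    unfolding W_L_def by (auto intro!: derivative_eq_intros)
  show ?thesis
  proof (cases "a = 0")
    case True
    have "pass_integral a T D = (\<lambda>y. ln (W_L a T D y))"
      using True by (auto simp: pass_integral_def)
    then show ?thesis
      using DERIV_chain2[OF DERIV_ln[OF W] dW] True by (simp add: field_simps)
  next
    case False
    have Wsq: "(s * a)^2 + (2 * D * y - a * T)^2 = 4 * D * W_L a T D y"
      unfolding power_mult_distrib s(2) W_L_def by (simp add: power2_eq_square algebra_simps)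
    have "((\<lambda>y. arctan ((2 * D * y - a * T) / (s * a))) has_real_derivative
       inverse (1 + ((2 * D * y - a * T) / (s * a))^2) * (2 * D / (s * a))) (at y)"
      using s False by (auto intro!: derivative_eq_intros)
    moreover have "inverse (1 + ((2 * D * y - a * T) / (s * a))^2) * (2 * D / (s * a))
        = (s * a)^2 / ((s * a)^2 + (2 * D * y - a * T)^2) * (2 * D / (s * a))"
      using s False by (simp add: power_divide field_simps)
    moreover have "\<dots> = s * a / (2 * W_L a T D y)"
      unfolding Wsq using s False W focus_det_pos[OF focus]
      by (simp add: power2_eq_square field_simps)
    ultimately have dA: "((\<lambda>y. arctan ((2 * D * y - a * T) / (s * a))) has_real_derivative
        s * a / (2 * W_L a T D y)) (at y)" by simp
    have "((\<lambda>y. ln (W_L a T D y) + 2 * T / s * arctan ((2 * D * y - a * T) / (s * a)))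
        has_real_derivative
        1 / W_L a T D y * (2 * D * y - a * T) + 2 * T / s * (s * a / (2 * W_L a T D y))) (at y)"
      by (intro DERIV_add DERIV_cmult DERIV_chain2[OF DERIV_ln_divide[OF W] dW] dA)
    moreover have "1 / W_L a T D y * (2 * D * y - a * T) + 2 * T / s * (s * a / (2 * W_L a T D y))
        = 2 * D * y / W_L a T D y"
      using s W by (simp add: field_simps)
    ultimately show ?thesis by (simp add: pass_integral_def[abs_def] s_def)
  qed
qed

lemma pass_integral_strict_mono:
  assumes focus: "T^2 - 4 * D < 0" and "0 < y" "y < z"
  shows "pass_integral a T D y < pass_integral a T D z"
proof (rule DERIV_pos_imp_increasing[OF \<open>y < z\<close>])
  fix x assume "y \<le> x" "x \<le> z"
  then have "x > 0" using \<open>0 < y\<close> by linarith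
  then show "\<exists>d. (pass_integral a T D has_real_derivative d) (at x) \<and> 0 < d"
    using pass_integral_deriv[OF focus, of a x] W_L_pos[OF focus, of a x] focus_det_pos[OF focus]
    by (intro exI[of _ "2 * D * x / W_L a T D x"]) auto
qed

lemma pass_integral_strict_antimono:
  assumes focus: "T^2 - 4 * D < 0" and "z < 0" "y < z"
  shows "pass_integral a T D z < pass_integral a T D y"
proof (rule DERIV_neg_imp_decreasing[OF \<open>y < z\<close>])
  fix x assume "y \<le> x" "x \<le> z"
  then have "x < 0" using \<open>z < 0\<close> by linarith
  then show "\<exists>d. (pass_integral a T D has_real_derivative d) (at x) \<and> d < 0"
    using pass_integral_deriv[OF focus, of a x] W_L_pos[OF focus, of a x] focus_det_pos[OF focus]
    by (intro exI[of _ "2 * D * x / W_L a T D x"]) (auto simp: divide_neg_pos mult_pos_neg)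
qed

lemma pass_integral_less_iff:
  assumes focus: "T^2 - 4 * D < 0"
  shows "0 < y \<Longrightarrow> 0 < z \<Longrightarrow> pass_integral a T D y < pass_integral a T D z \<longleftrightarrow> y < z"
    and "y < 0 \<Longrightarrow> z < 0 \<Longrightarrow> pass_integral a T D y < pass_integral a T D z \<longleftrightarrow> z < y"
  using pass_integral_strict_mono[OF focus, of y z a] pass_integral_strict_mono[OF focus, of z y a]
    pass_integral_strict_antimono[OF focus, of y z a] pass_integral_strict_antimono[OF focus, of z y a]
  by (metis linorder_neqE_linordered_idom order_less_asym)+

text \<open>The inverse of \<open>pass_integral\<close> on the negative half line. It makes the curve \<open>\<Psi> y\<^sub>1 = \<Psi> y\<^sub>0 + C\<close> the graph
of a differentiable function \<open>y\<^sub>1\<close> of \<open>y\<^sub>0\<close>.\<close>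

definition neg_branch :: "real \<Rightarrow> real \<Rightarrow> real \<Rightarrow> real \<Rightarrow> real" where
  "neg_branch a T D c = (THE u. u < 0 \<and> pass_integral a T D u = c)"

lemma neg_branch_eq:
  assumes focus: "T^2 - 4 * D < 0" and "u < 0"
  shows "neg_branch a T D (pass_integral a T D u) = u"
  unfolding neg_branch_def
proof (rule the_equality)
  fix v assume v: "v < 0 \<and> pass_integral a T D v = pass_integral a T D u"
  then show "v = u"
    using pass_integral_less_iff(2)[OF focus, of u v a] pass_integral_less_iff(2)[OF focus, of v u a]
      \<open>u < 0\<close> by simp
qed (use \<open>u < 0\<close> in simp)

lemma neg_branch_deriv:
  assumes focus: "T^2 - 4 * D < 0" and "u < 0"
  shows "(neg_branch a T D has_real_derivative W_L a T D u / (2 * D * u)) (at (pass_integral a T D u))"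
proof -
  let ?f = "pass_integral a T D" and ?g = "neg_branch a T D"
  have cont: "isCont ?f v" if "v < 0" for v
    using pass_integral_deriv[OF focus, of a v] that by (auto dest: DERIV_isCont)
  have cg: "isCont ?g (?f u)"
    by (rule isCont_inverse_function[of "- u / 2"])
       (use \<open>u < 0\<close> in \<open>auto intro!: cont neg_branch_eq[OF focus]\<close>)
  have ends: "?f (u / 2) < ?f u" "?f u < ?f (2 * u)"
    using \<open>u < 0\<close> by (auto intro!: pass_integral_strict_antimono[OF focus])
  have inv: "?f (?g c) = c" if c: "?f (u / 2) < c" "c < ?f (2 * u)" for c
  proof -
    have "\<forall>v. 2 * u \<le> v \<and> v \<le> u / 2 \<longrightarrow> isCont ?f v"
      using cont \<open>u < 0\<close> by auto
    then obtain v where "2 * u \<le> v" "v \<le> u / 2" "?f v = c"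
      using IVT2[of ?f "u / 2" c "2 * u"] c \<open>u < 0\<close> by auto
    then show ?thesis using neg_branch_eq[OF focus, of v a] \<open>u < 0\<close> by force
  qed
  have "(?g has_real_derivative inverse (2 * D * u / W_L a T D u)) (at (?f u))"
  proof (rule DERIV_inverse_function[OF _ _ ends inv cg])
    show "(?f has_real_derivative 2 * D * u / W_L a T D u) (at (?g (?f u)))"
      using pass_integral_deriv[OF focus, of a u] neg_branch_eq[OF assms, of a] \<open>u < 0\<close> by simp
    show "2 * D * u / W_L a T D u \<noteq> 0"
      using W_L_pos[OF focus, of a u] focus_det_pos[OF focus] \<open>u < 0\<close> by simp
  qed
  then show ?thesis by simp
qed

text \<open>The reason for the shape of \<open>F\<close>: the curve of the left equation has slope
\<open>y\<^sub>0 W\<^sub>L(y\<^sub>1) / (y\<^sub>1 W\<^sub>L(y\<^sub>0))\<close>, that of the right equation has slope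
\<open>(y\<^sub>0 - b) W\<^sub>R(y\<^sub>1 - b) / ((y\<^sub>1 - b) W\<^sub>R(y\<^sub>0 - b))\<close>. Clearing denominators in their difference gives
an antisymmetric polynomial, hence a multiple of \<open>y\<^sub>0 - y\<^sub>1\<close>, and \<open>F\<close> is, up to sign, the symmetric cofactor.\<close>

lemma F_fun_identity:
  "y1 * (y0 - b) * W_L a_L T_L D_L y0 * W_L a_R T_R D_R (y1 - b)
   - y0 * (y1 - b) * W_L a_R T_R D_R (y0 - b) * W_L a_L T_L D_L y1
   = (y0 - y1) * F_fun a_L a_R T_L D_L T_R D_R b y0 y1"
  unfolding W_L_def F_fun_def m0_def m1_def m2_def m3_def m4_def m5_def
  by (simp add: algebra_simps power2_eq_square power3_eq_cube)

text \<open>The right half plane is treated as a left one after the reflection \<open>x\<^sub>1 \<mapsto> - x\<^sub>1\<close>, which replaces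
\<open>a\<close> by \<open>- a\<close> and the level \<open>y\<close> by \<open>b - y\<close>.\<close>

lemma W_L_reflect: "W_L (- a) T D (- y) = W_L a T D y"
  by (simp add: W_L_def)

section \<open>Zeros of F between two solutions of the matching equations\<close>

locale half_maps =
  fixes a_L a_R T_L D_L T_R D_R b C_L C_R :: real
begin

text \<open>An excursion to the left that starts at level \<open>y\<^sub>0\<close> ends at level \<open>y\<^sub>1\<close>. The inequalities say that both
are crossing levels of the right kind.\<close>

definition left_match :: "real \<Rightarrow> real \<Rightarrow> bool" where
  "left_match y0 y1 \<longleftrightarrow> max 0 b < y0 \<and> y1 < min 0 b \<and>
     pass_integral a_L T_L D_L y1 - pass_integral a_L T_L D_L y0 = C_L"

text \<open>An excursion to the right that starts at level \<open>y\<^sub>1\<close> ends at level \<open>y\<^sub>0\<close>, written with the reflected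
parameters \<open>- a\<^sub>R\<close> and \<open>b - y\<close>.\<close>

definition right_match :: "real \<Rightarrow> real \<Rightarrow> bool" where
  "right_match y0 y1 \<longleftrightarrow> max 0 b < y0 \<and> y1 < min 0 b \<and>
     pass_integral (- a_R) T_R D_R (b - y0) - pass_integral (- a_R) T_R D_R (b - y1) = C_R"

text \<open>\<open>F\<close> divided by \<open>Y\<^sub>1\<^sup>2\<close>, as a function of \<open>\<zeta> = Y\<^sub>0 / Y\<^sub>1\<close> and \<open>\<eta> = 1 / Y\<^sub>1\<close>. The projective change of
coordinates sends the line \<open>Y\<^sub>1 = 0\<close> to infinity; as the curve \<open>F = 0\<close> does not meet that line in the
generic case, its image is bounded.\<close>

definition conic :: "real \<Rightarrow> real \<Rightarrow> real" where
  "conic \<zeta> \<eta> =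
     m0 a_L a_R T_L D_L T_R D_R b * \<eta>^2 + m1 a_L a_R T_L D_L T_R D_R b * \<zeta> * \<eta>
     + (m2 a_L a_R T_L D_L T_R D_R b - 2 * m3 a_L a_R T_L D_L T_R D_R b) * \<eta>
     + m3 a_L a_R T_L D_L T_R D_R b * \<zeta>^2 + m4 a_L a_R T_L D_L T_R D_R b * \<zeta>
     + m5 a_L a_R T_L D_L T_R D_R b"

definition common_zeros :: "(real \<times> real) set" where
  "common_zeros = {(u, v). v < 0 \<and> eval2 (F_tilde a_L a_R T_L D_L T_R D_R b) u v = 0 \<and>
     eval2 (G_tilde a_L a_R T_L D_L T_R D_R b) u v = 0}"

end

locale two_foci = half_maps +
  assumes focusL: "T_L^2 - 4 * D_L < 0" and focusR: "T_R^2 - 4 * D_R < 0"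
begin

text \<open>Rolle's theorem for the right equation along the curve of the left one. The curve is decreasing in
the quadrant of crossing levels, so that all points between two solutions are admissible as well.\<close>

lemma F_zero_between_double_matches:
  assumes y: "left_match y0 y1" "right_match y0 y1" and z: "left_match z0 z1" "right_match z0 z1"
    and "y0 < z0"
  shows "\<exists>u0 u1. y0 < u0 \<and> u0 < z0 \<and> left_match u0 u1 \<and> F_fun a_L a_R T_L D_L T_R D_R b u0 u1 = 0"
proof -
  let ?L = "pass_integral a_L T_L D_L" and ?R = "pass_integral (- a_R) T_R D_R"
  let ?g = "\<lambda>t. neg_branch a_L T_L D_L (?L t + C_L)"
  \<comment> \<open>the left-hand side of the right equation along the left curve\<close>
  define k where "k t = ?R (b - t) - ?R (b - ?g t)" for t
  have pos: "max 0 b < y0" "y1 < min 0 b" "max 0 b < z0" "z1 < min 0 b"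
    and eqs: "?L y1 = ?L y0 + C_L" "?L z1 = ?L z0 + C_L"
    "?R (b - y0) - ?R (b - y1) = C_R" "?R (b - z0) - ?R (b - z1) = C_R"
    using y z by (auto simp: left_match_def right_match_def)
  have "z1 < y1"
    using pass_integral_less_iff(2)[OF focusL, of y1 z1 a_L]
      pass_integral_strict_mono[OF focusL, of y0 z0 a_L] pos eqs \<open>y0 < z0\<close> by simp
  have curve: "\<exists>u. z1 \<le> u \<and> u \<le> y1 \<and> ?L u = ?L t + C_L \<and> ?g t = u" if t: "y0 \<le> t" "t \<le> z0" for t
  proof -
    have "?L y0 \<le> ?L t" "?L t \<le> ?L z0"
      using pass_integral_strict_mono[OF focusL, of y0 t a_L]
        pass_integral_strict_mono[OF focusL, of t z0 a_L] t pos by fastforce+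
    then have "?L y1 \<le> ?L t + C_L" "?L t + C_L \<le> ?L z1" using eqs by auto
    moreover have "isCont ?L v" if "z1 \<le> v \<and> v \<le> y1" for v
      using pass_integral_deriv[OF focusL, of a_L v] that pos by (auto dest: DERIV_isCont)
    ultimately obtain u where u: "z1 \<le> u" "u \<le> y1" "?L u = ?L t + C_L"
      using IVT2[of ?L y1 "?L t + C_L" z1] \<open>z1 < y1\<close> by auto
    then have "?g t = u"
      using neg_branch_eq[OF focusL, of u a_L] pos by auto
    then show ?thesis using u by blast
  qed
  have dk: "(k has_real_derivative
      - (2 * D_R * (b - t) / W_L a_R T_R D_R (t - b))
      + 2 * D_R * (b - ?g t) / W_L a_R T_R D_R (?g t - b)
        * (W_L a_L T_L D_L (?g t) / (2 * D_L * ?g t) * (2 * D_L * t / W_L a_L T_L D_L t))) (at t)"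
    if t: "y0 \<le> t" "t \<le> z0" for t
  proof -
    obtain u where u: "z1 \<le> u" "u \<le> y1" "?L u = ?L t + C_L" "?g t = u"
      using curve[OF t] by blast
    have sg: "u < 0" "u < b" "t > 0" "t > b" using u t pos by auto
    have dg: "(?g has_real_derivative
        W_L a_L T_L D_L u / (2 * D_L * u) * (2 * D_L * t / W_L a_L T_L D_L t)) (at t)"
    proof (rule DERIV_chain2[where f = "neg_branch a_L T_L D_L" and g = "\<lambda>t. ?L t + C_L"])
      show "(neg_branch a_L T_L D_L has_real_derivative W_L a_L T_L D_L u / (2 * D_L * u))
          (at (?L t + C_L))"
        using neg_branch_deriv[OF focusL \<open>u < 0\<close>, of a_L] u by simp
      show "((\<lambda>t. ?L t + C_L) has_real_derivative 2 * D_L * t / W_L a_L T_L D_L t) (at t)"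
        using pass_integral_deriv[OF focusL, of a_L t] sg by (auto intro!: derivative_eq_intros)
    qed
    have dR: "(?R has_real_derivative 2 * D_R * (b - v) / W_L a_R T_R D_R (v - b)) (at (b - v))"
      if "v \<noteq> b" for v
      using pass_integral_deriv[OF focusR, of "- a_R" "b - v"] that W_L_reflect[of a_R T_R D_R "v - b"]
      by simp
    have 1: "((\<lambda>t. ?R (b - t)) has_real_derivative 2 * D_R * (b - t) / W_L a_R T_R D_R (t - b) * (- 1)) (at t)"
      by (rule DERIV_chain2[where f = ?R and g = "\<lambda>t. b - t", OF dR]) (use sg in \<open>auto intro!: derivative_eq_intros\<close>)
    have 2: "((\<lambda>t. ?R (b - ?g t)) has_real_derivative 2 * D_R * (b - u) / W_L a_R T_R D_R (u - b)
        * (- (W_L a_L T_L D_L u / (2 * D_L * u) * (2 * D_L * t / W_L a_L T_L D_L t)))) (at t)"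
    proof (rule DERIV_chain2[where f = ?R and g = "\<lambda>t. b - ?g t"])
      show "(?R has_real_derivative 2 * D_R * (b - u) / W_L a_R T_R D_R (u - b)) (at (b - ?g t))"
        unfolding u(4) by (rule dR) (use sg in simp)
    qed (use dg in \<open>auto intro!: derivative_eq_intros\<close>)
    show ?thesis
      unfolding k_def[abs_def] u(4) using DERIV_diff[OF 1 2] by simp
  qed
  have "k y0 = k z0"
  proof -
    have "?g y0 = y1" "?g z0 = z1"
      using neg_branch_eq[OF focusL, of y1 a_L] neg_branch_eq[OF focusL, of z1 a_L] eqs pos by auto
    then show ?thesis using eqs by (simp add: k_def)
  qed
  then obtain t where t: "y0 < t" "t < z0" "(k has_real_derivative 0) (at t)"
    using Rolle[of y0 z0 k] \<open>y0 < z0\<close> dk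
    by (metis DERIV_isCont continuous_at_imp_continuous_on atLeastAtMost_iff less_imp_le
        real_differentiable_def)
  obtain u where u: "z1 \<le> u" "u \<le> y1" "?L u = ?L t + C_L" "?g t = u"
    using curve[of t] t by auto
  have sg: "u < 0" "u < b" "t > 0" "t > b" using u t pos by auto
  have W: "W_L a_R T_R D_R (t - b) > 0" "W_L a_R T_R D_R (u - b) > 0"
    "W_L a_L T_L D_L u > 0" "W_L a_L T_L D_L t > 0" "D_L > 0" "D_R > 0"
    using sg W_L_pos[OF focusL] W_L_pos[OF focusR] focus_det_pos[OF focusL] focus_det_pos[OF focusR]
    by auto
  have "- (2 * D_R * (b - t) / W_L a_R T_R D_R (t - b))
      + 2 * D_R * (b - u) / W_L a_R T_R D_R (u - b)
        * (W_L a_L T_L D_L u / (2 * D_L * u) * (2 * D_L * t / W_L a_L T_L D_L t)) = 0"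
    using DERIV_unique[OF dk t(3)] t u(4) by simp
  moreover have "- (2 * D_R * (b - t) / W_L a_R T_R D_R (t - b))
      + 2 * D_R * (b - u) / W_L a_R T_R D_R (u - b)
        * (W_L a_L T_L D_L u / (2 * D_L * u) * (2 * D_L * t / W_L a_L T_L D_L t))
      = 2 * D_R * ((b - u) / W_L a_R T_R D_R (u - b) * (W_L a_L T_L D_L u / u * (t / W_L a_L T_L D_L t))
                   - (b - t) / W_L a_R T_R D_R (t - b))"
    using W sg by (simp add: field_simps)
  ultimately have "(b - u) / W_L a_R T_R D_R (u - b) * (W_L a_L T_L D_L u / u * (t / W_L a_L T_L D_L t))
      = (b - t) / W_L a_R T_R D_R (t - b)"
    using W by simp
  then have "(b - u) * t * W_L a_L T_L D_L u * W_L a_R T_R D_R (t - b)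
      = (b - t) * u * W_L a_L T_L D_L t * W_L a_R T_R D_R (u - b)"
    using W sg by (simp add: field_simps)
  then have "(t - u) * F_fun a_L a_R T_L D_L T_R D_R b t u = 0"
    unfolding F_fun_identity[symmetric] by (simp add: algebra_simps)
  then have "F_fun a_L a_R T_L D_L T_R D_R b t u = 0" using sg by simp
  moreover have "left_match t u"
    using u t sg pos by (auto simp: left_match_def)
  ultimately show ?thesis using t by blast
qed

section \<open>Zeros of G on the curve F = 0\<close>

lemma F_fun_eq_conic:
  assumes "y0 \<noteq> 0" "y1 \<noteq> 0"
  shows "F_fun a_L a_R T_L D_L T_R D_R b y0 y1 = (y0 * y1)^2 * conic (1 / y0 + 1 / y1) (1 / (y0 * y1))"
  using assms unfolding F_fun_def conic_def
  by (simp add: field_simps power2_eq_square)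

lemma eval2_F_tilde:
  "eval2 (F_tilde a_L a_R T_L D_L T_R D_R b) (y0 + y1) (y0 * y1) = F_fun a_L a_R T_L D_L T_R D_R b y0 y1"
  unfolding F_tilde_eq
  by (simp add: eval2_def F_fun_def algebra_simps power2_eq_square)

lemma eval2_G_tilde:
  "eval2 (G_tilde a_L a_R T_L D_L T_R D_R b) (y0 + y1) (y0 * y1) = G_fun a_L a_R T_L D_L T_R D_R b y0 y1"
  unfolding G_tilde_eq G_fun_def deriv_F_fun deriv_F_fun' W_L_def
  by (simp add: eval2_def algebra_simps power2_eq_square)

text \<open>At a critical point of the left equation along a regular curve, the tangent is parallel to
\<open>(y\<^sub>1 W\<^sub>L(y\<^sub>0), y\<^sub>0 W\<^sub>L(y\<^sub>1))\<close>, the direction of the level curves of the left equation. If \<open>F\<close> vanishes along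
the curve, its derivative in this direction is zero, and that derivative is \<open>- G\<close>. The argument
covers singular points of \<open>F = 0\<close>, because regularity is required of the parametrisation only.\<close>

lemma G_zero_at_tangency:
  fixes y0 y1 :: "real \<Rightarrow> real"
  assumes d: "(y0 has_real_derivative d0) (at t)" "(y1 has_real_derivative d1) (at t)"
    and "y0 t > 0" "y1 t < 0" and regular: "d0 \<noteq> 0 \<or> d1 \<noteq> 0"
    and "open S" "t \<in> S" and F: "\<And>s. s \<in> S \<Longrightarrow> F_fun a_L a_R T_L D_L T_R D_R b (y0 s) (y1 s) = 0"
    and L: "((\<lambda>s. pass_integral a_L T_L D_L (y1 s) - pass_integral a_L T_L D_L (y0 s))
              has_real_derivative 0) (at t)"
  shows "G_fun a_L a_R T_L D_L T_R D_R b (y0 t) (y1 t) = 0"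
proof -
  define F0 where "F0 = deriv (\<lambda>u. F_fun a_L a_R T_L D_L T_R D_R b u (y1 t)) (y0 t)"
  define F1 where "F1 = deriv (\<lambda>u. F_fun a_L a_R T_L D_L T_R D_R b (y0 t) u) (y1 t)"
  define W0 W1 where "W0 = W_L a_L T_L D_L (y0 t)" and "W1 = W_L a_L T_L D_L (y1 t)"
  have W: "W0 > 0" "W1 > 0" "D_L > 0"
    using W_L_pos[OF focusL, of a_L] focus_det_pos[OF focusL] assms(3,4) by (auto simp: W0_def W1_def)
  have "((\<lambda>s. F_fun a_L a_R T_L D_L T_R D_R b (y0 s) (y1 s)) has_real_derivative F0 * d0 + F1 * d1) (at t)"
    unfolding F0_def F1_def deriv_F_fun deriv_F_fun' unfolding F_fun_def
    using d by (auto intro!: derivative_eq_intros simp: algebra_simps power2_eq_square)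
  then have "((\<lambda>s. 0) has_real_derivative F0 * d0 + F1 * d1) (at t)"
    by (rule has_field_derivative_transform_within_open[OF _ \<open>open S\<close> \<open>t \<in> S\<close>]) (rule F)
  then have Fd: "F0 * d0 + F1 * d1 = 0"
    using DERIV_unique DERIV_const by blast
  have "((\<lambda>s. pass_integral a_L T_L D_L (y1 s) - pass_integral a_L T_L D_L (y0 s)) has_real_derivative
      2 * D_L * y1 t / W1 * d1 - 2 * D_L * y0 t / W0 * d0) (at t)"
    unfolding W0_def W1_def
    using assms(3,4)
    by (intro DERIV_diff DERIV_chain2[OF pass_integral_deriv[OF focusL] d(1)]
          DERIV_chain2[OF pass_integral_deriv[OF focusL] d(2)]) auto
  then have "2 * D_L * y1 t / W1 * d1 - 2 * D_L * y0 t / W0 * d0 = 0"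
    using L DERIV_unique by blast
  then have rel: "y1 t * W0 * d1 = y0 t * W1 * d0"
    using W by (simp add: field_simps)
  define c where "c = d0 / (y1 t * W0)"
  have c0: "d0 = c * (y1 t * W0)"
    using W assms(4) by (simp add: c_def)
  have "(y1 t * W0) * d1 = (y1 t * W0) * (c * (y0 t * W1))"
    unfolding rel c0 by (simp add: algebra_simps)
  then have "d1 = c * (y0 t * W1)"
    using W assms(4) by simp
  note c = c0 this
  have "c \<noteq> 0" using regular c by auto
  moreover have "c * (y1 t * W0 * F0 + y0 t * W1 * F1) = 0"
    using Fd unfolding c by (simp add: algebra_simps)
  ultimately show ?thesis
    unfolding G_fun_def F0_def[symmetric] F1_def[symmetric] W0_def[symmetric] W1_def[symmetric] by simp
qed

text \<open>Rolle's theorem along one arc: if \<open>card K\<close> points of the left curve lie on a regular arc of \<open>F = 0\<close>,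
the left equation has a critical point between any two of them, and there \<open>G = 0\<close>. The condition on
\<open>I\<close> says that the part of the parametrised curve with \<open>\<eta> < 0\<close> under consideration is connected, and
injectivity makes different critical parameters different zeros.\<close>

lemma arc_tangencies:
  fixes \<zeta> \<eta> :: "real \<Rightarrow> real"
  assumes d\<zeta>: "\<And>t. (\<zeta> has_real_derivative \<zeta>' t) (at t)"
    and d\<eta>: "\<And>t. (\<eta> has_real_derivative \<eta>' t) (at t)"
    and regular: "\<And>t. \<zeta>' t \<noteq> 0 \<or> \<eta>' t \<noteq> 0"
    and on_conic: "\<And>t. conic (\<zeta> t) (\<eta> t) = 0"
    and I: "\<And>s r t. s \<in> I \<Longrightarrow> t \<in> I \<Longrightarrow> s \<le> r \<Longrightarrow> r \<le> t \<Longrightarrow> r \<in> I"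
    and neg: "\<And>t. t \<in> I \<Longrightarrow> \<eta> t < 0"
    and inj: "inj_on (\<lambda>t. (\<zeta> t, \<eta> t)) I"
    and "finite K"
    and K: "\<And>u0 u1. (u0, u1) \<in> K \<Longrightarrow> left_match u0 u1 \<and>
              (\<exists>t\<in>I. \<zeta> t = 1 / u0 + 1 / u1 \<and> \<eta> t = 1 / (u0 * u1))"
  shows "\<exists>S \<subseteq> common_zeros. finite S \<and> card K \<le> card S + 1"
proof -
  \<comment> \<open>\<open>1 / y\<^sub>0\<close> and \<open>1 / y\<^sub>1\<close> are the roots of \<open>X\<^sup>2 - \<zeta> X + \<eta>\<close>; they are real, of opposite sign, as \<open>\<eta> < 0\<close>\<close>
  define p q where "p t = (\<zeta> t + sqrt (\<zeta> t^2 - 4 * \<eta> t)) / 2"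
    and "q t = (\<zeta> t - sqrt (\<zeta> t^2 - 4 * \<eta> t)) / 2" for t
  define y0 y1 where "y0 t = 1 / p t" and "y1 t = 1 / q t" for t
  define H where "H t = pass_integral a_L T_L D_L (y1 t) - pass_integral a_L T_L D_L (y0 t)" for t
  have sum: "p t + q t = \<zeta> t" for t by (simp add: p_def q_def field_simps)
  have disc: "\<zeta> t^2 - 4 * \<eta> t > 0" "\<bar>\<zeta> t\<bar> < sqrt (\<zeta> t^2 - 4 * \<eta> t)" if "\<eta> t < 0" for t
  proof -
    show "\<zeta> t^2 - 4 * \<eta> t > 0" using that zero_le_power2[of "\<zeta> t"] by linarith
    have "sqrt (\<zeta> t^2) < sqrt (\<zeta> t^2 - 4 * \<eta> t)" using that by (intro real_sqrt_less_mono) simp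
    then show "\<bar>\<zeta> t\<bar> < sqrt (\<zeta> t^2 - 4 * \<eta> t)" by simp
  qed
  have prod: "p t * q t = \<eta> t" if "\<eta> t < 0" for t
  proof -
    have "p t * q t = (\<zeta> t^2 - (sqrt (\<zeta> t^2 - 4 * \<eta> t))^2) / 4"
      by (simp add: p_def q_def field_simps power2_eq_square)
    then show ?thesis using disc(1)[OF that] by simp
  qed
  have pq: "p t > 0" "q t < 0" if "\<eta> t < 0" for t
    using disc(2)[OF that] by (auto simp: p_def q_def)
  have y: "y0 t > 0" "y1 t < 0" if "\<eta> t < 0" for t
    using pq[OF that] by (auto simp: y0_def y1_def divide_neg_pos)
  have yinv: "1 / y0 t + 1 / y1 t = \<zeta> t" "1 / (y0 t * y1 t) = \<eta> t" if "\<eta> t < 0" for t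
    using sum[of t] prod[OF that] by (simp_all add: y0_def y1_def)
  have F0: "F_fun a_L a_R T_L D_L T_R D_R b (y0 t) (y1 t) = 0" if "\<eta> t < 0" for t
    using F_fun_eq_conic[of "y0 t" "y1 t"] y[OF that] yinv[OF that] on_conic[of t] by simp
  have derivs: "\<exists>d0 d1. (y0 has_real_derivative d0) (at t) \<and> (y1 has_real_derivative d1) (at t) \<and>
      (d0 \<noteq> 0 \<or> d1 \<noteq> 0)" if "\<eta> t < 0" for t
  proof -
    define s where "s = sqrt (\<zeta> t^2 - 4 * \<eta> t)"
    define d where "d = (2 * \<zeta> t * \<zeta>' t - 4 * \<eta>' t) / (2 * s)"
    have "s > 0" using disc(1)[OF that] by (simp add: s_def)
    have "((\<lambda>t. \<zeta> t^2 - 4 * \<eta> t) has_real_derivative 2 * \<zeta> t * \<zeta>' t - 4 * \<eta>' t) (at t)"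
      using d\<zeta>[of t] d\<eta>[of t] by (auto intro!: derivative_eq_intros)
    from DERIV_chain2[OF DERIV_real_sqrt[OF disc(1)[OF that]] this]
    have ds: "((\<lambda>t. sqrt (\<zeta> t^2 - 4 * \<eta> t)) has_real_derivative d) (at t)"
      by (simp add: d_def s_def field_simps)
    define r where "r t = sqrt (\<zeta> t^2 - 4 * \<eta> t)" for t
    have pr: "p = (\<lambda>t. (\<zeta> t + r t) / 2)" and qr: "q = (\<lambda>t. (\<zeta> t - r t) / 2)"
      by (auto simp: p_def q_def r_def)
    have dr: "(r has_real_derivative d) (at t)" unfolding r_def[abs_def] by (rule ds)
    have dp: "(p has_real_derivative (\<zeta>' t + d) / 2) (at t)"
      unfolding pr using d\<zeta>[of t] dr by (auto intro!: derivative_eq_intros)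
    have dq: "(q has_real_derivative (\<zeta>' t - d) / 2) (at t)"
      unfolding qr using d\<zeta>[of t] dr by (auto intro!: derivative_eq_intros)
    have "(y0 has_real_derivative - ((\<zeta>' t + d) / 2) / (p t)^2) (at t)"
      unfolding y0_def[abs_def] using dp pq[OF that]
      by (auto intro!: derivative_eq_intros simp: power2_eq_square)
    moreover have "(y1 has_real_derivative - ((\<zeta>' t - d) / 2) / (q t)^2) (at t)"
      unfolding y1_def[abs_def] using dq pq[OF that]
      by (auto intro!: derivative_eq_intros simp: power2_eq_square)
    moreover have "- ((\<zeta>' t + d) / 2) / (p t)^2 \<noteq> 0 \<or> - ((\<zeta>' t - d) / 2) / (q t)^2 \<noteq> 0"
    proof (rule ccontr)
      assume "\<not> ?thesis"
      then have "\<zeta>' t + d = 0" "\<zeta>' t - d = 0" using pq[OF that] by auto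
      then have "\<zeta>' t = 0" "d = 0" by auto
      then have "\<eta>' t = 0" using \<open>s > 0\<close> by (simp add: d_def)
      then show False using regular[of t] \<open>\<zeta>' t = 0\<close> by simp
    qed
    ultimately show ?thesis by blast
  qed
  have dH: "\<exists>d. (H has_real_derivative d) (at t)" if neg_t: "\<eta> t < 0" for t
  proof -
    obtain d0 d1 where d: "(y0 has_real_derivative d0) (at t)" "(y1 has_real_derivative d1) (at t)"
      using derivs[OF neg_t] by blast
    have "((\<lambda>s. pass_integral a_L T_L D_L (y1 s)) has_real_derivative
        2 * D_L * y1 t / W_L a_L T_L D_L (y1 t) * d1) (at t)"
      by (rule DERIV_chain2[where f = "pass_integral a_L T_L D_L" and g = y1,
            OF pass_integral_deriv[OF focusL] d(2)]) (use y[OF neg_t] in simp)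
    moreover have "((\<lambda>s. pass_integral a_L T_L D_L (y0 s)) has_real_derivative
        2 * D_L * y0 t / W_L a_L T_L D_L (y0 t) * d0) (at t)"
      by (rule DERIV_chain2[where f = "pass_integral a_L T_L D_L" and g = y0,
            OF pass_integral_deriv[OF focusL] d(1)]) (use y[OF neg_t] in simp)
    ultimately show ?thesis
      unfolding H_def[abs_def] using DERIV_diff by blast
  qed
  define \<tau> where "\<tau> u = (SOME t. t \<in> I \<and> \<zeta> t = 1 / fst u + 1 / snd u \<and> \<eta> t = 1 / (fst u * snd u))"
    for u :: "real \<times> real"
  have \<tau>: "\<tau> u \<in> I" "\<zeta> (\<tau> u) = 1 / fst u + 1 / snd u" "\<eta> (\<tau> u) = 1 / (fst u * snd u)"
    if "u \<in> K" for u
    using someI_ex[of "\<lambda>t. t \<in> I \<and> \<zeta> t = 1 / fst u + 1 / snd u \<and> \<eta> t = 1 / (fst u * snd u)"]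
      K[of "fst u" "snd u"] that unfolding \<tau>_def[symmetric] by auto
  have yback: "y0 (\<tau> u) = fst u" "y1 (\<tau> u) = snd u" if "u \<in> K" for u
  proof -
    have u: "fst u > 0" "snd u < 0"
      using K[of "fst u" "snd u"] that by (auto simp: left_match_def)
    have "\<zeta> (\<tau> u)^2 - 4 * \<eta> (\<tau> u) = (1 / fst u - 1 / snd u)^2"
    proof -
      have "(x + z)^2 - 4 * (x * z) = (x - z)^2" for x z :: real
        by (simp add: power2_eq_square algebra_simps)
      from this[of "1 / fst u" "1 / snd u"] show ?thesis
        unfolding \<tau>(2,3)[OF that] by simp
    qed
    moreover have "1 / fst u > 0" "1 / snd u < 0" using u by simp_all
    then have "1 / fst u - 1 / snd u > 0" by linarith
    ultimately have "sqrt (\<zeta> (\<tau> u)^2 - 4 * \<eta> (\<tau> u)) = 1 / fst u - 1 / snd u"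
      by simp
    then show "y0 (\<tau> u) = fst u" "y1 (\<tau> u) = snd u"
      unfolding y0_def y1_def p_def q_def \<tau>(2)[OF that] by simp_all
  qed
  have "inj_on \<tau> K" using yback by (metis inj_onI prod_eqI)
  then have cardK: "card (\<tau> ` K) = card K" by (rule card_image)
  obtain S where S: "finite S" "card (\<tau> ` K) \<le> card S + 1"
    "\<And>t. t \<in> S \<Longrightarrow> t \<in> I \<and> (H has_real_derivative 0) (at t)"
  proof (rule interlaced_witnesses[of "\<tau> ` K" "\<lambda>t. t \<in> I \<and> (H has_real_derivative 0) (at t)"])
    fix s t assume st: "s \<in> \<tau> ` K" "t \<in> \<tau> ` K" "s < t"
    have "H (\<tau> u) = C_L" if "u \<in> K" for u
      using K[of "fst u" "snd u"] that yback[OF that] by (simp add: H_def left_match_def)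
    then have "H s = H t" using st by auto
    have inI: "r \<in> I" if "s \<le> r" "r \<le> t" for r
      using I[of s t r] st \<tau>(1) that by auto
    have dif: "\<exists>d. (H has_real_derivative d) (at r)" if "s \<le> r" "r \<le> t" for r
      using dH neg inI that by blast
    obtain r where "s < r" "r < t" "(H has_real_derivative 0) (at r)"
    proof (rule Rolle[OF \<open>s < t\<close> \<open>H s = H t\<close>, THEN exE])
      show "continuous_on {s..t} H"
      proof (intro continuous_at_imp_continuous_on ballI)
        fix r assume "r \<in> {s..t}"
        then show "isCont H r" using dif[of r] DERIV_isCont by auto
      qed
      show "H differentiable (at r)" if "s < r" "r < t" for r
        using dif[of r] that by (auto simp: real_differentiable_def)
    qed blast
    then show "\<exists>z>s. z < t \<and> z \<in> I \<and> (H has_real_derivative 0) (at z)"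
      using inI[of r] by auto
  qed (use \<open>finite K\<close> that in auto)
  define pt where "pt t = (y0 t + y1 t, y0 t * y1 t)" for t
  have "pt t \<in> common_zeros" if "t \<in> S" for t
  proof -
    have t: "\<eta> t < 0" "(H has_real_derivative 0) (at t)" using S(3)[OF that] neg by auto
    have opn: "open {s. \<eta> s < 0}"
      using d\<eta> by (intro open_Collect_less continuous_intros continuous_at_imp_continuous_on)
        (auto dest: DERIV_isCont)
    obtain d0 d1 where d: "(y0 has_real_derivative d0) (at t)" "(y1 has_real_derivative d1) (at t)"
      "d0 \<noteq> 0 \<or> d1 \<noteq> 0" using derivs[OF t(1)] by blast
    have "G_fun a_L a_R T_L D_L T_R D_R b (y0 t) (y1 t) = 0"
      using G_zero_at_tangency[OF d(1,2) y[OF t(1)] d(3) opn] t F0 unfolding H_def[abs_def] by simp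
    then show ?thesis
      using F0[OF t(1)] y[OF t(1)]
      by (simp add: pt_def common_zeros_def eval2_F_tilde eval2_G_tilde mult_pos_neg)
  qed
  moreover have "inj_on pt S"
  proof (rule inj_onI)
    fix s t assume st: "s \<in> S" "t \<in> S" "pt s = pt t"
    then have neg': "s \<in> I" "t \<in> I" "\<eta> s < 0" "\<eta> t < 0" using S(3) neg by auto
    have rel: "\<zeta> r = (y0 r + y1 r) / (y0 r * y1 r)" "\<eta> r = 1 / (y0 r * y1 r)" if "\<eta> r < 0" for r
      using yinv[OF that] y[OF that] by (auto simp: field_simps)
    have "\<zeta> s = \<zeta> t" "\<eta> s = \<eta> t"
      using rel[OF neg'(3)] rel[OF neg'(4)] st(3) by (auto simp: pt_def)
    then show "s = t" using inj neg' by (auto dest: inj_onD)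
  qed
  ultimately show ?thesis
    using S cardK by (intro exI[of _ "pt ` S"]) (auto simp: card_image)
qed

text \<open>A half plane cuts a line in a ray, an open line or nothing, each of which is one arc.\<close>

lemma line_tangencies:
  assumes "finite K" and \<beta>\<gamma>: "\<beta> \<noteq> 0 \<or> \<gamma> \<noteq> 0"
    and line: "\<And>\<zeta> \<eta>. \<alpha> + \<beta> * \<zeta> + \<gamma> * \<eta> = 0 \<Longrightarrow> conic \<zeta> \<eta> = 0"
    and K: "\<And>u0 u1. (u0, u1) \<in> K \<Longrightarrow> left_match u0 u1 \<and>
              \<alpha> + \<beta> * (1 / u0 + 1 / u1) + \<gamma> * (1 / (u0 * u1)) = 0"
  shows "\<exists>S \<subseteq> common_zeros. finite S \<and> card K \<le> card S + 1"
proof -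
  define N where "N = \<beta>^2 + \<gamma>^2"
  have N: "N \<noteq> 0" using \<beta>\<gamma> by (simp add: N_def)
  \<comment> \<open>the line, parametrised from the foot of its perpendicular through the origin\<close>
  define \<zeta> \<eta> where "\<zeta> t = - \<alpha> * \<beta> / N + \<gamma> * t" and "\<eta> t = - \<alpha> * \<gamma> / N - \<beta> * t" for t
  have on_line: "\<alpha> + \<beta> * \<zeta> t + \<gamma> * \<eta> t = 0" for t
  proof -
    have "\<alpha> + \<beta> * \<zeta> t + \<gamma> * \<eta> t = \<alpha> - \<alpha> * (\<beta>^2 + \<gamma>^2) / N"
      by (simp add: \<zeta>_def \<eta>_def algebra_simps power2_eq_square add_divide_distrib)
    then show ?thesis using N by (simp add: N_def[symmetric])
  qed
  show ?thesis
  proof (rule arc_tangencies[of \<zeta> "\<lambda>_. \<gamma>" \<eta> "\<lambda>_. - \<beta>" "{t. \<eta> t < 0}" K])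
    show "(\<zeta> has_real_derivative \<gamma>) (at t)" for t
      unfolding \<zeta>_def[abs_def] by (auto intro!: derivative_eq_intros)
    show "(\<eta> has_real_derivative - \<beta>) (at t)" for t
      unfolding \<eta>_def[abs_def] by (auto intro!: derivative_eq_intros)
    show "\<gamma> \<noteq> 0 \<or> - \<beta> \<noteq> 0" for t :: real using \<beta>\<gamma> by auto
    show "conic (\<zeta> t) (\<eta> t) = 0" for t by (rule line[OF on_line])
    show "r \<in> {t. \<eta> t < 0}" if "s \<in> {t. \<eta> t < 0}" "t \<in> {t. \<eta> t < 0}" "s \<le> r" "r \<le> t" for s r t
    proof -
      have "\<eta> r \<le> \<eta> s \<or> \<eta> r \<le> \<eta> t"
        using that by (cases "\<beta> \<ge> 0") (auto simp: \<eta>_def intro: mult_left_mono mult_left_mono_neg)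
      then show ?thesis using that by auto
    qed
    show "inj_on (\<lambda>t. (\<zeta> t, \<eta> t)) {t. \<eta> t < 0}"
      using \<beta>\<gamma> by (auto intro!: inj_onI simp: \<zeta>_def \<eta>_def)
    show "left_match u0 u1 \<and> (\<exists>t\<in>{t. \<eta> t < 0}. \<zeta> t = 1 / u0 + 1 / u1 \<and> \<eta> t = 1 / (u0 * u1))"
      if "(u0, u1) \<in> K" for u0 u1
    proof -
      define z e where "z = 1 / u0 + 1 / u1" and "e = 1 / (u0 * u1)"
      have ze: "\<alpha> = - (\<beta> * z + \<gamma> * e)" using K[OF that] by (simp add: z_def e_def)
      have "u0 > 0" "u1 < 0" using K[OF that] by (auto simp: left_match_def)
      then have "e < 0" by (simp add: e_def divide_neg_pos mult_pos_neg)
      have "\<zeta> ((\<gamma> * z - \<beta> * e) / N) = z * ((\<beta>^2 + \<gamma>^2) / N)"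
        unfolding \<zeta>_def ze by (simp add: algebra_simps power2_eq_square add_divide_distrib diff_divide_distrib)
      moreover have "\<eta> ((\<gamma> * z - \<beta> * e) / N) = e * ((\<beta>^2 + \<gamma>^2) / N)"
        unfolding \<eta>_def ze by (simp add: algebra_simps power2_eq_square add_divide_distrib diff_divide_distrib)
      ultimately have "\<zeta> ((\<gamma> * z - \<beta> * e) / N) = z" "\<eta> ((\<gamma> * z - \<beta> * e) / N) = e"
        using N unfolding N_def[symmetric] by simp_all
      then show ?thesis
        using K[OF that] \<open>e < 0\<close> unfolding z_def[symmetric] e_def[symmetric]
        by (intro conjI bexI[of _ "(\<gamma> * z - \<beta> * e) / N"]) auto
    qed
  qed (use \<open>finite K\<close> in auto)
qed

text \<open>The quadratic part of the conic is definite, so that the conic is empty, a point or an ellipse. On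
an ellipse \<open>\<eta> = \<eta>\<^sub>c - r cos t\<close>, and for \<open>t\<close> in \<open>(-\<pi>, \<pi>]\<close> the condition \<open>\<eta> < 0\<close> bounds \<open>cos t\<close> from below,
which leaves an interval: one arc.\<close>

lemma ellipse_tangencies:
  assumes "finite K"
    and nz: "m3 a_L a_R T_L D_L T_R D_R b \<noteq> 0"
    and definite: "4 * m0 a_L a_R T_L D_L T_R D_R b * m3 a_L a_R T_L D_L T_R D_R b
                   - (m1 a_L a_R T_L D_L T_R D_R b)^2 > 0"
    and K: "\<And>u0 u1. (u0, u1) \<in> K \<Longrightarrow> left_match u0 u1 \<and>
              conic (1 / u0 + 1 / u1) (1 / (u0 * u1)) = 0"
  shows "\<exists>S \<subseteq> common_zeros. finite S \<and> card K \<le> card S + 1"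
proof -
  define M0 M1 M2 M3 M4 M5 where "M0 = m0 a_L a_R T_L D_L T_R D_R b"
    and "M1 = m1 a_L a_R T_L D_L T_R D_R b" and "M2 = m2 a_L a_R T_L D_L T_R D_R b"
    and "M3 = m3 a_L a_R T_L D_L T_R D_R b" and "M4 = m4 a_L a_R T_L D_L T_R D_R b"
    and "M5 = m5 a_L a_R T_L D_L T_R D_R b"
  note M = M0_def[symmetric] M1_def[symmetric] M2_def[symmetric] M3_def[symmetric]
    M4_def[symmetric] M5_def[symmetric]
  define \<delta> f where "\<delta> = 4 * M0 * M3 - M1^2" and "f = 2 * M3 * (M2 - 2 * M3) - M1 * M4"
  define \<rho> where "\<rho> = f^2 / \<delta> - (4 * M3 * M5 - M4^2)"
  have "\<delta> > 0" "M3 \<noteq> 0" using definite nz by (simp_all add: \<delta>_def M)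
  have square: "4 * M3 * conic \<zeta> \<eta> = (2 * M3 * \<zeta> + M1 * \<eta> + M4)^2 + \<delta> * (\<eta> + f / \<delta>)^2 - \<rho>" for \<zeta> \<eta>
  proof -
    have "\<delta> * (\<eta> + f / \<delta>)^2 = \<delta> * \<eta>^2 + 2 * f * \<eta> + f^2 / \<delta>"
      using \<open>\<delta> > 0\<close> by (simp add: field_simps power2_eq_square)
    then have "\<delta> * (\<eta> + f / \<delta>)^2 - \<rho> = \<delta> * \<eta>^2 + 2 * f * \<eta> + (4 * M3 * M5 - M4^2)"
      by (simp add: \<rho>_def)
    then show ?thesis
      unfolding conic_def M \<delta>_def f_def by (simp add: algebra_simps power2_eq_square)
  qed
  have conic_iff: "conic \<zeta> \<eta> = 0 \<longleftrightarrow> (2 * M3 * \<zeta> + M1 * \<eta> + M4)^2 + \<delta> * (\<eta> + f / \<delta>)^2 = \<rho>" for \<zeta> \<eta>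
    using square[of \<zeta> \<eta>] \<open>M3 \<noteq> 0\<close> by (metis diff_eq_eq add_0 mult_eq_0_iff zero_neq_numeral diff_self)
  show ?thesis
  proof (cases "\<rho> > 0")
    case False
    have point: "1 / u0 + 1 / u1 = (M1 * f / \<delta> - M4) / (2 * M3) \<and> 1 / (u0 * u1) = - f / \<delta>"
      if "(u0, u1) \<in> K" for u0 u1
    proof -
      have "(2 * M3 * (1 / u0 + 1 / u1) + M1 * (1 / (u0 * u1)) + M4)^2
          + \<delta> * (1 / (u0 * u1) + f / \<delta>)^2 = \<rho>"
        using K[OF that] conic_iff by blast
      moreover have "\<delta> * (1 / (u0 * u1) + f / \<delta>)^2 \<ge> 0" using \<open>\<delta> > 0\<close> by simp
      ultimately have "(2 * M3 * (1 / u0 + 1 / u1) + M1 * (1 / (u0 * u1)) + M4)^2 = 0"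
        "\<delta> * (1 / (u0 * u1) + f / \<delta>)^2 = 0"
        using False zero_le_power2[of "2 * M3 * (1 / u0 + 1 / u1) + M1 * (1 / (u0 * u1)) + M4"]
        by linarith+
      then have 1: "2 * M3 * (1 / u0 + 1 / u1) + M1 * (1 / (u0 * u1)) + M4 = 0"
        and 2: "1 / (u0 * u1) = - f / \<delta>"
        using \<open>\<delta> > 0\<close> by (auto simp: eq_neg_iff_add_eq_0)
      have "2 * M3 * (1 / u0 + 1 / u1) = M1 * f / \<delta> - M4"
        using 1 unfolding 2 by (simp add: algebra_simps)
      then show ?thesis using 2 \<open>M3 \<noteq> 0\<close> by (simp add: eq_divide_eq mult.commute)
    qed
    have "u = v" if u: "u \<in> K" and v: "v \<in> K" for u v
    proof -
      obtain u0 u1 v0 v1 where uv: "u = (u0, u1)" "v = (v0, v1)" by (meson surj_pair)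
      have sg: "u0 > 0" "u1 < 0" "v0 > 0" "v1 < 0"
        using K[of u0 u1] K[of v0 v1] u v uv by (auto simp: left_match_def)
      have s: "1 / u0 + 1 / u1 = 1 / v0 + 1 / v1" and p: "1 / u0 * (1 / u1) = 1 / v0 * (1 / v1)"
        using point[of u0 u1] point[of v0 v1] u v uv by simp_all
      have "(1 / u0 - 1 / v0) * (1 / u0 - 1 / v1) = (1 / u0) * (1 / u0) - (1 / v0 + 1 / v1) * (1 / u0) + 1 / v0 * (1 / v1)"
        by (simp add: algebra_simps)
      also have "\<dots> = 0" unfolding s[symmetric] p[symmetric] by (simp add: algebra_simps)
      finally have "1 / u0 = 1 / v0 \<or> 1 / u0 = 1 / v1" by simp
      moreover have "1 / u0 > 0" "1 / v1 < 0" using sg by auto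
      ultimately have "1 / u0 = 1 / v0" by linarith
      then have "u0 = v0" "u1 = v1" using s by simp_all
      then show ?thesis using uv by simp
    qed
    then have "card K \<le> 1"
      using \<open>finite K\<close> by (simp add: card_le_Suc0_iff_eq)
    then show ?thesis by (intro exI[of _ "{}"]) auto
  next
    case True
    define r where "r = sqrt (\<rho> / \<delta>)"
    have r: "r > 0" "\<delta> * r^2 = \<rho>" using True \<open>\<delta> > 0\<close> by (simp_all add: r_def)
    define \<eta> \<zeta> where "\<eta> t = - f / \<delta> - r * cos t"
      and "\<zeta> t = (sqrt \<rho> * sin t - M1 * (- f / \<delta> - r * cos t) - M4) / (2 * M3)" for t
    have \<zeta>\<eta>: "2 * M3 * \<zeta> t + M1 * \<eta> t + M4 = sqrt \<rho> * sin t" for t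
      using \<open>M3 \<noteq> 0\<close> by (simp add: \<zeta>_def \<eta>_def)
    define I where "I = {t. - pi < t \<and> t \<le> pi \<and> \<eta> t < 0}"
    show ?thesis
    proof (rule arc_tangencies[of \<zeta> "\<lambda>t. (sqrt \<rho> * cos t - M1 * (r * sin t)) / (2 * M3)"
            \<eta> "\<lambda>t. r * sin t" I K])
      show "(\<eta> has_real_derivative r * sin t) (at t)" for t
        unfolding \<eta>_def[abs_def] by (auto intro!: derivative_eq_intros)
      show "(\<zeta> has_real_derivative (sqrt \<rho> * cos t - M1 * (r * sin t)) / (2 * M3)) (at t)" for t
        unfolding \<zeta>_def[abs_def] using \<open>M3 \<noteq> 0\<close> by (auto intro!: derivative_eq_intros simp: field_simps)
      show "(sqrt \<rho> * cos t - M1 * (r * sin t)) / (2 * M3) \<noteq> 0 \<or> r * sin t \<noteq> 0" for t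
        using True r \<open>M3 \<noteq> 0\<close> sin_zero_abs_cos_one[of t] by auto
      show "conic (\<zeta> t) (\<eta> t) = 0" for t
      proof -
        have "(sqrt \<rho> * sin t)^2 + \<delta> * (- (r * cos t))^2 = \<rho> * (sin t)^2 + \<delta> * r^2 * (cos t)^2"
          using True by (simp add: power_mult_distrib)
        also have "\<dots> = \<rho> * ((sin t)^2 + (cos t)^2)" unfolding r(2) by (simp only: distrib_left)
        also have "\<dots> = \<rho>" by (simp only: sin_cos_squared_add mult_1_right)
        finally have e: "(sqrt \<rho> * sin t)^2 + \<delta> * (- (r * cos t))^2 = \<rho>" .
        have \<eta>f: "\<eta> t + f / \<delta> = - (r * cos t)" by (simp add: \<eta>_def)
        show ?thesis
          unfolding conic_iff \<zeta>\<eta> \<eta>f by (rule e)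
      qed
      show "s \<in> I" if "s1 \<in> I" "s2 \<in> I" "s1 \<le> s" "s \<le> s2" for s1 s s2
      proof -
        have b: "- pi < s1" "s2 \<le> pi" using that by (auto simp: I_def)
        have "cos s1 \<le> cos s \<or> cos s2 \<le> cos s"
        proof (cases "s \<ge> 0")
          case True
          then show ?thesis using b that by (intro disjI2 cos_monotone_0_pi_le) auto
        next
          case False
          then have "cos (- s1) \<le> cos (- s)" using b that by (intro cos_monotone_0_pi_le) auto
          then show ?thesis by simp
        qed
        then have "\<eta> s \<le> \<eta> s1 \<or> \<eta> s \<le> \<eta> s2" using r(1) by (simp add: \<eta>_def)
        then show ?thesis using that by (auto simp: I_def)
      qed
      show "inj_on (\<lambda>t. (\<zeta> t, \<eta> t)) I"
      proof (rule inj_onI)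
        fix s t assume st: "s \<in> I" "t \<in> I" "(\<zeta> s, \<eta> s) = (\<zeta> t, \<eta> t)"
        then have "sqrt \<rho> * sin s = sqrt \<rho> * sin t"
          unfolding \<zeta>\<eta>[symmetric] by simp
        then have "sin s = sin t" "cos s = cos t" using True r st by (auto simp: \<eta>_def)
        then have "cos (s - t) = 1" using sin_cos_squared_add3[of t] by (simp add: cos_diff)
        then obtain n :: int where n: "s - t = of_int n * 2 * pi" by (auto simp: cos_one_2pi_int)
        have "\<bar>s - t\<bar> < 2 * pi" using st by (auto simp: I_def)
        then have "\<bar>of_int n :: real\<bar> < 1" unfolding n by (simp add: abs_mult)
        then have "n = 0" by linarith
        then show "s = t" using n by simp
      qed
      show "left_match u0 u1 \<and> (\<exists>t\<in>I. \<zeta> t = 1 / u0 + 1 / u1 \<and> \<eta> t = 1 / (u0 * u1))"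
        if "(u0, u1) \<in> K" for u0 u1
      proof -
        define z e where "z = 1 / u0 + 1 / u1" and "e = 1 / (u0 * u1)"
        have "u0 > 0" "u1 < 0" using K[OF that] by (auto simp: left_match_def)
        then have "e < 0" by (simp add: e_def divide_neg_pos mult_pos_neg)
        define S C where "S = (2 * M3 * z + M1 * e + M4) / sqrt \<rho>" and "C = - (e + f / \<delta>) / r"
        have S: "sqrt \<rho> * S = 2 * M3 * z + M1 * e + M4" and C: "r * C = - (e + f / \<delta>)"
          using True r by (auto simp: S_def C_def)
        have "\<rho> * S^2 + \<rho> * C^2 = (sqrt \<rho> * S)^2 + \<delta> * (r * C)^2"
          using True by (simp add: power_mult_distrib r(2)[symmetric])
        also have "\<dots> = \<rho>"
          unfolding S C power2_minus
          by (rule conic_iff[THEN iffD1]) (use K[OF that] in \<open>simp add: z_def e_def\<close>)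
        finally have "\<rho> * (S^2 + C^2) = \<rho> * 1" by (simp add: algebra_simps)
        then have "C^2 + S^2 = 1" using True by simp
        then obtain t' where t': "C = cos t'" "S = sin t'"
          using sincos_total_2pi by blast
        obtain t where t: "- pi < t" "t \<le> pi" "sin t = S" "cos t = C"
          using sincos_principal_value[of t'] t' by auto
        have \<eta>t: "\<eta> t = e" using C by (simp add: \<eta>_def t)
        have "2 * M3 * \<zeta> t = 2 * M3 * z" using \<zeta>\<eta>[of t] S unfolding \<eta>t t by linarith
        then have "\<zeta> t = z" using \<open>M3 \<noteq> 0\<close> by simp
        then show ?thesis using \<eta>t t K[OF that] \<open>e < 0\<close>
          by (auto simp: I_def z_def e_def intro!: bexI[of _ t])
      qed
    qed (use \<open>finite K\<close> in \<open>auto simp: I_def\<close>)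
  qed
qed

text \<open>If \<open>a\<^sub>L = 0\<close> or \<open>b = 0\<close> the equation of the conic is of degree at most one. If \<open>a\<^sub>R = 0\<close> it is a pair of parallel lines,
one of which is \<open>(y\<^sub>0 - b) (y\<^sub>1 - b) = 0\<close> and contains no crossing levels. Otherwise
\<open>4 m\<^sub>0 m\<^sub>3 - m\<^sub>1\<^sup>2 = (a\<^sub>L\<^sup>2 b a\<^sub>R)\<^sup>2 (4 D\<^sub>R - T\<^sub>R\<^sup>2)\<close> is positive, so its
quadratic part is definite; the assumption that the right system is a focus enters here.\<close>

lemma tangencies:
  assumes "finite K"
    and nz: "F_tilde a_L a_R T_L D_L T_R D_R b \<noteq> 0"
    and K: "\<And>u0 u1. (u0, u1) \<in> K \<Longrightarrow> left_match u0 u1 \<and> F_fun a_L a_R T_L D_L T_R D_R b u0 u1 = 0"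
  shows "\<exists>S \<subseteq> common_zeros. finite S \<and> card K \<le> card S + 1"
proof -
  have sg: "u0 > 0" "u0 > b" "u1 < 0" "u1 < b" if "(u0, u1) \<in> K" for u0 u1
    using K[OF that] by (auto simp: left_match_def)
  have con: "conic (1 / u0 + 1 / u1) (1 / (u0 * u1)) = 0" if "(u0, u1) \<in> K" for u0 u1
    using K[OF that] sg[OF that] F_fun_eq_conic[of u0 u1] by simp
  have "D_R > 0" by (rule focus_det_pos[OF focusR])
  consider (line) "a_L = 0 \<or> b = 0" | (corner) "a_L \<noteq> 0" "b \<noteq> 0" "a_R = 0"
    | (ellipse) "a_L \<noteq> 0" "b \<noteq> 0" "a_R \<noteq> 0" by blast
  then show ?thesis
  proof cases
    case line
    then have m: "m0 a_L a_R T_L D_L T_R D_R b = 0" "m1 a_L a_R T_L D_L T_R D_R b = 0"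
      "m3 a_L a_R T_L D_L T_R D_R b = 0"
      by (auto simp: m0_def m1_def m3_def)
    show ?thesis
    proof (cases "m4 a_L a_R T_L D_L T_R D_R b = 0 \<and> m2 a_L a_R T_L D_L T_R D_R b = 0")
      case True
      then have "m5 a_L a_R T_L D_L T_R D_R b \<noteq> 0"
        using nz m by (simp add: F_tilde_eq)
      then have "K = {}" using con True m by (auto simp: conic_def)
      then show ?thesis by (intro exI[of _ "{}"]) auto
    next
      case False
      show ?thesis
      proof (rule line_tangencies[OF \<open>finite K\<close>,
            where \<alpha> = "m5 a_L a_R T_L D_L T_R D_R b" and \<beta> = "m4 a_L a_R T_L D_L T_R D_R b"
              and \<gamma> = "m2 a_L a_R T_L D_L T_R D_R b"])
      qed (use False m con K in \<open>auto simp: conic_def add_ac\<close>)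
    qed
  next
    case corner
    define \<beta> \<gamma> \<alpha> where "\<beta> = - (a_L^2 * D_R)" and "\<gamma> = a_L^2 * b * D_R"
      and "\<alpha> = m5 a_L a_R T_L D_L T_R D_R b"
    have factor: "conic \<zeta> \<eta> = (1 - b * \<zeta> + b^2 * \<eta>) * (\<alpha> + \<beta> * \<zeta> + \<gamma> * \<eta>)" for \<zeta> \<eta>
      unfolding conic_def m0_def m1_def m2_def m3_def m4_def m5_def \<alpha>_def \<beta>_def \<gamma>_def
      unfolding corner(3)
      by (simp add: algebra_simps power2_eq_square power3_eq_cube)
    show ?thesis
    proof (rule line_tangencies[OF \<open>finite K\<close>, of \<beta> \<gamma> \<alpha>])
      show "\<beta> \<noteq> 0 \<or> \<gamma> \<noteq> 0" using corner \<open>D_R > 0\<close> by (simp add: \<beta>_def)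
      show "conic \<zeta> \<eta> = 0" if "\<alpha> + \<beta> * \<zeta> + \<gamma> * \<eta> = 0" for \<zeta> \<eta>
        unfolding factor that by simp
      show "left_match u0 u1 \<and> \<alpha> + \<beta> * (1 / u0 + 1 / u1) + \<gamma> * (1 / (u0 * u1)) = 0"
        if "(u0, u1) \<in> K" for u0 u1
      proof -
        have "1 - b * (1 / u0 + 1 / u1) + b^2 * (1 / (u0 * u1)) = (u0 - b) * (u1 - b) / (u0 * u1)"
          using sg[OF that] by (simp add: field_simps power2_eq_square)
        then have "1 - b * (1 / u0 + 1 / u1) + b^2 * (1 / (u0 * u1)) \<noteq> 0"
          using sg[OF that] by simp
        then show ?thesis using K[OF that] con[OF that] unfolding factor by simp
      qed
    qed
  next
    case ellipse
    show ?thesis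
    proof (rule ellipse_tangencies[OF \<open>finite K\<close>])
      show "m3 a_L a_R T_L D_L T_R D_R b \<noteq> 0"
        using ellipse \<open>D_R > 0\<close> by (simp add: m3_def)
      have "4 * m0 a_L a_R T_L D_L T_R D_R b * m3 a_L a_R T_L D_L T_R D_R b
          - (m1 a_L a_R T_L D_L T_R D_R b)^2 = (a_L^2 * b * a_R)^2 * (4 * D_R - T_R^2)"
        unfolding m0_def m1_def m3_def by (simp add: algebra_simps power2_eq_square power3_eq_cube)
      also have "\<dots> > 0"
        using ellipse focusR by (intro mult_pos_pos) auto
      finally show "4 * m0 a_L a_R T_L D_L T_R D_R b * m3 a_L a_R T_L D_L T_R D_R b
          - (m1 a_L a_R T_L D_L T_R D_R b)^2 > 0" .
    qed (use K con in auto)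
  qed
qed

text \<open>Each of the two applications of Rolle's theorem loses one point.\<close>

lemma card_double_matches_le:
  assumes nz: "F_tilde a_L a_R T_L D_L T_R D_R b \<noteq> 0"
    and "finite E" and E: "\<And>y0. y0 \<in> E \<Longrightarrow> \<exists>y1. left_match y0 y1 \<and> right_match y0 y1"
  shows "\<exists>S \<subseteq> common_zeros. finite S \<and> card E \<le> card S + 2"
proof -
  obtain U where U: "finite U" "card E \<le> card U + 1"
    "\<And>u0. u0 \<in> U \<Longrightarrow> \<exists>u1. left_match u0 u1 \<and> F_fun a_L a_R T_L D_L T_R D_R b u0 u1 = 0"
  proof (rule interlaced_witnesses[OF \<open>finite E\<close>,
        of "\<lambda>u0. \<exists>u1. left_match u0 u1 \<and> F_fun a_L a_R T_L D_L T_R D_R b u0 u1 = 0"])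
    fix y z assume "y \<in> E" "z \<in> E" "y < z"
    then show "\<exists>u0>y. u0 < z \<and> (\<exists>u1. left_match u0 u1 \<and> F_fun a_L a_R T_L D_L T_R D_R b u0 u1 = 0)"
      using E F_zero_between_double_matches by meson
  qed blast
  then obtain g where g: "\<And>u0. u0 \<in> U \<Longrightarrow> left_match u0 (g u0) \<and> F_fun a_L a_R T_L D_L T_R D_R b u0 (g u0) = 0"
    by metis
  define K where "K = (\<lambda>u0. (u0, g u0)) ` U"
  have "card K = card U" unfolding K_def by (intro card_image inj_onI) auto
  moreover obtain S where "S \<subseteq> common_zeros" "finite S" "card K \<le> card S + 1"
    using tangencies[OF _ nz, of K] U(1) g by (auto simp: K_def)
  ultimately show ?thesis
    using U(2) by (intro exI[of _ S]) auto
qed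

end

section \<open>Excursions around a focus\<close>

text \<open>In the coordinates \<open>m + i n\<close> the system is \<open>z' = (\<alpha> + i \<beta>) z\<close>; the two constants of motion are the
real and imaginary part of \<open>exp (- (\<alpha> + i \<beta>) (r - s)) z\<close>.\<close>

lemma rotating_solution:
  fixes m n :: "real \<Rightarrow> real"
  assumes m: "\<And>r. r \<in> {s..t} \<Longrightarrow> (m has_real_derivative \<alpha> * m r - \<beta> * n r) (at r within {s..t})"
    and n: "\<And>r. r \<in> {s..t} \<Longrightarrow> (n has_real_derivative \<beta> * m r + \<alpha> * n r) (at r within {s..t})"
    and r: "r \<in> {s..t}"
  shows "m r = exp (\<alpha> * (r - s)) * (m s * cos (\<beta> * (r - s)) - n s * sin (\<beta> * (r - s)))"
    and "n r = exp (\<alpha> * (r - s)) * (m s * sin (\<beta> * (r - s)) + n s * cos (\<beta> * (r - s)))"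
proof -
  define e c d where "e r = exp (- \<alpha> * (r - s))" and "c r = cos (\<beta> * (r - s))"
    and "d r = sin (\<beta> * (r - s))" for r
  have de: "(e has_real_derivative - \<alpha> * e r) (at r within {s..t})" for r
    unfolding e_def[abs_def] by (auto intro!: derivative_eq_intros)
  have dc: "(c has_real_derivative - \<beta> * d r) (at r within {s..t})" for r
    unfolding c_def[abs_def] d_def by (auto intro!: derivative_eq_intros)
  have dd: "(d has_real_derivative \<beta> * c r) (at r within {s..t})" for r
    unfolding d_def[abs_def] c_def by (auto intro!: derivative_eq_intros)
  have dk: "((\<lambda>r. e r * (m r * c r + n r * d r)) has_real_derivative 0) (at r within {s..t})"
    if "r \<in> {s..t}" for r
    using m[OF that] n[OF that] de[of r] dc[of r] dd[of r]
    by (auto intro!: derivative_eq_intros simp: algebra_simps)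
  have "\<exists>k. \<forall>r\<in>{s..t}. e r * (m r * c r + n r * d r) = k"
    by (rule has_field_derivative_zero_constant) (use dk in auto)
  then obtain k where k: "\<And>r. r \<in> {s..t} \<Longrightarrow> e r * (m r * c r + n r * d r) = k" by blast
  have dl: "((\<lambda>r. e r * (n r * c r - m r * d r)) has_real_derivative 0) (at r within {s..t})"
    if "r \<in> {s..t}" for r
    using m[OF that] n[OF that] de[of r] dc[of r] dd[of r]
    by (auto intro!: derivative_eq_intros simp: algebra_simps)
  have "\<exists>l. \<forall>r\<in>{s..t}. e r * (n r * c r - m r * d r) = l"
    by (rule has_field_derivative_zero_constant) (use dl in auto)
  then obtain l where l: "\<And>r. r \<in> {s..t} \<Longrightarrow> e r * (n r * c r - m r * d r) = l" by blast
  have "s \<in> {s..t}" using r by auto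
  then have kl: "k = m s" "l = n s"
    using k[of s] l[of s] by (simp_all add: e_def c_def d_def)
  have E: "exp (\<alpha> * (r - s)) * e r = 1"
    by (simp add: e_def flip: exp_add)
  have cd: "c r * c r + d r * d r = 1"
    by (simp add: c_def d_def flip: power2_eq_square)
  have "exp (\<alpha> * (r - s)) * (k * c r - l * d r)
      = (exp (\<alpha> * (r - s)) * e r) * (m r * (c r * c r + d r * d r))"
    unfolding k[OF r, symmetric] l[OF r, symmetric] by (simp add: algebra_simps)
  then show "m r = exp (\<alpha> * (r - s)) * (m s * cos (\<beta> * (r - s)) - n s * sin (\<beta> * (r - s)))"
    unfolding E cd kl by (simp add: c_def d_def)
  have "exp (\<alpha> * (r - s)) * (k * d r + l * c r)
      = (exp (\<alpha> * (r - s)) * e r) * (n r * (c r * c r + d r * d r))"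
    unfolding k[OF r, symmetric] l[OF r, symmetric] by (simp add: algebra_simps)
  then show "n r = exp (\<alpha> * (r - s)) * (m s * sin (\<beta> * (r - s)) + n s * cos (\<beta> * (r - s)))"
    unfolding E cd kl by (simp add: c_def d_def)
qed

text \<open>\<open>T / \<beta>\<close> times \<open>0\<close>, \<open>\<pi>\<close> or \<open>2 \<pi>\<close> for \<open>a > 0\<close>, \<open>a = 0\<close>, \<open>a < 0\<close>. This is the part of the angle swept during
an excursion that the principal value of \<open>arctan\<close> does not see; it depends on whether the focus is
virtual, on the switching line, or inside the half plane of the excursion.\<close>

definition pass_const :: "real \<Rightarrow> real \<Rightarrow> real \<Rightarrow> real" where
  "pass_const a T D = 2 * pi * T * (1 - sgn a) / sqrt (4 * D - T^2)"

text \<open>The first coordinate of an affine planar system with trace \<open>T\<close> and determinant \<open>D\<close> satisfies the scalar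
equation \<open>x'' - T x' + D x = a\<close>.\<close>

locale focus_motion =
  fixes a T D :: real and x v :: "real \<Rightarrow> real" and s t :: real
  assumes focus: "T^2 - 4 * D < 0"
    and dx: "\<And>r. r \<in> {s..t} \<Longrightarrow> (x has_real_derivative v r) (at r within {s..t})"
    and dv: "\<And>r. r \<in> {s..t} \<Longrightarrow> (v has_real_derivative T * v r - D * x r + a) (at r within {s..t})"
begin

text \<open>With \<open>u = x - a / D\<close>, the combination \<open>m + i n = (x' - \<alpha> u) + i \<beta> u\<close> is multiplied by \<open>\<alpha> + i \<beta>\<close>
under differentiation. On the switching line \<open>n\<close> is a constant and \<open>m\<close> determines the level.\<close>

definition \<alpha> :: real where "\<alpha> = T / 2"
definition \<beta> :: real where "\<beta> = sqrt (4 * D - T^2) / 2"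
definition m :: "real \<Rightarrow> real" where "m r = v r - \<alpha> * (x r - a / D)"
definition n :: "real \<Rightarrow> real" where "n r = \<beta> * (x r - a / D)"

lemma D_pos: "D > 0" using focus_det_pos[OF focus] .

lemma \<beta>_pos: "\<beta> > 0" using focus by (simp add: \<beta>_def)

lemma \<alpha>\<beta>: "\<alpha>^2 + \<beta>^2 = D"
  using focus by (simp add: \<alpha>_def \<beta>_def power_divide field_simps)

lemma motion:
  assumes "r \<in> {s..t}"
  shows "m r = exp (\<alpha> * (r - s)) * (m s * cos (\<beta> * (r - s)) - n s * sin (\<beta> * (r - s)))"
    and "n r = exp (\<alpha> * (r - s)) * (m s * sin (\<beta> * (r - s)) + n s * cos (\<beta> * (r - s)))"
proof -
  have dm: "(m has_real_derivative \<alpha> * m r - \<beta> * n r) (at r within {s..t})" if "r \<in> {s..t}" for r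
  proof -
    have "(m has_real_derivative T * v r - D * x r + a - \<alpha> * v r) (at r within {s..t})"
      unfolding m_def[abs_def] using dx[OF that] dv[OF that] by (auto intro!: derivative_eq_intros)
    moreover have "T * v r - D * x r + a - \<alpha> * v r = \<alpha> * m r - \<beta> * n r"
    proof -
      have "\<alpha> * m r - \<beta> * n r = \<alpha> * v r - (\<alpha>^2 + \<beta>^2) * (x r - a / D)"
        by (simp add: m_def n_def algebra_simps power2_eq_square)
      then show ?thesis unfolding \<alpha>\<beta> using D_pos by (simp add: \<alpha>_def algebra_simps)
    qed
    ultimately show ?thesis by simp
  qed
  have dn: "(n has_real_derivative \<beta> * m r + \<alpha> * n r) (at r within {s..t})" if "r \<in> {s..t}" for r
  proof -
    have "(n has_real_derivative \<beta> * v r) (at r within {s..t})"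
      unfolding n_def[abs_def] using dx[OF that] by (auto intro!: derivative_eq_intros)
    then show ?thesis by (simp add: m_def n_def algebra_simps)
  qed
  show "m r = exp (\<alpha> * (r - s)) * (m s * cos (\<beta> * (r - s)) - n s * sin (\<beta> * (r - s)))"
    and "n r = exp (\<alpha> * (r - s)) * (m s * sin (\<beta> * (r - s)) + n s * cos (\<beta> * (r - s)))"
    using rotating_solution[OF dm dn assms] by blast+
qed

lemma half_turn:
  assumes "r \<in> {s..t}" "r + pi / \<beta> \<in> {s..t}"
  shows "n (r + pi / \<beta>) = - exp (\<alpha> * (pi / \<beta>)) * n r"
    and "m (r + pi / \<beta>) = - exp (\<alpha> * (pi / \<beta>)) * m r"
proof -
  have 1: "\<beta> * (r + pi / \<beta> - s) = \<beta> * (r - s) + pi"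
    using \<beta>_pos by (simp add: field_simps)
  have 2: "exp (\<alpha> * (r + pi / \<beta> - s)) = exp (\<alpha> * (pi / \<beta>)) * exp (\<alpha> * (r - s))"
    by (simp add: algebra_simps flip: exp_add)
  show "n (r + pi / \<beta>) = - exp (\<alpha> * (pi / \<beta>)) * n r"
    unfolding motion(2)[OF assms(2)] motion(2)[OF assms(1)] 1 2 sin_periodic_pi cos_periodic_pi
    by (simp only: mult_minus_right mult_minus_left minus_add_distrib[symmetric] mult.assoc)
  show "m (r + pi / \<beta>) = - exp (\<alpha> * (pi / \<beta>)) * m r"
    unfolding motion(1)[OF assms(2)] motion(1)[OF assms(1)] 1 2 sin_periodic_pi cos_periodic_pi
    by (simp only: mult_minus_right mult_minus_left minus_diff_minus mult.assoc)
qed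

lemma full_turn:
  assumes "r \<in> {s..t}" "r + 2 * pi / \<beta> \<in> {s..t}"
  shows "n (r + 2 * pi / \<beta>) = exp (2 * \<alpha> * (pi / \<beta>)) * n r"
    and "m (r + 2 * pi / \<beta>) = exp (2 * \<alpha> * (pi / \<beta>)) * m r"
proof -
  have p: "2 * pi / \<beta> = pi / \<beta> + pi / \<beta>" "pi / \<beta> > 0" using \<beta>_pos by auto
  then have h: "r + pi / \<beta> \<in> {s..t}" "r + pi / \<beta> + pi / \<beta> = r + 2 * pi / \<beta>"
    using assms by auto
  have h2: "r + pi / \<beta> + pi / \<beta> \<in> {s..t}" using assms h(2) by simp
  show "n (r + 2 * pi / \<beta>) = exp (2 * \<alpha> * (pi / \<beta>)) * n r"
    using half_turn(1)[OF h(1) h2] half_turn(1)[OF assms(1) h(1)] unfolding h(2)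
    by (simp flip: exp_add)
  show "m (r + 2 * pi / \<beta>) = exp (2 * \<alpha> * (pi / \<beta>)) * m r"
    using half_turn(2)[OF h(1) h2] half_turn(2)[OF assms(1) h(1)] unfolding h(2)
    by (simp flip: exp_add)
qed

lemma m_n_on_section:
  assumes "x r = 0" "v r = - y"
  shows "n r = - \<beta> * (a / D)" and "m r = - (y - \<alpha> * (a / D))"
    and "D * ((m r)^2 + (n r)^2) = W_L a T D y"
proof -
  show n: "n r = - \<beta> * (a / D)" and m: "m r = - (y - \<alpha> * (a / D))"
    using assms by (simp_all add: n_def m_def)
  have "(m r)^2 + (n r)^2 = y^2 - 2 * \<alpha> * (a / D) * y + (\<alpha>^2 + \<beta>^2) * (a / D)^2"
    unfolding n m by (simp add: algebra_simps power2_eq_square)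
  then show "D * ((m r)^2 + (n r)^2) = W_L a T D y"
    unfolding \<alpha>\<beta> using D_pos by (simp add: W_L_def \<alpha>_def field_simps power2_eq_square)
qed

end

text \<open>An excursion into \<open>x < 0\<close>.\<close>

locale focus_pass = focus_motion +
  fixes y0 y1 :: real
  assumes s_less_t: "s < t"
    and ends: "x s = 0" "x t = 0" "v s = - y0" "v t = - y1"
    and signs: "y0 > 0" "y1 < 0"
    and inside: "\<And>r. s < r \<Longrightarrow> r < t \<Longrightarrow> x r < 0"
begin

lemma n_ends: "n s = - \<beta> * (a / D)" "n t = - \<beta> * (a / D)"
  using m_n_on_section ends by blast+

lemma n_inside:
  assumes "s < r" "r < t" shows "n r < - \<beta> * (a / D)"
  using mult_pos_neg[OF \<beta>_pos inside[OF assms]] by (simp add: n_def algebra_simps)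

lemma n_le:
  assumes "s \<le> r" "r \<le> t" shows "n r \<le> - \<beta> * (a / D)"
  using n_inside[of r] n_ends assms by (cases "r = s \<or> r = t") (auto simp: less_le)

text \<open>Half a turn reverses the sign of \<open>n\<close>, whereas \<open>n\<close> stays negative if the focus lies beyond the
switching line.\<close>

lemma turn_virtual:
  assumes "a > 0" shows "\<beta> * (t - s) < pi"
proof (rule ccontr)
  assume "\<not> ?thesis"
  then have h: "s + pi / \<beta> \<le> t" using \<beta>_pos by (simp add: field_simps)
  have neg: "- \<beta> * (a / D) < 0" using assms D_pos \<beta>_pos by simp
  have "n (s + pi / \<beta>) = - exp (\<alpha> * (pi / \<beta>)) * n s"
    using h s_less_t \<beta>_pos by (intro half_turn) auto
  moreover have "- exp (\<alpha> * (pi / \<beta>)) * (- \<beta> * (a / D)) > 0"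
    using neg by (intro mult_neg_neg) simp_all
  ultimately have "n (s + pi / \<beta>) > 0" unfolding n_ends by simp
  moreover have "n (s + pi / \<beta>) < 0"
    using n_le[of "s + pi / \<beta>"] neg h \<beta>_pos by (auto simp: order_le_less_trans)
  ultimately show False by simp
qed

lemma turn_boundary:
  assumes "a = 0" shows "\<beta> * (t - s) = pi"
proof -
  have n0: "n s = 0" "n t = 0" using n_ends assms by auto
  have m: "m s \<noteq> 0" using m_n_on_section(2)[OF ends(1,3)] assms signs by simp
  have le: "\<beta> * (t - s) \<le> pi"
  proof (rule ccontr)
    assume "\<not> ?thesis"
    then have h: "s + pi / \<beta> < t" using \<beta>_pos by (simp add: field_simps)
    have "n (s + pi / \<beta>) = - exp (\<alpha> * (pi / \<beta>)) * n s"
      using h s_less_t \<beta>_pos by (intro half_turn) auto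
    then show False using n_inside[of "s + pi / \<beta>"] h \<beta>_pos n0 assms by simp
  qed
  have "sin (\<beta> * (t - s)) = 0"
    using motion(2)[of t] s_less_t n0 m by simp
  then show ?thesis
    using le s_less_t \<beta>_pos sin_gt_zero[of "\<beta> * (t - s)"] by fastforce
qed

text \<open>A full turn multiplies \<open>n\<close> by \<open>q = exp (2 \<pi> \<alpha> / \<beta>)\<close>. On an excursion \<open>n\<close> is at most its value at both ends.
Going a full turn forward from the start gives \<open>q \<le> 1\<close>, going one back from the end gives \<open>q \<ge> 1\<close>; for
\<open>q = 1\<close> the motion is periodic and would return to the line with its initial velocity.\<close>

lemma turn_real:
  assumes "a < 0" shows "\<beta> * (t - s) < 2 * pi"
proof (rule ccontr)
  assume "\<not> ?thesis"
  then have h: "s + 2 * pi / \<beta> \<le> t" using \<beta>_pos by (simp add: field_simps)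
  have p: "2 * pi / \<beta> > 0" using \<beta>_pos by simp
  define d q where "d = - \<beta> * (a / D)" and "q = exp (2 * \<alpha> * (pi / \<beta>))"
  have "d > 0" using assms D_pos \<beta>_pos by (simp add: d_def divide_neg_pos mult_pos_neg)
  have "q > 0" by (simp add: q_def)
  have st: "s \<in> {s..t}" "s + 2 * pi / \<beta> \<in> {s..t}" using h s_less_t p by auto
  have nq: "n (s + 2 * pi / \<beta>) = q * d"
    using full_turn(1)[OF st] unfolding n_ends d_def[symmetric] q_def[symmetric] .
  then have "q * d \<le> d" using n_le[of "s + 2 * pi / \<beta>", folded d_def] h p by simp
  then have "q \<le> 1" using \<open>d > 0\<close> by simp
  have "t - 2 * pi / \<beta> \<in> {s..t}" "t - 2 * pi / \<beta> + 2 * pi / \<beta> \<in> {s..t}" using h s_less_t p by auto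
  from full_turn(1)[OF this] have "d = q * n (t - 2 * pi / \<beta>)"
    using n_ends by (simp add: d_def q_def)
  also have "\<dots> \<le> q * d"
    using n_le[of "t - 2 * pi / \<beta>"] h p \<open>q > 0\<close> by (intro mult_left_mono) (auto simp: d_def)
  finally have "q \<ge> 1" using \<open>d > 0\<close> by simp
  then have "q = 1" using \<open>q \<le> 1\<close> by simp
  then have "t = s + 2 * pi / \<beta>"
    using nq n_inside[of "s + 2 * pi / \<beta>"] h p by (fastforce simp: d_def)
  then have "m t = m s" using full_turn(2)[OF st] \<open>q = 1\<close> by (simp add: q_def)
  then show False
    using m_n_on_section(2)[OF ends(1,3)] m_n_on_section(2)[OF ends(2,4)] signs by simp
qed

lemma W_L_growth: "ln (W_L a T D y1) = ln (W_L a T D y0) + T * (t - s)"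
proof -
  define E \<theta> where "E = exp (\<alpha> * (t - s))" and "\<theta> = \<beta> * (t - s)"
  have "t \<in> {s..t}" using s_less_t by simp
  from motion[OF this] have mt: "m t = E * (m s * cos \<theta> - n s * sin \<theta>)"
    and nt: "n t = E * (m s * sin \<theta> + n s * cos \<theta>)"
    by (simp_all add: E_def \<theta>_def)
  have "(m t)^2 + (n t)^2 = E^2 * (((m s)^2 + (n s)^2) * ((sin \<theta>)^2 + (cos \<theta>)^2))"
    unfolding mt nt by (simp only: power2_eq_square) (simp only: algebra_simps)
  then have "D * ((m t)^2 + (n t)^2) = E^2 * (D * ((m s)^2 + (n s)^2))"
    by simp
  then have "W_L a T D y1 = E^2 * W_L a T D y0"
    unfolding m_n_on_section(3)[OF ends(1,3)] m_n_on_section(3)[OF ends(2,4)] .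
  moreover have "E^2 = exp (T * (t - s))"
    by (simp add: E_def \<alpha>_def power2_eq_square flip: exp_add)
  moreover have "W_L a T D y0 > 0" using W_L_pos[OF focus] signs by simp
  ultimately show ?thesis by (simp add: ln_mult)
qed

text \<open>The angles at the ends are known modulo \<open>2 \<pi>\<close>; the bounds on the total turn single out the multiple.
For a real focus the order \<open>y\<^sub>1 < y\<^sub>0\<close> excludes the value without an additional turn.\<close>

lemma angle_swept:
  assumes "a \<noteq> 0"
  defines "A y \<equiv> arctan ((2 * D * y - a * T) / (sqrt (4 * D - T^2) * a))"
  shows "\<beta> * (t - s) = A y0 - A y1 + pi * (1 - sgn a)"
proof -
  define E \<theta> where "E = exp (\<alpha> * (t - s))" and "\<theta> = \<beta> * (t - s)"
  \<comment> \<open>the common value of \<open>n\<close> at both ends\<close>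
  define c where "c = - \<beta> * (a / D)"
  have c: "c \<noteq> 0" using assms(1) D_pos \<beta>_pos by (simp add: c_def)
  have "E > 0" by (simp add: E_def)
  have \<theta>: "\<theta> > 0" using s_less_t \<beta>_pos by (simp add: \<theta>_def)
  have "t \<in> {s..t}" using s_less_t by simp
  note mt = motion(1)[OF this, unfolded n_ends, folded c_def E_def \<theta>_def]
    and nt = motion(2)[OF this, unfolded n_ends, folded c_def E_def \<theta>_def]
  have A: "A y = arctan (- (y - \<alpha> * (a / D)) / c)" for y
  proof -
    have "(2 * D * y - a * T) / (sqrt (4 * D - T^2) * a) = - (y - \<alpha> * (a / D)) / c"
      using assms(1) D_pos \<beta>_pos unfolding c_def \<alpha>_def \<beta>_def by (simp add: field_simps)
    then show ?thesis by (simp add: A_def)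
  qed
  have A0: "A y0 = arctan (m s / c)" and A1: "A y1 = arctan (m t / c)"
    unfolding A m_n_on_section(2)[OF ends(1,3)] m_n_on_section(2)[OF ends(2,4)] by simp_all
  define \<phi> where "\<phi> = A y0"
  have \<phi>: "- pi / 2 < \<phi>" "\<phi> < pi / 2" using arctan_lbound arctan_ubound by (auto simp: \<phi>_def A0)
  then have "cos \<phi> > 0" by (intro cos_gt_zero_pi) auto
  have "tan \<phi> = m s / c" by (simp add: \<phi>_def A0 tan_arctan)
  then have ms: "m s * cos \<phi> = c * sin \<phi>"
    using \<open>cos \<phi> > 0\<close> c by (simp add: tan_def field_simps)
  have "c * cos \<phi> = E * (m s * cos \<phi> * sin \<theta> + c * cos \<phi> * cos \<theta>)"
    by (subst nt) (simp add: algebra_simps)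
  also have "\<dots> = c * (E * cos (\<phi> - \<theta>))"
    unfolding ms by (simp add: cos_diff algebra_simps)
  finally have cos: "cos \<phi> = E * cos (\<phi> - \<theta>)" using c by simp
  then have cpos: "cos (\<phi> - \<theta>) > 0" using \<open>cos \<phi> > 0\<close> \<open>E > 0\<close> by (simp add: zero_less_mult_iff)
  have "m t * cos \<phi> = E * (m s * cos \<phi> * cos \<theta> - c * cos \<phi> * sin \<theta>)"
    unfolding mt by (simp add: algebra_simps)
  also have "\<dots> = c * (E * sin (\<phi> - \<theta>))"
    unfolding ms by (simp add: sin_diff algebra_simps)
  finally have "m t / c = E * sin (\<phi> - \<theta>) / cos \<phi>"
    using c \<open>cos \<phi> > 0\<close> by (simp add: field_simps)
  also have "\<dots> = tan (\<phi> - \<theta>)"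
    unfolding cos using \<open>E > 0\<close> by (simp add: tan_def)
  finally have tan: "m t / c = tan (\<phi> - \<theta>)" .
  show ?thesis
  proof (cases "a > 0")
    case True
    have "\<theta> < pi" using turn_virtual[OF True] by (simp add: \<theta>_def)
    have "- pi / 2 < \<phi> - \<theta>"
    proof (rule ccontr)
      assume "\<not> ?thesis"
      then have "cos (\<phi> - \<theta> + pi) \<ge> 0" using \<phi> \<open>\<theta> < pi\<close> by (intro cos_ge_zero) auto
      then show False using cpos by simp
    qed
    then have "A y1 = \<phi> - \<theta>" unfolding A1 tan using \<phi> \<theta> by (intro arctan_tan) auto
    then show ?thesis using True by (simp add: \<phi>_def \<theta>_def)
  next
    case False
    then have "a < 0" using assms(1) by simp
    then have "c > 0" using D_pos \<beta>_pos by (simp add: c_def divide_neg_pos mult_pos_neg)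
    have \<theta>2: "\<theta> < 2 * pi" using turn_real[OF \<open>a < 0\<close>] by (simp add: \<theta>_def)
    have "m s < m t"
      unfolding m_n_on_section(2)[OF ends(1,3)] m_n_on_section(2)[OF ends(2,4)] using signs by simp
    then have "A y0 < A y1"
      unfolding A0 A1 using \<open>c > 0\<close> by (simp add: arctan_less_iff divide_strict_right_mono)
    have "\<phi> - \<theta> < - pi / 2"
    proof (rule ccontr)
      assume not: "\<not> ?thesis"
      then have "\<phi> - \<theta> \<noteq> - pi / 2" using cpos by (auto simp: cos_minus)
      then have "A y1 = \<phi> - \<theta>" unfolding A1 tan using \<phi> \<theta> not by (intro arctan_tan) auto
      then show False using \<open>A y0 < A y1\<close> \<theta> by (simp add: \<phi>_def)
    qed
    moreover have "\<phi> - \<theta> + 2 * pi < pi / 2"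
    proof (rule ccontr)
      assume "\<not> ?thesis"
      then have "cos (\<phi> - \<theta> + pi) \<ge> 0" using calculation by (intro cos_ge_zero) auto
      then show False using cpos by simp
    qed
    ultimately have "arctan (tan (\<phi> - \<theta> + 2 * pi)) = \<phi> - \<theta> + 2 * pi"
      using \<phi> \<theta>2 by (intro arctan_tan) auto
    moreover have "tan (\<phi> - \<theta> + 2 * pi) = tan (\<phi> - \<theta>)" by (rule tan_periodic)
    ultimately have "A y1 = \<phi> - \<theta> + 2 * pi" unfolding A1 tan by simp
    then show ?thesis using \<open>a < 0\<close> by (simp add: \<phi>_def \<theta>_def)
  qed
qed

text \<open>The growth of the modulus gives the duration \<open>T (t - s)\<close>, the angle gives \<open>\<beta> (t - s)\<close>; eliminating the
duration leaves a relation between the levels.\<close>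

lemma pass_relation: "pass_integral a T D y1 - pass_integral a T D y0 = pass_const a T D"
proof -
  have s: "sqrt (4 * D - T^2) = 2 * \<beta>" by (simp add: \<beta>_def)
  show ?thesis
  proof (cases "a = 0")
    case True
    have ts: "t - s = pi / \<beta>" using turn_boundary[OF True] \<beta>_pos by (simp add: field_simps)
    show ?thesis
      using W_L_growth[unfolded ts] True unfolding pass_integral_def pass_const_def s by simp
  next
    case False
    define A where "A y = arctan ((2 * D * y - a * T) / (sqrt (4 * D - T^2) * a))" for y
    have "\<beta> * (t - s) = A y0 - A y1 + pi * (1 - sgn a)"
      using angle_swept[OF False] by (simp add: A_def)
    from arg_cong[OF this, of "\<lambda>z. T / \<beta> * z"]
    have "T * (t - s) = T / \<beta> * (A y0 - A y1 + pi * (1 - sgn a))"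
      using \<beta>_pos by simp
    then have "T * (t - s) = T / \<beta> * A y0 - T / \<beta> * A y1 + T / \<beta> * (pi * (1 - sgn a))"
      by (simp only: distrib_left right_diff_distrib)
    moreover have PI: "pass_integral a T D y = ln (W_L a T D y) + T / \<beta> * A y" for y
      using \<beta>_pos by (simp add: pass_integral_def A_def s)
    moreover have PC: "pass_const a T D = T / \<beta> * (pi * (1 - sgn a))"
      using \<beta>_pos by (simp add: pass_const_def s)
    ultimately show ?thesis
      using W_L_growth unfolding PI PC by linarith
  qed
qed

end

section \<open>Crossing periodic orbits of the piecewise linear system\<close>

no_notation fps_nth (infixl "$" 75)

lemma affine_field_nth:
  "affine_field A b x $ 1 = A$1$1 * x$1 + A$1$2 * x$2 + b$1"
  "affine_field A b x $ 2 = A$2$1 * x$1 + A$2$2 * x$2 + b$2"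
  by (simp_all add: affine_field_def matrix_vector_mult_def sum_2)

lemma continuous_affine_field:
  "continuous_on S x \<Longrightarrow> continuous_on S (\<lambda>r. affine_field A b (x r))"
  unfolding affine_field_def
  by (intro continuous_on_add continuous_on_const 
        bounded_linear.continuous_on[OF matrix_vector_mul_bounded_linear])

text \<open>The factor \<open>\<kappa>\<close> is \<open>1\<close> on the left. On the right it is \<open>- a\<^sub>1\<^sub>2\<^sup>L / a\<^sub>1\<^sub>2\<^sup>R\<close>, which reflects the half plane
and scales velocities so that levels of both sides are measured in the same unit.\<close>

lemma affine_solution_focus_motion:
  fixes A :: "real^2^2"
  assumes focus: "(trace A)^2 - 4 * Determinants.det A < 0"
    and sol: "\<And>r. r \<in> {s..t} \<Longrightarrow> (x has_vector_derivative affine_field A b (x r)) (at r within {s..t})"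
  shows "focus_motion (\<kappa> * (A$1$2 * b$2 - A$2$2 * b$1)) (trace A) (Determinants.det A)
           (\<lambda>r. \<kappa> * x r $ 1) (\<lambda>r. \<kappa> * affine_field A b (x r) $ 1) s t"
proof
  have comp: "((\<lambda>r. x r $ i) has_real_derivative affine_field A b (x r) $ i) (at r within {s..t})"
    if "r \<in> {s..t}" for r i
    using bounded_linear.has_vector_derivative[OF bounded_linear_vec_nth sol[OF that], of i]
    by (simp add: has_real_derivative_iff_has_vector_derivative)
  fix r assume r: "r \<in> {s..t}"
  show "((\<lambda>r. \<kappa> * x r $ 1) has_real_derivative \<kappa> * affine_field A b (x r) $ 1) (at r within {s..t})"
    by (intro DERIV_cmult comp[OF r])
  have "((\<lambda>r. \<kappa> * affine_field A b (x r) $ 1) has_real_derivative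
      \<kappa> * (A$1$1 * affine_field A b (x r) $ 1 + A$1$2 * affine_field A b (x r) $ 2)) (at r within {s..t})"
    unfolding affine_field_nth(1)[of A b "x _"]
    using comp[OF r, of 1] comp[OF r, of 2]
    by (auto intro!: derivative_eq_intros simp: affine_field_nth)
  moreover have "\<kappa> * (A$1$1 * affine_field A b (x r) $ 1 + A$1$2 * affine_field A b (x r) $ 2)
      = trace A * (\<kappa> * affine_field A b (x r) $ 1) - Determinants.det A * (\<kappa> * x r $ 1)
        + \<kappa> * (A$1$2 * b$2 - A$2$2 * b$1)"
    by (simp add: affine_field_nth det_2 trace_def sum_2 algebra_simps)
  ultimately show "((\<lambda>r. \<kappa> * affine_field A b (x r) $ 1) has_real_derivative
      trace A * (\<kappa> * affine_field A b (x r) $ 1) - Determinants.det A * (\<kappa> * x r $ 1)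
        + \<kappa> * (A$1$2 * b$2 - A$2$2 * b$1)) (at r within {s..t})"
    by simp
qed (rule focus)

lemma filippov_field_cases:
  "p $ 1 < 0 \<Longrightarrow> filippov_field A_L b_L A_R b_R p = {affine_field A_L b_L p}"
  "p $ 1 > 0 \<Longrightarrow> filippov_field A_L b_L A_R b_R p = {affine_field A_R b_R p}"
  by (simp_all add: filippov_field_def)

lemma filippov_field_bound:
  assumes "\<sigma> * affine_field A_L b_L p $ 1 \<le> c" "\<sigma> * affine_field A_R b_R p $ 1 \<le> c"
    and "w \<in> filippov_field A_L b_L A_R b_R p"
  shows "\<sigma> * w $ 1 \<le> c"
proof -
  let ?l = "affine_field A_L b_L p" and ?r = "affine_field A_R b_R p"
  have "w \<in> convex hull {?l, ?r}"
    using assms(3) hull_subset[of "{?l, ?r}" convex] by (auto simp: filippov_field_def split: if_splits)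
  then obtain u u' where u: "0 \<le> u" "0 \<le> u'" "u + u' = 1" "w = u *\<^sub>R ?l + u' *\<^sub>R ?r"
    by (auto simp: convex_hull_2)
  have "\<sigma> * w $ 1 = u * (\<sigma> * ?l $ 1) + u' * (\<sigma> * ?r $ 1)"
    by (simp add: u(4) algebra_simps)
  also have "\<dots> \<le> u * c + u' * c"
    using assms u by (intro add_mono mult_left_mono) auto
  also have "\<dots> = c" using u(3) by (simp flip: distrib_right)
  finally show ?thesis .
qed

lemma isCont_less_nbhd:
  fixes f :: "real \<Rightarrow> real"
  assumes "isCont f r" "f r < c"
  obtains e where "e > 0" "\<And>q. \<bar>q - r\<bar> < e \<Longrightarrow> f q < c"
proof -
  have "\<forall>\<^sub>F q in nhds r. f q < c"
    using assms by (auto simp: isCont_def tendsto_at_iff_tendsto_nhds dest: order_tendstoD(2))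
  then obtain e where "e > 0" "\<forall>q. dist q r < e \<longrightarrow> f q < c"
    by (auto simp: eventually_nhds_metric)
  then show thesis using that by (auto simp: dist_real_def)
qed

lemma first_zero:
  fixes g :: "real \<Rightarrow> real"
  assumes cont: "\<And>r. isCont g r" and "a \<le> b" "g a < 0" "g b \<ge> 0"
  obtains t where "a < t" "t \<le> b" "g t = 0" "\<And>r. a \<le> r \<Longrightarrow> r < t \<Longrightarrow> g r < 0"
proof -
  define Z where "Z = {r. 0 \<le> g r} \<inter> {a..b}"
  define t where "t = Inf Z"
  have cl: "closed Z"
    unfolding Z_def using cont
    by (intro closed_Int closed_Collect_le continuous_at_imp_continuous_on) auto
  have ne: "b \<in> Z" using assms by (simp add: Z_def)
  have bd: "bdd_below Z" by (auto simp: Z_def intro!: bdd_belowI[of _ a])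
  have tZ: "t \<in> Z" unfolding t_def using closed_contains_Inf[OF _ bd cl] ne by auto
  have before: "g r < 0" if "a \<le> r" "r < t" for r
  proof (rule ccontr)
    assume "\<not> g r < 0"
    then have "r \<in> Z" using that tZ by (auto simp: Z_def)
    then show False using cInf_lower[OF _ bd] that by (force simp: t_def)
  qed
  have "a \<noteq> t" using tZ assms by (auto simp: Z_def)
  then have "a < t" using tZ by (auto simp: Z_def)
  have "g t \<le> 0"
  proof (rule ccontr)
    assume "\<not> g t \<le> 0"
    then obtain e where e: "e > 0" "\<And>q. \<bar>q - t\<bar> < e \<Longrightarrow> - g q < 0"
      using isCont_less_nbhd[of t "\<lambda>q. - g q" 0] cont by (auto intro: continuous_intros)
    define q where "q = max a (t - e / 2)"
    have "a \<le> q" "q < t" "\<bar>q - t\<bar> < e" using \<open>a < t\<close> e by (auto simp: q_def)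
    then show False using before[of q] e(2)[of q] by simp
  qed
  then have "g t = 0" using tZ by (auto simp: Z_def)
  then show thesis using that \<open>a < t\<close> tZ before by (auto simp: Z_def)
qed

lemma last_zero:
  fixes g :: "real \<Rightarrow> real"
  assumes cont: "\<And>r. isCont g r" and "a \<le> b" "g b < 0" "g a \<ge> 0"
  obtains t where "a \<le> t" "t < b" "g t = 0" "\<And>r. t < r \<Longrightarrow> r \<le> b \<Longrightarrow> g r < 0"
proof -
  have "isCont (\<lambda>r. g (- r)) r" for r
    using isCont_o2[of r uminus g] cont by (auto intro: continuous_intros)
  then obtain t where t: "- b < t" "t \<le> - a" "g (- t) = 0" "\<And>r. - b \<le> r \<Longrightarrow> r < t \<Longrightarrow> g (- r) < 0"
    using first_zero[of "\<lambda>r. g (- r)" "- b" "- a"] assms by auto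
  show thesis
    by (rule that[of "- t"]) (use t t(4)[of "- _"] in auto)
qed

text \<open>A periodic solution that meets the switching line in crossing points only, with its velocity \<open>v\<close>
known almost everywhere.\<close>

locale crossing_orbit =
  fixes A_L :: "real^2^2" and b_L :: "real^2" and A_R :: "real^2^2" and b_R :: "real^2"
    and x v :: "real \<Rightarrow> real^2" and P :: real
  assumes same_sign: "A_L$1$2 * A_R$1$2 > 0"
    and focusL: "(trace A_L)^2 - 4 * Determinants.det A_L < 0"
    and focusR: "(trace A_R)^2 - 4 * Determinants.det A_R < 0"
    and solution: "\<And>s t. s \<le> t \<Longrightarrow> (v has_integral x t - x s) {s..t}"
    and inclusion: "AE t in lebesgue. v t \<in> filippov_field A_L b_L A_R b_R (x t)"
    and period_pos: "P > 0" and period: "\<And>t. x (t + P) = x t"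
    and crossing: "\<And>r. x r $ 1 = 0 \<Longrightarrow> crossing_point A_L b_L A_R b_R (x r)"
    and left_visited: "\<exists>r. x r $ 1 < 0" and right_visited: "\<exists>r. x r $ 1 > 0"
begin

abbreviation "vL r \<equiv> affine_field A_L b_L (x r) $ 1"
abbreviation "vR r \<equiv> affine_field A_R b_R (x r) $ 1"
abbreviation "bs \<equiv> par_bstar A_L b_L A_R b_R"

definition level :: "real \<Rightarrow> real" where "level r = - (A_L$1$2 * x r $ 2 + b_L$1)"

lemma isCont_x: "isCont x r"
proof -
  have int: "v integrable_on {r - 1..r + 1}"
    using solution[of "r - 1" "r + 1"] by (auto simp: has_integral_integrable_integral)
  have "continuous_on {r - 1..r + 1} (\<lambda>q. x (r - 1) + integral {r - 1..q} v)"
    by (intro continuous_intros indefinite_integral_continuous_1 int)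
  moreover have "x (r - 1) + integral {r - 1..q} v = x q" if "q \<in> {r - 1..r + 1}" for q
    using solution[of "r - 1" q] that by (simp add: integral_unique)
  ultimately have "continuous_on {r - 1..r + 1} x"
    by (rule continuous_on_eq)
  then show ?thesis
    by (rule continuous_on_interior) (simp add: interior_atLeastAtMost_real)
qed

lemma isCont_nth: "isCont (\<lambda>r. x r $ i) r"
  using isCont_x by (intro continuous_intros)

lemma isCont_vL: "isCont vL r" and isCont_vR: "isCont vR r"
  unfolding affine_field_nth by (intro continuous_intros isCont_nth)+

lemma isCont_level: "isCont level r"
  unfolding level_def[abs_def] by (intro continuous_intros isCont_nth)

lemma exceptional_set:
  obtains N where "negligible N" "\<And>t. t \<notin> N \<Longrightarrow> v t \<in> filippov_field A_L b_L A_R b_R (x t)"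
  using inclusion unfolding eventually_ae_filter negligible_iff_null_sets by auto

text \<open>In the interior of a side the inclusion determines the velocity almost everywhere, and an indefinite
integral of a continuous function is continuously differentiable, up to the end points.\<close>

lemma one_sided_derivative:
  assumes side: "\<And>q. s < q \<Longrightarrow> q < t \<Longrightarrow>
      filippov_field A_L b_L A_R b_R (x q) = {affine_field A b (x q)}"
    and r: "r \<in> {s..t}"
  shows "(x has_vector_derivative affine_field A b (x r)) (at r within {s..t})"
proof -
  obtain N where N: "negligible N" "\<And>t. t \<notin> N \<Longrightarrow> v t \<in> filippov_field A_L b_L A_R b_R (x t)"
    using exceptional_set by blast
  define f where "f q = affine_field A b (x q)" for q
  have "continuous_on {s..t} f"
    unfolding f_def using isCont_x
    by (intro continuous_affine_field continuous_at_imp_continuous_on) auto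
  from integral_has_vector_derivative[OF this r]
  have d: "((\<lambda>u. x s + integral {s..u} f) has_vector_derivative f r) (at r within {s..t})"
    by (auto intro!: derivative_eq_intros)
  have eq: "x u = x s + integral {s..u} f" if u: "u \<in> {s..t}" for u
  proof -
    have "(f has_integral x u - x s) {s..u}"
    proof (rule has_integral_spike)
      show "negligible (N \<union> {s, t})" using N(1) by (intro negligible_Un) auto
      show "(v has_integral x u - x s) {s..u}" using u by (intro solution) auto
      show "f q = v q" if "q \<in> {s..u} - (N \<union> {s, t})" for q
        using that u N(2)[of q] side[of q] by (auto simp: f_def)
    qed
    then show ?thesis by (simp add: integral_unique)
  qed
  show ?thesis
    using has_vector_derivative_transform[OF r eq d] by (simp add: f_def)
qed

text \<open>Where both fields push to one side at a definite rate, so does every Filippov solution, because a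
half plane of velocities is convex.\<close>

lemma field_bound_decrease:
  assumes "s \<le> t"
    and vL: "\<And>q. s \<le> q \<Longrightarrow> q \<le> t \<Longrightarrow> \<sigma> * vL q \<le> - d"
    and vR: "\<And>q. s \<le> q \<Longrightarrow> q \<le> t \<Longrightarrow> \<sigma> * vR q \<le> - d"
  shows "\<sigma> * x t $ 1 - \<sigma> * x s $ 1 \<le> - d * (t - s)"
proof -
  obtain N where N: "negligible N" "\<And>t. t \<notin> N \<Longrightarrow> v t \<in> filippov_field A_L b_L A_R b_R (x t)"
    using exceptional_set by blast
  have "bounded_linear (\<lambda>w :: real^2. \<sigma> * w $ 1)"
    using bounded_linear_mult_right bounded_linear_compose bounded_linear_vec_nth by blast
  from has_integral_linear[OF solution[OF \<open>s \<le> t\<close>] this]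
  have i: "((\<lambda>q. \<sigma> * v q $ 1) has_integral \<sigma> * x t $ 1 - \<sigma> * x s $ 1) {s..t}"
    by (simp add: o_def right_diff_distrib)
  have "((\<lambda>q. if q \<in> N then - d else \<sigma> * v q $ 1) has_integral \<sigma> * x t $ 1 - \<sigma> * x s $ 1) {s..t}"
    by (rule has_integral_spike[OF N(1) _ i]) auto
  moreover have "((\<lambda>q. - d) has_integral - d * (t - s)) {s..t}"
    using has_integral_const_real[of "- d" s t] \<open>s \<le> t\<close> by (simp add: mult.commute)
  ultimately show ?thesis
  proof (rule has_integral_le)
    fix q assume "q \<in> {s..t}"
    then show "(if q \<in> N then - d else \<sigma> * v q $ 1) \<le> - d"
      using filippov_field_bound[OF vL vR N(2), of q] by auto
  qed
qed

lemma transversal_crossing: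
  assumes zero: "x r $ 1 = 0" and down: "\<sigma> * vL r < 0" "\<sigma> * vR r < 0"
  obtains e where "e > 0" "\<And>q. r < q \<Longrightarrow> q < r + e \<Longrightarrow> \<sigma> * x q $ 1 < 0"
    "\<And>q. r - e < q \<Longrightarrow> q < r \<Longrightarrow> \<sigma> * x q $ 1 > 0"
proof -
  define d where "d = min (- (\<sigma> * vL r)) (- (\<sigma> * vR r)) / 2"
  have d: "d > 0" "\<sigma> * vL r < - d" "\<sigma> * vR r < - d" using down by (auto simp: d_def min_def)
  have "isCont (\<lambda>q. \<sigma> * vL q) r" "isCont (\<lambda>q. \<sigma> * vR q) r"
    by (intro continuous_intros isCont_vL isCont_vR)+
  then obtain e1 e2 where e: "e1 > 0" "\<And>q. \<bar>q - r\<bar> < e1 \<Longrightarrow> \<sigma> * vL q < - d"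
    "e2 > 0" "\<And>q. \<bar>q - r\<bar> < e2 \<Longrightarrow> \<sigma> * vR q < - d"
    using isCont_less_nbhd[of r "\<lambda>q. \<sigma> * vL q" "- d"] isCont_less_nbhd[of r "\<lambda>q. \<sigma> * vR q" "- d"] d
    by metis
  show thesis
  proof (rule that[of "min e1 e2"])
    fix q assume q: "r < q" "q < r + min e1 e2"
    have "\<sigma> * x q $ 1 - \<sigma> * x r $ 1 \<le> - d * (q - r)"
      using q e by (intro field_bound_decrease less_imp_le) auto
    moreover have "- d * (q - r) < 0" using q d by (simp add: mult_pos_pos)
    ultimately show "\<sigma> * x q $ 1 < 0" using zero by simp
  next
    fix q assume q: "r - min e1 e2 < q" "q < r"
    have "\<sigma> * x r $ 1 - \<sigma> * x q $ 1 \<le> - d * (r - q)"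
      using q e by (intro field_bound_decrease less_imp_le) auto
    moreover have "- d * (r - q) < 0" using q d by (simp add: mult_pos_pos)
    ultimately show "\<sigma> * x q $ 1 > 0" using zero by simp
  qed (use e in simp)
qed

lemma ratio_pos: "A_L$1$2 / A_R$1$2 > 0"
  using same_sign by (simp add: zero_less_mult_iff zero_less_divide_iff)

lemma velocities_on_section:
  assumes "x r $ 1 = 0"
  shows "vL r = - level r" and "A_L$1$2 / A_R$1$2 * vR r = bs - level r"
proof -
  have "A_R$1$2 \<noteq> 0" using same_sign by auto
  then show "vL r = - level r" and "A_L$1$2 / A_R$1$2 * vR r = bs - level r"
    using assms by (simp_all add: affine_field_nth level_def par_bstar_def distrib_left)
qed

lemma crossing_direction:
  assumes "x r $ 1 = 0"
  shows "max 0 bs < level r \<and> vL r < 0 \<and> vR r < 0 \<or> level r < min 0 bs \<and> vL r > 0 \<and> vR r > 0"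
proof -
  have "vL r * vR r > 0" using crossing[OF assms] by (simp add: crossing_point_def)
  then have "vL r > 0 \<and> vR r > 0 \<or> vL r < 0 \<and> vR r < 0" by (simp add: zero_less_mult_iff)
  then show ?thesis
  proof
    assume h: "vL r > 0 \<and> vR r > 0"
    then have "bs - level r > 0" using velocities_on_section(2)[OF assms] ratio_pos
      by (metis mult_pos_pos)
    then show ?thesis using h velocities_on_section(1)[OF assms] by auto
  next
    assume h: "vL r < 0 \<and> vR r < 0"
    then have "bs - level r < 0" using velocities_on_section(2)[OF assms] ratio_pos
      by (metis mult_pos_neg)
    then show ?thesis using h velocities_on_section(1)[OF assms] by auto
  qed
qed

text \<open>\<open>\<sigma>\<close> is \<open>1\<close> for an excursion to the left and \<open>- 1\<close> for one to the right.\<close>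

definition pass :: "real \<Rightarrow> real \<Rightarrow> real \<Rightarrow> bool" where
  "pass \<sigma> s t \<longleftrightarrow> s < t \<and> x s $ 1 = 0 \<and> x t $ 1 = 0 \<and> (\<forall>r. s < r \<longrightarrow> r < t \<longrightarrow> \<sigma> * x r $ 1 < 0)"

lemma pass_ends:
  assumes pass: "pass \<sigma> s t" and \<sigma>: "\<sigma> = 1 \<or> \<sigma> = -1"
  shows "\<sigma> * vL s < 0" and "\<sigma> * vL t > 0"
proof -
  have p: "s < t" "x s $ 1 = 0" "x t $ 1 = 0" "\<And>r. s < r \<Longrightarrow> r < t \<Longrightarrow> \<sigma> * x r $ 1 < 0"
    using pass by (auto simp: pass_def)
  show "\<sigma> * vL s < 0"
  proof (rule ccontr)
    assume "\<not> ?thesis"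
    then have "(- \<sigma>) * vL s < 0" "(- \<sigma>) * vR s < 0" using crossing_direction[OF p(2)] \<sigma> by auto
    then obtain e where e: "e > 0" "\<And>q. s < q \<Longrightarrow> q < s + e \<Longrightarrow> (- \<sigma>) * x q $ 1 < 0"
      using transversal_crossing[OF p(2)] by metis
    define q where "q = min ((s + t) / 2) (s + e / 2)"
    have "s < q" "q < t" "q < s + e" using p(1) e(1) by (auto simp: q_def min_def)
    then show False using e(2)[of q] p(4)[of q] by simp
  qed
  show "\<sigma> * vL t > 0"
  proof (rule ccontr)
    assume "\<not> ?thesis"
    then have "\<sigma> * vL t < 0" "\<sigma> * vR t < 0" using crossing_direction[OF p(3)] \<sigma> by auto
    then obtain e where e: "e > 0" "\<And>q. t - e < q \<Longrightarrow> q < t \<Longrightarrow> \<sigma> * x q $ 1 > 0"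
      using transversal_crossing[OF p(3)] by metis
    define q where "q = max ((s + t) / 2) (t - e / 2)"
    have "s < q" "q < t" "t - e < q" using p(1) e(1) by (auto simp: q_def max_def)
    then show False using e(2)[of q] p(4)[of q] by simp
  qed
qed

sublocale periodic: periodic_fun_simple x P
  by standard (rule period)

text \<open>By periodicity the orbit is on the other side both later and earlier.\<close>

lemma pass_through:
  assumes "\<sigma> * x r $ 1 < 0" and \<sigma>: "\<sigma> = 1 \<or> \<sigma> = -1"
  obtains s t where "pass \<sigma> s t" "s < r" "r < t"
proof -
  obtain q where q: "\<sigma> * x q $ 1 > 0"
    using left_visited right_visited \<sigma> by (metis minus_mult_left mult_1 neg_0_less_iff_less)
  obtain k :: nat where k: "\<bar>q - r\<bar> < of_nat k * P"
    using reals_Archimedean3[OF period_pos] by blast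
  have cont: "isCont (\<lambda>r. \<sigma> * x r $ 1) r" for r by (intro continuous_intros isCont_nth)
  obtain t where t: "r < t" "\<sigma> * x t $ 1 = 0" "\<And>u. r \<le> u \<Longrightarrow> u < t \<Longrightarrow> \<sigma> * x u $ 1 < 0"
    using first_zero[OF cont, of r "q + of_nat k * P"] assms(1) q k periodic.plus_of_nat[of q k]
    by (auto simp: abs_less_iff)
  obtain s where s: "s < r" "\<sigma> * x s $ 1 = 0" "\<And>u. s < u \<Longrightarrow> u \<le> r \<Longrightarrow> \<sigma> * x u $ 1 < 0"
    using last_zero[OF cont, of "q - of_nat k * P" r] assms(1) q k periodic.minus_of_nat[of q k]
    by (auto simp: abs_less_iff)
  have "pass \<sigma> s t"
    unfolding pass_def
  proof (intro conjI allI impI)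
    show "s < t" using s(1) t(1) by simp
    show "x s $ 1 = 0" "x t $ 1 = 0" using s(2) t(2) \<sigma> by auto
    show "\<sigma> * x u $ 1 < 0" if "s < u" "u < t" for u
      using s(3)[of u] t(3)[of u] that by (cases "u \<le> r") auto
  qed
  then show thesis using that s t by blast
qed

lemma pass_starting:
  assumes r: "x r $ 1 = 0" "\<sigma> * vL r < 0" and \<sigma>: "\<sigma> = 1 \<or> \<sigma> = -1"
  obtains u where "pass \<sigma> r u"
proof -
  have "\<sigma> * vR r < 0" using r crossing_direction[OF r(1)] \<sigma> by auto
  then obtain e where e: "e > 0" "\<And>q. r < q \<Longrightarrow> q < r + e \<Longrightarrow> \<sigma> * x q $ 1 < 0"
    using transversal_crossing[OF r] by metis
  obtain t u where u: "pass \<sigma> t u" "t < r + e / 2" "r + e / 2 < u"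
    using pass_through[of \<sigma> "r + e / 2"] e \<sigma> by auto
  have "\<not> t < r" using u r e(1) by (auto simp: pass_def)
  moreover have "\<not> r < t" using u e(2)[of t] e(1) by (auto simp: pass_def)
  ultimately have "t = r" by simp
  then show thesis using that u by simp
qed

lemma pass_ending:
  assumes r: "x r $ 1 = 0" "\<sigma> * vL r > 0" and \<sigma>: "\<sigma> = 1 \<or> \<sigma> = -1"
  obtains u where "pass \<sigma> u r"
proof -
  have "(- \<sigma>) * vL r < 0" "(- \<sigma>) * vR r < 0" using r crossing_direction[OF r(1)] \<sigma> by auto
  then obtain e where e: "e > 0" "\<And>q. r - e < q \<Longrightarrow> q < r \<Longrightarrow> (- \<sigma>) * x q $ 1 > 0"
    using transversal_crossing[OF r(1)] by metis
  obtain u t where u: "pass \<sigma> u t" "u < r - e / 2" "r - e / 2 < t"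
    using pass_through[of \<sigma> "r - e / 2"] e(1) e(2)[of "r - e / 2"] \<sigma> by auto
  have "\<not> t < r" using u e(2)[of t] e(1) by (auto simp: pass_def)
  moreover have "\<not> r < t"
  proof
    assume "r < t"
    moreover have "u < r" using u(2) e(1) by linarith
    ultimately have "\<sigma> * x r $ 1 < 0" using u(1) by (simp add: pass_def)
    then show False using r(1) by simp
  qed
  ultimately have "t = r" by simp
  then show thesis using that u by simp
qed

abbreviation "aL \<equiv> par_aL A_L b_L"
abbreviation "aR \<equiv> par_aR A_L A_R b_R"
abbreviation "TL \<equiv> trace A_L"
abbreviation "TR \<equiv> trace A_R"
abbreviation "DL \<equiv> Determinants.det A_L"
abbreviation "DR \<equiv> Determinants.det A_R"

sublocale halves: two_foci aL aR TL DL TR DR bs "pass_const aL TL DL" "pass_const (- aR) TR DR"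
  by standard (fact focusL focusR)+

lemma left_pass:
  assumes pass: "pass 1 s t"
  shows "halves.left_match (level s) (level t)"
proof -
  have p: "s < t" "x s $ 1 = 0" "x t $ 1 = 0" "\<And>r. s < r \<Longrightarrow> r < t \<Longrightarrow> x r $ 1 < 0"
    using pass by (auto simp: pass_def)
  have lev: "max 0 bs < level s" "level t < min 0 bs"
    using pass_ends[OF pass] crossing_direction[OF p(2)] crossing_direction[OF p(3)] by auto
  have "focus_motion (1 * (A_L$1$2 * b_L$2 - A_L$2$2 * b_L$1)) TL DL (\<lambda>r. 1 * x r $ 1) (\<lambda>r. 1 * vL r) s t"
    by (intro affine_solution_focus_motion focusL one_sided_derivative filippov_field_cases(1) p(4))
  then have "focus_motion aL TL DL (\<lambda>r. x r $ 1) vL s t"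
    by (simp add: par_aL_def)
  then have "focus_pass aL TL DL (\<lambda>r. x r $ 1) vL s t (level s) (level t)"
    by (intro focus_pass.intro focus_pass_axioms.intro)
       (use p lev velocities_on_section in auto)
  then show ?thesis
    using focus_pass.pass_relation lev by (auto simp: halves.left_match_def)
qed

lemma right_pass:
  assumes pass: "pass (-1) s t"
  shows "halves.right_match (level t) (level s)"
proof -
  define k where "k = - (A_L$1$2 / A_R$1$2)"
  have p: "s < t" "x s $ 1 = 0" "x t $ 1 = 0" "\<And>r. s < r \<Longrightarrow> r < t \<Longrightarrow> x r $ 1 > 0"
    using pass by (auto simp: pass_def)
  have k: "k < 0" using ratio_pos by (simp add: k_def)
  have lev: "max 0 bs < level t" "level s < min 0 bs"
    using pass_ends[OF pass] crossing_direction[OF p(2)] crossing_direction[OF p(3)] by auto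
  have "focus_motion (k * (A_R$1$2 * b_R$2 - A_R$2$2 * b_R$1)) TR DR (\<lambda>r. k * x r $ 1) (\<lambda>r. k * vR r) s t"
    by (intro affine_solution_focus_motion focusR one_sided_derivative filippov_field_cases(2) p(4))
  moreover have "k * (A_R$1$2 * b_R$2 - A_R$2$2 * b_R$1) = - aR"
    by (simp add: k_def par_aR_def)
  ultimately have "focus_motion (- aR) TR DR (\<lambda>r. k * x r $ 1) (\<lambda>r. k * vR r) s t"
    by simp
  moreover have "k * vR r = - (bs - level r)" if "x r $ 1 = 0" for r
    using velocities_on_section(2)[OF that] by (simp add: k_def)
  ultimately have "focus_pass (- aR) TR DR (\<lambda>r. k * x r $ 1) (\<lambda>r. k * vR r) s t
      (bs - level s) (bs - level t)"
    by (intro focus_pass.intro focus_pass_axioms.intro)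
       (use p lev k in \<open>auto intro: mult_neg_pos\<close>)
  then show ?thesis
    using focus_pass.pass_relation lev by (auto simp: halves.right_match_def)
qed

lemma reduce_time: "\<exists>q\<in>{0..P}. x q = x r"
proof
  have "of_int \<lfloor>r / P\<rfloor> * P \<le> r" "r < (of_int \<lfloor>r / P\<rfloor> + 1) * P"
    using floor_divide_lower[OF period_pos] floor_divide_upper[OF period_pos] by blast+
  then show "r - of_int \<lfloor>r / P\<rfloor> * P \<in> {0..P}" by (simp add: algebra_simps)
  show "x (r - of_int \<lfloor>r / P\<rfloor> * P) = x r" by (rule periodic.minus_of_int)
qed

lemma highest_level:
  obtains r where "x r $ 1 = 0" "level r > 0"
    "\<And>q. x q $ 1 = 0 \<Longrightarrow> level q > 0 \<Longrightarrow> level q \<le> level r"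
proof -
  define Z where "Z = {r\<in>{0..P}. x r $ 1 = 0 \<and> 0 \<le> level r}"
  have red: "\<exists>q'\<in>Z. level q' = level q" if q: "x q $ 1 = 0" "level q > 0" for q
  proof -
    obtain q' where "q' \<in> {0..P}" "x q' = x q" using reduce_time by blast
    then show ?thesis using q by (auto simp: Z_def level_def)
  qed
  have "Z = {0..P} \<inter> ({r. x r $ 1 = 0} \<inter> {r. 0 \<le> level r})" by (auto simp: Z_def)
  moreover have "closed ({r. x r $ 1 = 0} \<inter> {r. 0 \<le> level r})"
    using isCont_nth isCont_level
    by (intro closed_Int closed_Collect_le closed_Collect_eq continuous_at_imp_continuous_on) auto
  ultimately have "compact Z" by (simp add: compact_Int_closed)
  obtain q where "x q $ 1 < 0" using left_visited by blast
  then obtain s t where "pass 1 s t" using pass_through[of 1 q] by (metis mult_1)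
  then have "x s $ 1 = 0" "level s > 0"
    using left_pass[of s t] by (auto simp: pass_def halves.left_match_def)
  then have "Z \<noteq> {}" using red by blast
  moreover have "continuous_on Z level"
    using isCont_level by (intro continuous_at_imp_continuous_on) auto
  ultimately obtain r where r: "r \<in> Z" "\<And>q. q \<in> Z \<Longrightarrow> level q \<le> level r"
    using continuous_attains_sup[OF \<open>compact Z\<close>, of level] by blast
  have r0: "x r $ 1 = 0" using r(1) by (simp add: Z_def)
  moreover have "level r > 0"
    using r(1) crossing_direction[OF r0] by (auto simp: Z_def)
  moreover have "level q \<le> level r" if "x q $ 1 = 0" "level q > 0" for q
    using red[OF that] r(2) by force
  ultimately show thesis using that by blast
qed

text \<open>Let \<open>r\<close> be a time of entry into the left half plane with the highest level. The level one loop earlier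
is not higher, and the return map is increasing; so the level one loop later is not lower than at
\<open>r\<close>, hence equal to it. This replaces a topological argument that the orbit closes after one loop.\<close>

lemma double_match:
  obtains r y1 where "x r $ 1 = 0" "halves.left_match (level r) y1" "halves.right_match (level r) y1"
proof -
  obtain r where r: "x r $ 1 = 0" "level r > 0"
    and top: "\<And>q. x q $ 1 = 0 \<Longrightarrow> level q > 0 \<Longrightarrow> level q \<le> level r"
    using highest_level by blast
  have down: "vL r < 0" using crossing_direction[OF r(1)] r(2) by auto
  have z: "x s $ 1 = 0" "x t $ 1 = 0" if "pass \<sigma> s t" for \<sigma> s t using that by (auto simp: pass_def)
  obtain t where t: "pass 1 r t" using pass_starting[OF r(1), of 1] down by auto
  obtain u where u: "pass (-1) t u"
    using pass_starting[OF z(2)[OF t], of "-1"] pass_ends(2)[OF t] by auto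
  obtain t' where t': "pass (-1) t' r" using pass_ending[OF r(1), of "-1"] down by auto
  obtain s' where s': "pass 1 s' t'"
    using pass_ending[OF z(1)[OF t'], of 1] pass_ends(1)[OF t'] by auto
  let ?L = "pass_integral aL TL DL" and ?R = "pass_integral (- aR) TR DR"
  have L: "?L (level t) = ?L (level r) + pass_const aL TL DL" "level t < 0" "level t < bs"
    "?L (level t') = ?L (level s') + pass_const aL TL DL" "level t' < 0" "level t' < bs" "level s' > 0"
    using left_pass[OF t] left_pass[OF s'] by (auto simp: halves.left_match_def)
  have R: "?R (bs - level r) = ?R (bs - level t') + pass_const (- aR) TR DR" "level r > bs"
    "?R (bs - level u) = ?R (bs - level t) + pass_const (- aR) TR DR" "level u > bs" "level u > 0"
    using right_pass[OF t'] right_pass[OF u] by (auto simp: halves.right_match_def)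
  have "level s' \<le> level r" using top[OF z(1)[OF s']] L by simp
  then have "?L (level t') \<le> ?L (level t)"
    using pass_integral_less_iff(1)[OF focusL, of "level r" "level s'" aL] L r by force
  then have "level t \<le> level t'"
    using pass_integral_less_iff(2)[OF focusL, of "level t" "level t'" aL] L by force
  then have "?R (bs - level t') \<le> ?R (bs - level t)"
    using pass_integral_less_iff(1)[OF focusR, of "bs - level t" "bs - level t'" "- aR"] L by force
  then have "level r \<le> level u"
    using pass_integral_less_iff(2)[OF focusR, of "bs - level u" "bs - level r" "- aR"] R by force
  moreover have "level u \<le> level r" using top[OF z(2)[OF u]] R by simp
  ultimately have "level u = level r" by simp
  then have "halves.right_match (level r) (level t)" using right_pass[OF u] by simp
  then show thesis using that r left_pass[OF t] by blast
qed

lemma side_after: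
  assumes side: "\<sigma> * x r $ 1 < 0 \<or> x r $ 1 = 0 \<and> \<sigma> * vL r < 0 \<and> \<sigma> * vR r < 0"
  obtains e where "e > 0" "\<And>q. r < q \<Longrightarrow> q < r + e \<Longrightarrow> \<sigma> * x q $ 1 < 0"
proof (cases "x r $ 1 = 0")
  case True
  then have "\<sigma> * vL r < 0" "\<sigma> * vR r < 0" using side by auto
  then show thesis using transversal_crossing[OF True] that by metis
next
  case False
  have "isCont (\<lambda>q. \<sigma> * x q $ 1) r" by (intro continuous_intros isCont_nth)
  then obtain e where "e > 0" "\<And>q. \<bar>q - r\<bar> < e \<Longrightarrow> \<sigma> * x q $ 1 < 0"
    using isCont_less_nbhd[of r "\<lambda>q. \<sigma> * x q $ 1" 0] False side by blast
  then show thesis using that[of e] by auto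
qed

text \<open>At a crossing point the field decides the side on which the solution continues; the choice depends on
the point only.\<close>

lemma side_exists:
  "\<exists>\<sigma>. (\<sigma> = 1 \<or> \<sigma> = -1) \<and>
     (\<sigma> * x r $ 1 < 0 \<or> x r $ 1 = 0 \<and> \<sigma> * vL r < 0 \<and> \<sigma> * vR r < 0)"
proof -
  consider "x r $ 1 < 0" | "x r $ 1 > 0" | "x r $ 1 = 0" by linarith
  then show ?thesis
  proof cases
    case 3
    then show ?thesis using crossing_direction[OF 3] by (cases "vL r < 0") (auto intro: exI[of _ 1] exI[of _ "-1"])
  qed (auto intro: exI[of _ 1] exI[of _ "-1"])
qed

end

lemma focus_motion_unique:
  assumes fm: "focus_motion a T D x v s (s + h)" and fm': "focus_motion a T D x' v' s' (s' + h)"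
    and start: "x s = x' s'" "v s = v' s'" and q: "0 \<le> q" "q \<le> h"
  shows "x (s + q) = x' (s' + q)" and "v (s + q) = v' (s' + q)"
proof -
  interpret X: focus_motion a T D x v s "s + h" by (rule fm)
  interpret Y: focus_motion a T D x' v' s' "s' + h" by (rule fm')
  have q': "s + q \<in> {s..s + h}" "s' + q \<in> {s'..s' + h}" using q by auto
  have st: "X.m s = Y.m s'" "X.n s = Y.n s'"
    using start by (simp_all add: X.m_def Y.m_def X.n_def Y.n_def)
  have "X.n (s + q) = Y.n (s' + q)"
    unfolding X.motion(2)[OF q'(1)] Y.motion(2)[OF q'(2)] st by simp
  then show x: "x (s + q) = x' (s' + q)"
    using X.\<beta>_pos by (simp add: X.n_def Y.n_def)
  have "X.m (s + q) = Y.m (s' + q)"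
    unfolding X.motion(1)[OF q'(1)] Y.motion(1)[OF q'(2)] st by simp
  then show "v (s + q) = v' (s' + q)"
    using x by (simp add: X.m_def Y.m_def)
qed

lemma affine_solution_unique:
  fixes A :: "real^2^2"
  assumes focus: "(trace A)^2 - 4 * Determinants.det A < 0" and "A$1$2 \<noteq> 0"
    and x: "\<And>r. r \<in> {s..s + h} \<Longrightarrow>
              (x has_vector_derivative affine_field A b (x r)) (at r within {s..s + h})"
    and x': "\<And>r. r \<in> {s'..s' + h} \<Longrightarrow>
              (x' has_vector_derivative affine_field A b (x' r)) (at r within {s'..s' + h})"
    and start: "x s = x' s'" and q: "0 \<le> q" "q \<le> h"
  shows "x (s + q) = x' (s' + q)"
proof -
  note fm = affine_solution_focus_motion[OF focus x, of 1] affine_solution_focus_motion[OF focus x', of 1]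
  have 1: "x (s + q) $ 1 = x' (s' + q) $ 1"
    using focus_motion_unique(1)[OF fm _ _ q] start by simp
  have "affine_field A b (x (s + q)) $ 1 = affine_field A b (x' (s' + q)) $ 1"
    using focus_motion_unique(2)[OF fm _ _ q] start by simp
  then have "x (s + q) $ 2 = x' (s' + q) $ 2"
    using 1 \<open>A$1$2 \<noteq> 0\<close> by (simp add: affine_field_nth)
  then show ?thesis using 1 by (simp add: Finite_Cartesian_Product.vec_eq_iff forall_2)
qed

text \<open>Forward uniqueness. The two solutions agree up to a maximal time; there they are at the same point,
continue on the same side and obey the same affine equation, so they agree a little longer.
Periodicity turns agreement in the future into equality of the orbits.\<close>

lemma crossing_orbits_meeting:
  assumes "crossing_orbit A_L b_L A_R b_R x v P" "crossing_orbit A_L b_L A_R b_R x' v' P'"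
    and start: "x s = x' s'"
  shows "range x = range x'"
proof -
  interpret X: crossing_orbit A_L b_L A_R b_R x v P by fact
  interpret Y: crossing_orbit A_L b_L A_R b_R x' v' P' by fact
  have nz: "A_L$1$2 \<noteq> 0" "A_R$1$2 \<noteq> 0" using X.same_sign by auto
  have prolong: "\<exists>h>0. \<forall>q. 0 \<le> q \<and> q \<le> h \<longrightarrow> x (r + q) = x' (r' + q)" if eq: "x r = x' r'" for r r'
  proof -
    obtain \<sigma> where \<sigma>: "\<sigma> = 1 \<or> \<sigma> = -1"
      and side: "\<sigma> * x r $ 1 < 0 \<or> x r $ 1 = 0 \<and> \<sigma> * X.vL r < 0 \<and> \<sigma> * X.vR r < 0"
      using X.side_exists by blast
    obtain e where e: "e > 0" "\<And>q. r < q \<Longrightarrow> q < r + e \<Longrightarrow> \<sigma> * x q $ 1 < 0"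
      using X.side_after[OF side] by blast
    obtain e' where e': "e' > 0" "\<And>q. r' < q \<Longrightarrow> q < r' + e' \<Longrightarrow> \<sigma> * x' q $ 1 < 0"
      using Y.side_after[of \<sigma> r'] side eq by metis
    define h where "h = min e e'"
    have h: "h > 0" using e e' by (simp add: h_def)
    from \<sigma> have "x (r + q) = x' (r' + q)" if q: "0 \<le> q" "q \<le> h" for q
    proof
      assume "\<sigma> = 1"
      have neg: "x u $ 1 < 0" if "r < u" "u < r + h" for u
        using that e(2)[of u] \<open>\<sigma> = 1\<close> by (auto simp: h_def)
      have neg': "x' u $ 1 < 0" if "r' < u" "u < r' + h" for u
        using that e'(2)[of u] \<open>\<sigma> = 1\<close> by (auto simp: h_def)
      show ?thesis
        by (rule affine_solution_unique[where b = b_L, OF X.focusL nz(1) X.one_sided_derivative Y.one_sided_derivative eq q])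
           (use neg neg' in \<open>simp_all add: filippov_field_cases\<close>)
    next
      assume "\<sigma> = -1"
      have pos: "x u $ 1 > 0" if "r < u" "u < r + h" for u
        using that e(2)[of u] \<open>\<sigma> = -1\<close> by (auto simp: h_def)
      have pos': "x' u $ 1 > 0" if "r' < u" "u < r' + h" for u
        using that e'(2)[of u] \<open>\<sigma> = -1\<close> by (auto simp: h_def)
      show ?thesis
        by (rule affine_solution_unique[where b = b_R, OF X.focusR nz(2) X.one_sided_derivative Y.one_sided_derivative eq q])
           (use pos pos' in \<open>simp_all add: filippov_field_cases\<close>)
    qed
    then show ?thesis using h by blast
  qed
  have agree: "x (s + r) = x' (s' + r)" if "r \<ge> 0" for r
  proof (rule ccontr)
    assume neq: "x (s + r) \<noteq> x' (s' + r)"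
    define E where "E = {u\<in>{0..r}. \<forall>q\<in>{0..u}. x (s + q) = x' (s' + q)}"
    define c where "c = Sup E"
    have E0: "0 \<in> E" using that start by (simp add: E_def)
    have bd: "bdd_above E" by (auto simp: E_def intro!: bdd_aboveI[of _ r])
    have c0: "0 \<le> c" unfolding c_def by (rule cSup_upper[OF E0 bd])
    have cr: "c \<le> r" unfolding c_def using E0 by (intro cSup_least) (auto simp: E_def)
    have below: "x (s + q) = x' (s' + q)" if q: "0 \<le> q" "q < c" for q
    proof -
      obtain u where "u \<in> E" "q < u" using q(2) less_cSup_iff[OF _ bd] E0 by (auto simp: c_def)
      then show ?thesis using q by (auto simp: E_def)
    qed
    have at_c: "x (s + c) = x' (s' + c)"
    proof (cases "c = 0")
      case True
      then show ?thesis using start by simp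
    next
      case False
      define d where "d q = x (s + q) - x' (s' + q)" for q
      have "isCont d c"
        unfolding d_def using isCont_o2[of c "\<lambda>q. s + q" x] isCont_o2[of c "\<lambda>q. s' + q" x']
        by (auto intro!: continuous_intros X.isCont_x Y.isCont_x)
      then have "(d \<longlongrightarrow> d c) (at_left c)"
        by (simp add: isCont_def filterlim_at_split)
      moreover have "(d \<longlongrightarrow> 0) (at_left c)"
      proof (rule tendsto_eventually)
        have "\<forall>\<^sub>F q in at_left c. q \<in> {0<..<c}"
          using False c0 by (auto simp: eventually_at_left_field intro!: exI[of _ 0])
        then show "\<forall>\<^sub>F q in at_left c. d q = 0"
          by eventually_elim (simp add: d_def below)
      qed
      ultimately have "d c = 0" by (intro tendsto_unique[of "at_left c"]) auto
      then show ?thesis by (simp add: d_def)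
    qed
    then have "c < r" using cr neq by (cases "c = r") auto
    obtain h where h: "h > 0" "\<And>q. 0 \<le> q \<Longrightarrow> q \<le> h \<Longrightarrow> x (s + c + q) = x' (s' + c + q)"
      using prolong[OF at_c] by blast
    define u where "u = min r (c + h)"
    have "x (s + q) = x' (s' + q)" if q: "q \<in> {0..u}" for q
    proof (cases "q < c")
      case True
      then show ?thesis using below q by auto
    next
      case False
      then show ?thesis using h(2)[of "q - c"] q by (auto simp: u_def)
    qed
    then have "u \<in> E" using c0 h(1) that by (auto simp: E_def u_def)
    then have "u \<le> c" unfolding c_def by (rule cSup_upper[OF _ bd])
    then show False using \<open>c < r\<close> h(1) by (auto simp: u_def)
  qed
  show ?thesis
  proof (intro equalityI subsetI)
    fix p assume "p \<in> range x"
    then obtain r where r: "p = x r" by blast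
    obtain k :: nat where "\<bar>s - r\<bar> < of_nat k * P" using reals_Archimedean3[OF X.period_pos] by blast
    then have "0 \<le> r + of_nat k * P - s" by linarith
    from agree[OF this] have "p = x' (s' + (r + of_nat k * P - s))"
      using X.periodic.plus_of_nat[of r k] r by simp
    then show "p \<in> range x'" by simp
  next
    fix p assume "p \<in> range x'"
    then obtain r where r: "p = x' r" by blast
    obtain k :: nat where "\<bar>s' - r\<bar> < of_nat k * P'" using reals_Archimedean3[OF Y.period_pos] by blast
    then have "0 \<le> r + of_nat k * P' - s'" by linarith
    from agree[OF this] have "p = x (s + (r + of_nat k * P' - s'))"
      using Y.periodic.plus_of_nat[of r k] r by simp
    then show "p \<in> range x" by simp
  qed
qed

section \<open>The bound on the number of limit cycles\<close>

lemma degree_coeff_quadratic: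
  fixes a b c d e f :: real
  assumes "i \<le> degree [:[:a, b, c:], [:d, e:], [:f:]:]"
  shows "degree (coeff [:[:a, b, c:], [:d, e:], [:f:]:] i) + i \<le> 2"
proof -
  have "degree [:[:a, b, c:], [:d, e:], [:f:]:] \<le> 2" by simp
  then consider "i = 0" | "i = 1" | "i = 2" using assms by linarith
  then show ?thesis by cases (simp_all add: numeral_2_eq_2)
qed

lemma degree_coeff_cubic:
  fixes a b c d e f g h k l :: real
  assumes "i \<le> degree (- [:[:a, b, c, d:], [:e, f, g:], [:h, k:], [:l:]:])"
  shows "degree (coeff (- [:[:a, b, c, d:], [:e, f, g:], [:h, k:], [:l:]:]) i) + i \<le> 3"
proof -
  have "degree (- [:[:a, b, c, d:], [:e, f, g:], [:h, k:], [:l:]:]) \<le> 3" by simp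
  then consider "i = 0" | "i = 1" | "i = 2" | "i = 3" using assms by linarith
  then show ?thesis by cases (simp_all add: numeral_2_eq_2 numeral_3_eq_3)
qed

lemma degree_resultant_le_6:
  "degree (resultant (F_tilde a_L a_R T_L D_L T_R D_R b) (G_tilde a_L a_R T_L D_L T_R D_R b)) \<le> 6"
proof -
  let ?F = "F_tilde a_L a_R T_L D_L T_R D_R b" and ?G = "G_tilde a_L a_R T_L D_L T_R D_R b"
  have F: "degree (coeff ?F i) + i \<le> 2" if "i \<le> degree ?F" for i
    using that unfolding F_tilde_eq by (rule degree_coeff_quadratic)
  have G: "degree (coeff ?G i) + i \<le> 3" if "i \<le> degree ?G" for i
    using that unfolding G_tilde_eq by (rule degree_coeff_cubic)
  have "degree (resultant ?F ?G) + degree ?F * degree ?G \<le> degree ?G * 2 + degree ?F * 3"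
    by (rule degree_resultant_le[OF F G])
  moreover have "(2 - int (degree ?F)) * (3 - int (degree ?G)) \<ge> 0"
    using F[of "degree ?F"] G[of "degree ?G"] by (intro mult_nonneg_nonneg) auto
  then have "int (degree ?G * 2 + degree ?F * 3) \<le> int (6 + degree ?F * degree ?G)"
    by (simp add: algebra_simps)
  ultimately show ?thesis by linarith
qed

context two_foci
begin

text \<open>If \<open>F\<close> vanishes on \<open>Y\<^sub>1 = w\<close>, then \<open>a\<^sub>L = 0\<close> or \<open>b = 0\<close>, and \<open>F\<close> reduces to \<open>m\<^sub>5 Y\<^sub>1 (Y\<^sub>1 - w)\<close>. Comparing the
coefficients of \<open>G\<close> then forces \<open>m\<^sub>5 = 0\<close>.\<close>

lemma no_common_line:
  assumes nz: "F_tilde a_L a_R T_L D_L T_R D_R b \<noteq> 0" and "w < 0"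
    and F: "\<And>u. eval2 (F_tilde a_L a_R T_L D_L T_R D_R b) u w = 0"
    and G: "\<And>u. eval2 (G_tilde a_L a_R T_L D_L T_R D_R b) u w = 0"
  shows False
proof -
  define M0 M1 M2 M3 M4 M5 where "M0 = m0 a_L a_R T_L D_L T_R D_R b"
    and "M1 = m1 a_L a_R T_L D_L T_R D_R b" and "M2 = m2 a_L a_R T_L D_L T_R D_R b"
    and "M3 = m3 a_L a_R T_L D_L T_R D_R b" and "M4 = m4 a_L a_R T_L D_L T_R D_R b"
    and "M5 = m5 a_L a_R T_L D_L T_R D_R b"
  note M = M0_def[symmetric] M1_def[symmetric] M2_def[symmetric] M3_def[symmetric]
    M4_def[symmetric] M5_def[symmetric]
  have quad: "p = 0 \<and> q = 0 \<and> r = 0" if "\<And>u. p + q * u + r * u^2 = 0" for p q r :: real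
    using that[of 0] that[of 1] that[of "-1"] by auto
  have ev: "(M0 + (M2 - 2 * M3) * w + M5 * w^2) + (M1 + M4 * w) * u + M3 * u^2 = 0" for u
    using F[of u] by (simp add: F_tilde_eq eval2_def M algebra_simps power2_eq_square)
  have "M3 = 0" "M1 + M4 * w = 0" using quad[OF ev] by auto
  then have "a_L = 0 \<or> b = 0" using focus_det_pos[OF focusR] by (simp add: M3_def m3_def)
  then have "M0 = 0" "M1 = 0" by (auto simp: M0_def m0_def M1_def m1_def)
  then have "M4 = 0" using \<open>M1 + M4 * w = 0\<close> \<open>w < 0\<close> by simp
  have "w * (M2 + M5 * w) = 0"
    using quad[OF ev] \<open>M0 = 0\<close> \<open>M3 = 0\<close> by (simp add: algebra_simps power2_eq_square)
  then have M2: "M2 = - (M5 * w)" using \<open>w < 0\<close> by simp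
  have ev': "(- 2 * a_L^2 * M5 * w^2 + 2 * D_L * M5 * w^3) + (- a_L * T_L * M5 * w^2) * u
      + (a_L^2 * M5 * w) * u^2 = 0" for u
    using G[of u] \<open>M1 = 0\<close> \<open>M3 = 0\<close> \<open>M4 = 0\<close>
    unfolding G_tilde_eq M by (simp add: eval2_def M2 algebra_simps power2_eq_square power3_eq_cube)
  have "a_L^2 * M5 = 0" using quad[OF ev'] \<open>w < 0\<close> by simp
  then have "2 * D_L * M5 * w^3 = 0" using quad[OF ev'] by auto
  then have "M5 = 0" using \<open>w < 0\<close> focus_det_pos[OF focusL] by simp
  then show False
    using nz M2 \<open>M0 = 0\<close> \<open>M1 = 0\<close> \<open>M3 = 0\<close> \<open>M4 = 0\<close> by (simp add: F_tilde_eq M)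
qed

lemma card_double_matches_bound:
  defines "R \<equiv> resultant_Y0 (F_tilde a_L a_R T_L D_L T_R D_R b) (G_tilde a_L a_R T_L D_L T_R D_R b)"
  assumes "R \<noteq> 0"
    and "finite E" and E: "\<And>y0. y0 \<in> E \<Longrightarrow> \<exists>y1. left_match y0 y1 \<and> right_match y0 y1"
  shows "card E + size {# z \<in># proots (map_poly complex_of_real R). z \<notin> \<real>\<^sub>\<le>\<^sub>0 #} \<le> 8"
proof -
  let ?F = "F_tilde a_L a_R T_L D_L T_R D_R b" and ?G = "G_tilde a_L a_R T_L D_L T_R D_R b"
  have nz: "?F \<noteq> 0" and R: "R = resultant ?F ?G"
    using \<open>R \<noteq> 0\<close> by (auto simp: R_def resultant_Y0_def split: if_splits)
  obtain S where S: "S \<subseteq> common_zeros" "finite S" "card E \<le> card S + 2"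
    using card_double_matches_le[OF nz \<open>finite E\<close> E] by blast
  have "card S + size {# z \<in># proots (map_poly complex_of_real R). z \<notin> \<real>\<^sub>\<le>\<^sub>0 #} \<le> degree R"
    unfolding R
  proof (rule card_common_zeros_le)
    show "resultant ?F ?G \<noteq> 0" using \<open>R \<noteq> 0\<close> R by simp
    show "(\<exists>u. eval2 ?F u w \<noteq> 0) \<or> (\<exists>u. eval2 ?G u w \<noteq> 0)" if "w < 0" for w
      using no_common_line[OF nz that] by blast
  qed (use S in \<open>auto simp: common_zeros_def\<close>)
  moreover have "degree R \<le> 6" unfolding R by (rule degree_resultant_le_6)
  ultimately show ?thesis using S(3) by linarith
qed

end

lemma crossing_periodic_orbit_obtain:
  assumes "A_L$1$2 * A_R$1$2 > 0"
    and "(trace A_L)^2 - 4 * Determinants.det A_L < 0" "(trace A_R)^2 - 4 * Determinants.det A_R < 0"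
    and "crossing_periodic_orbit A_L b_L A_R b_R \<Gamma>"
  obtains x v P where "crossing_orbit A_L b_L A_R b_R x v P" "\<Gamma> = range x"
proof -
  obtain x P where xP: "filippov_solution A_L b_L A_R b_R x" "P > 0" "\<And>t. x (t + P) = x t" "\<Gamma> = range x"
    and sides: "\<exists>p\<in>\<Gamma>. p $ 1 < 0" "\<exists>p\<in>\<Gamma>. p $ 1 > 0"
    and cross: "\<And>p. p \<in> \<Gamma> \<Longrightarrow> p $ 1 = 0 \<Longrightarrow> crossing_point A_L b_L A_R b_R p"
    using assms(4) unfolding crossing_periodic_orbit_def by blast
  obtain v where v: "\<And>s t. s \<le> t \<Longrightarrow> (v has_integral x t - x s) {s..t}"
    "AE t in lebesgue. v t \<in> filippov_field A_L b_L A_R b_R (x t)"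
    using xP(1) unfolding filippov_solution_def by blast
  have "crossing_orbit A_L b_L A_R b_R x v P"
    by standard (use assms v xP sides cross in auto)
  then show thesis using that xP(4) by blast
qed

theorem theorem5:
  fixes A_L A_R :: "real^2^2" and b_L b_R :: "real^2"
    and T_L T_R D_L D_R a_L a_R bstar :: real and R :: "real poly" and l :: nat
  assumes "A_L$1$2 * A_R$1$2 > 0"
    and "T_L = trace A_L" and "T_R = trace A_R"
    and "D_L = Determinants.det A_L" and "D_R = Determinants.det A_R"
    and "T_L^2 - 4 * D_L < 0" and "T_R^2 - 4 * D_R < 0"
    and "a_L = par_aL A_L b_L" and "a_R = par_aR A_L A_R b_R" and "bstar = par_bstar A_L b_L A_R b_R"
    and "R = resultant_Y0 (F_tilde a_L a_R T_L D_L T_R D_R bstar) (G_tilde a_L a_R T_L D_L T_R D_R bstar)"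
    and "R \<noteq> 0"
    and "l = size {# z \<in># proots (map_poly complex_of_real R). z \<notin> \<real>\<^sub>\<le>\<^sub>0 #}"
  shows "finite {\<Gamma>. crossing_limit_cycle A_L b_L A_R b_R \<Gamma>} \<and>
         int (card {\<Gamma>. crossing_limit_cycle A_L b_L A_R b_R \<Gamma>}) \<le> 8 - int l"
proof -
  define Orb where "Orb = {\<Gamma>. crossing_periodic_orbit A_L b_L A_R b_R \<Gamma>}"
  define level where "level p = - (A_L$1$2 * p$2 + b_L$1)" for p :: "real^2"
  interpret two_foci a_L a_R T_L D_L T_R D_R bstar "pass_const a_L T_L D_L" "pass_const (- a_R) T_R D_R"
    by standard (fact assms)+
  note hyps = assms(1) assms(6,7)[unfolded assms(2-5)]
  have "\<exists>p\<in>\<Gamma>. p $ 1 = 0 \<and> (\<exists>y1. left_match (level p) y1 \<and> right_match (level p) y1)"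
    if \<Gamma>: "\<Gamma> \<in> Orb" for \<Gamma>
  proof -
    obtain x v P where x: "crossing_orbit A_L b_L A_R b_R x v P" "\<Gamma> = range x"
      using crossing_periodic_orbit_obtain[OF hyps] \<Gamma> unfolding Orb_def by blast
    interpret X: crossing_orbit A_L b_L A_R b_R x v P by (rule x(1))
    obtain r y1 where r: "x r $ 1 = 0" "X.halves.left_match (X.level r) y1" "X.halves.right_match (X.level r) y1"
      using X.double_match by blast
    have "X.level r = level (x r)" by (simp add: X.level_def level_def)
    then show ?thesis
      using r x(2) unfolding assms(2-5,8-10) by (intro bexI[of _ "x r"]) auto
  qed
  then obtain p where p: "\<And>\<Gamma>. \<Gamma> \<in> Orb \<Longrightarrow> p \<Gamma> \<in> \<Gamma> \<and> p \<Gamma> $ 1 = 0 \<and>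
      (\<exists>y1. left_match (level (p \<Gamma>)) y1 \<and> right_match (level (p \<Gamma>)) y1)"
    by metis
  have inj: "inj_on (\<lambda>\<Gamma>. level (p \<Gamma>)) Orb"
  proof (rule inj_onI)
    fix \<Gamma> \<Gamma>' assume \<Gamma>: "\<Gamma> \<in> Orb" "\<Gamma>' \<in> Orb" "level (p \<Gamma>) = level (p \<Gamma>')"
    have "p \<Gamma> $ 2 = p \<Gamma>' $ 2" using \<Gamma>(3) assms(1) by (auto simp: level_def)
    then have eq: "p \<Gamma> = p \<Gamma>'"
      using p[OF \<Gamma>(1)] p[OF \<Gamma>(2)] by (simp add: Finite_Cartesian_Product.vec_eq_iff forall_2)
    obtain x v P where x: "crossing_orbit A_L b_L A_R b_R x v P" "\<Gamma> = range x"
      using crossing_periodic_orbit_obtain[OF hyps] \<Gamma>(1) unfolding Orb_def by blast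
    obtain x' v' P' where x': "crossing_orbit A_L b_L A_R b_R x' v' P'" "\<Gamma>' = range x'"
      using crossing_periodic_orbit_obtain[OF hyps] \<Gamma>(2) unfolding Orb_def by blast
    obtain s s' where "p \<Gamma> = x s" "p \<Gamma>' = x' s'"
      using p[OF \<Gamma>(1)] p[OF \<Gamma>(2)] x(2) x'(2) by blast
    then show "\<Gamma> = \<Gamma>'" using crossing_orbits_meeting[OF x(1) x'(1)] eq x(2) x'(2) by metis
  qed
  have bound: "card C + l \<le> 8" if "C \<subseteq> Orb" "finite C" for C
  proof -
    have "card ((\<lambda>\<Gamma>. level (p \<Gamma>)) ` C) + l \<le> 8"
      unfolding assms(13) assms(11)
    proof (rule card_double_matches_bound)
      show "resultant_Y0 (F_tilde a_L a_R T_L D_L T_R D_R bstar) (G_tilde a_L a_R T_L D_L T_R D_R bstar) \<noteq> 0"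
        using assms(11,12) by simp
    qed (use that p in auto)
    then show ?thesis using card_image[OF inj_on_subset[OF inj that(1)]] by simp
  qed
  have "finite Orb"
  proof (rule ccontr)
    assume "infinite Orb"
    then obtain C where "C \<subseteq> Orb" "finite C" "card C = 9" using infinite_arbitrarily_large by blast
    then show False using bound[of C] by simp
  qed
  have sub: "{\<Gamma>. crossing_limit_cycle A_L b_L A_R b_R \<Gamma>} \<subseteq> Orb"
    by (auto simp: Orb_def crossing_limit_cycle_def)
  then have "card {\<Gamma>. crossing_limit_cycle A_L b_L A_R b_R \<Gamma>} + l \<le> 8"
    using card_mono[OF \<open>finite Orb\<close> sub] bound[of Orb] \<open>finite Orb\<close> by simp
  then show ?thesis using finite_subset[OF sub \<open>finite Orb\<close>] by linarith
qed

end
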